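(* Let $\mathcal K$ be a 2-category and $n$ a positive integer. For each $1\le m\le n$ and $1\le k\le m$ let $C_k^{(m)}:\mathsf{Wdl}^{(m)}(\overline{\mathcal K})\to\mathsf{Wdl}^{(m-1)}(\overline{\mathcal K})$ be the 2-functor $C_k$ described in the context. Then the composite 2-functor $$C^{(1)}_{k_1}\circ C^{(2)}_{k_2}\circ\cdots\circ C^{(n)}_{k_n}:\mathsf{Wdl}^{(n)}(\overline{\mathcal K})\to\mathsf{Wdl}^{(0)}(\overline{\mathcal K})=\mathsf{Mnd}(\overline{\mathcal K})$$ does not depend on the choice of the indices $k_i\in\{1,2,\dots,i\}$, $1\le i\le n$.
   Context: Conventions. For 1-cells, $uw$ is the horizontal composite ($w$ applied first); for 2-cells $\alpha,\beta$, $\alpha\beta$ is their horizontal composite; a 1-cell written next to a 2-cell means whiskering by its identity 2-cell; $\alpha.\beta$ is vertical composition ($\beta$ first). A monad $(A,t)$ has multiplication $\mu:tt\to t$ and unit $\eta:1_A\to t$; decorations of $t$ (indices, primes) carry over to $\mu,\eta$. Local idempotent closure $\overline{\mathcal K}$: same 0-cells as $\mathcal K$; 1-cells $A\to B$ are pairs $(v,\bar v)$ with $v:A\to B$ a 1-cell of $\mathcal K$ and $\bar v:v\to v$ an idempotent 2-cell; 2-cells $(v,\bar v)\to(v',\bar v')$ are 2-cells $\omega:v\to v'$ of $\mathcal K$ with $\bar v'.\omega=\omega=\omega.\bar v$; compositions are induced from $\mathcal K$ (horizontal composite of $(u,\bar u),(w,\bar w)$ is $(uw,\bar u\bar w)$),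 the identity 2-cell of $(v,\bar v)$ is $\bar v$. A monad $(A,(t,\bar t))$ in $\overline{\mathcal K}$ is given by 2-cells $\mu,\eta$ of $\mathcal K$ satisfying the monad axioms in $\overline{\mathcal K}$ (so $\mu.t\eta=\mu.\eta t=\bar t$); we often write just $t$, and write $v$ for $(v,\bar v)$. For $\mathcal L\in\{\mathcal K,\overline{\mathcal K}\}$, $\mathsf{Mnd}(\mathcal L)$ has as 0-cells the monads $(A,t)$ in $\mathcal L$; 1-cells $(A,t)\to(A',t')$ are pairs $(v,\psi)$ with $v:A\to A'$ and $\psi:t'v\to vt$ in $\mathcal L$, $\psi.\mu'v=v\mu.\psi t.t'\psi$, $\psi.\eta'v=v\eta$; 2-cells $(v,\psi)\to(v',\psi')$ are $\omega:v\to v'$ with $\psi'.t'\omega=\omega t.\psi$; the composite of $(u,\chi)$ followed by $(v,\psi)$ is $(vu,v\chi.\psi u)$. A weak distributive law in $\mathcal L$: monads $(A,t),(A,s)$ in $\mathcal L$ and a 2-cell $\lambda:ts\to st$ of $\mathcal L$ with $\lambda.\mu s=s\mu.\lambda t.t\lambda$, $\lambda.t\mu=\mu t.s\lambda.\lambda s$, $\lambda.\eta s=\mu t.s\lambda.st\eta.s\eta$, $\lambda.t\eta=s\mu.\lambda t.\eta st.\eta t$. Its idempotent is $\bar\lambda:=\mu t.s\lambda.st\eta=s\mu.\lambda t.\eta st$. For $\lambda$ in $\overline{\mathcal K}$ its weak wreath product is the monad $(A,(st,\bar\lambda))$ in $\overline{\mathcal K}$ with multiplication $\mu\mu.s\lambda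 t$ and unit $\lambda.\eta\eta$. $\mathsf{Wdl}(\mathcal L)$: 0-cells are weak distributive laws in $\mathcal L$; a 1-cell from $\lambda:ts\to st$ (on $A$) to $\lambda':t's'\to s't'$ (on $A'$) is $(v,\xi,\zeta)$ with $(v,\xi):(A,t)\to(A',t')$, $(v,\zeta):(A,s)\to(A',s')$ 1-cells of $\mathsf{Mnd}(\mathcal L)$ and $v\lambda.\xi s.t'\zeta=v\bar\lambda.\zeta t.s'\xi.\lambda'v$; 2-cells are 2-cells $\omega$ of $\mathcal L$ that are 2-cells of $\mathsf{Mnd}(\mathcal L)$ both $(v,\xi)\to(v',\xi')$ and $(v,\zeta)\to(v',\zeta')$. $\mathsf{Wdl}^{(n)}(\mathcal L)$ ($n\ge0$): a 0-cell consists of monads $(A,s_0),\dots,(A,s_n)$ in $\mathcal L$ on one object and weak distributive laws $\lambda_{i,j}:s_js_i\to s_is_j$ ($0\le i<j\le n$) satisfying the Yang–Baxter relation $\lambda_{i,j}s_k.s_j\lambda_{i,k}.\lambda_{j,k}s_i=s_i\lambda_{j,k}.\lambda_{i,k}s_j.s_k\lambda_{i,j}$ for $i<j<k$. A 1-cell to $\{\lambda'_{i,j}:s'_js'_i\to s'_is'_j\}$ (on $A'$) is $v:A\to A'$ with 2-cells $\xi_i:s'_iv\to vs_i$ such that each $(v,\xi_i)$ is a 1-cell of $\mathsf{Mnd}(\mathcal L)$ and each $(v,\xi_i,\xi_j)$, $i<j$, is a 1-cell $\lambda_{i,j}\to\lambda'_{i,j}$ of $\mathsf{Wdl}(\mathcal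 L)$; 2-cells are $\omega:v\to v'$ which are 2-cells $(v,\xi_i)\to(v',\xi'_i)$ of $\mathsf{Mnd}(\mathcal L)$ for all $i$; compositions come from $\mathcal L$. So $\mathsf{Wdl}^{(0)}(\mathcal L)=\mathsf{Mnd}(\mathcal L)$, $\mathsf{Wdl}^{(1)}(\mathcal L)=\mathsf{Wdl}(\mathcal L)$. $\bar\lambda_{ij}$ denotes the idempotent of $\lambda_{i,j}$. The 2-functor $C_k:\mathsf{Wdl}^{(m)}(\overline{\mathcal K})\to\mathsf{Wdl}^{(m-1)}(\overline{\mathcal K})$ ($1\le k\le m$): it sends a 0-cell $\{\lambda_{i,j}\}$ to the 0-cell whose monads are $s_0,\dots,s_{k-2}$, the weak wreath product $(s_{k-1}s_k,\bar\lambda_{k-1,k})$, $s_{k+1},\dots,s_m$ (in this order), with weak distributive laws: $\lambda_{i,j}$ if $i,j\notin\{k-1,k\}$; $s_{k-1}\lambda_{k,j}.\lambda_{k-1,j}s_k.s_j\bar\lambda_{k-1,k}:s_j(s_{k-1}s_k)\to(s_{k-1}s_k)s_j$ for $j>k$; $\lambda_{i,k-1}s_k.s_{k-1}\lambda_{i,k}.\bar\lambda_{k-1,k}s_i:(s_{k-1}s_k)s_i\to s_i(s_{k-1}s_k)$ for $i<k-1$. It sends a 1-cell $(v,\{\xi_i\})$ to $v$ with the 2-cells $\xi_i$ ($i<k-1$), $v\bar\lambda_{k-1,k}.\xi_{k-1}s_k.s'_{k-1}\xi_k$, and $\xi_{i}$ ($i>k$), in this order; it is the identity on 2-cells. *)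

theory Defs
  imports Main
begin

text \<open>A 2-category with 0-cells of type 'o, 1-cells of type 'a and 2-cells of type 'c.
  comp1 u w is the horizontal composite uw (w applied first);
  vcomp a b is the vertical composite a.b (b first);
  hcomp a b is the horizontal composite of 2-cells (b first).\<close>

record ('o, 'a, 'c) tcat =
  tc_ob :: "'o set"
  tc_arr1 :: "'a set"
  tc_arr2 :: "'c set"
  tc_src :: "'a \<Rightarrow> 'o"
  tc_trg :: "'a \<Rightarrow> 'o"
  tc_dom :: "'c \<Rightarrow> 'a"
  tc_cod :: "'c \<Rightarrow> 'a"
  tc_id1 :: "'o \<Rightarrow> 'a"
  tc_id2 :: "'a \<Rightarrow> 'c"
  tc_comp1 :: "'a \<Rightarrow> 'a \<Rightarrow> 'a"
  tc_vcomp :: "'c \<Rightarrow> 'c \<Rightarrow> 'c"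
  tc_hcomp :: "'c \<Rightarrow> 'c \<Rightarrow> 'c"

definition twocat :: "('o, 'a, 'c) tcat \<Rightarrow> bool" where
  "twocat K \<longleftrightarrow>
    (\<forall>v\<in>tc_arr1 K. tc_src K v \<in> tc_ob K \<and> tc_trg K v \<in> tc_ob K) \<and>
    (\<forall>A\<in>tc_ob K. tc_id1 K A \<in> tc_arr1 K \<and> tc_src K (tc_id1 K A) = A \<and> tc_trg K (tc_id1 K A) = A) \<and>
    (\<forall>u\<in>tc_arr1 K. \<forall>w\<in>tc_arr1 K. tc_src K u = tc_trg K w \<longrightarrow>
        tc_comp1 K u w \<in> tc_arr1 K \<and> tc_src K (tc_comp1 K u w) = tc_src K w \<and>
        tc_trg K (tc_comp1 K u w) = tc_trg K u) \<and>
    (\<forall>u\<in>tc_arr1 K. \<forall>v\<in>tc_arr1 K. \<forall>w\<in>tc_arr1 K.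
        tc_src K u = tc_trg K v \<and> tc_src K v = tc_trg K w \<longrightarrow>
        tc_comp1 K (tc_comp1 K u v) w = tc_comp1 K u (tc_comp1 K v w)) \<and>
    (\<forall>v\<in>tc_arr1 K. tc_comp1 K (tc_id1 K (tc_trg K v)) v = v \<and> tc_comp1 K v (tc_id1 K (tc_src K v)) = v) \<and>
    (\<forall>\<alpha>\<in>tc_arr2 K. tc_dom K \<alpha> \<in> tc_arr1 K \<and> tc_cod K \<alpha> \<in> tc_arr1 K \<and>
        tc_src K (tc_dom K \<alpha>) = tc_src K (tc_cod K \<alpha>) \<and> tc_trg K (tc_dom K \<alpha>) = tc_trg K (tc_cod K \<alpha>)) \<and>
    (\<forall>v\<in>tc_arr1 K. tc_id2 K v \<in> tc_arr2 K \<and> tc_dom K (tc_id2 K v) = v \<and> tc_cod K (tc_id2 K v) = v) \<and>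
    (\<forall>\<alpha>\<in>tc_arr2 K. \<forall>\<beta>\<in>tc_arr2 K. tc_dom K \<alpha> = tc_cod K \<beta> \<longrightarrow>
        tc_vcomp K \<alpha> \<beta> \<in> tc_arr2 K \<and> tc_dom K (tc_vcomp K \<alpha> \<beta>) = tc_dom K \<beta> \<and>
        tc_cod K (tc_vcomp K \<alpha> \<beta>) = tc_cod K \<alpha>) \<and>
    (\<forall>\<alpha>\<in>tc_arr2 K. \<forall>\<beta>\<in>tc_arr2 K. \<forall>\<gamma>\<in>tc_arr2 K.
        tc_dom K \<alpha> = tc_cod K \<beta> \<and> tc_dom K \<beta> = tc_cod K \<gamma> \<longrightarrow>
        tc_vcomp K (tc_vcomp K \<alpha> \<beta>) \<gamma> = tc_vcomp K \<alpha> (tc_vcomp K \<beta> \<gamma>)) \<and>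
    (\<forall>\<alpha>\<in>tc_arr2 K. tc_vcomp K (tc_id2 K (tc_cod K \<alpha>)) \<alpha> = \<alpha> \<and> tc_vcomp K \<alpha> (tc_id2 K (tc_dom K \<alpha>)) = \<alpha>) \<and>
    (\<forall>\<alpha>\<in>tc_arr2 K. \<forall>\<beta>\<in>tc_arr2 K. tc_src K (tc_dom K \<alpha>) = tc_trg K (tc_dom K \<beta>) \<longrightarrow>
        tc_hcomp K \<alpha> \<beta> \<in> tc_arr2 K \<and>
        tc_dom K (tc_hcomp K \<alpha> \<beta>) = tc_comp1 K (tc_dom K \<alpha>) (tc_dom K \<beta>) \<and>
        tc_cod K (tc_hcomp K \<alpha> \<beta>) = tc_comp1 K (tc_cod K \<alpha>) (tc_cod K \<beta>)) \<and>
    (\<forall>\<alpha>\<in>tc_arr2 K. \<forall>\<beta>\<in>tc_arr2 K. \<forall>\<gamma>\<in>tc_arr2 K.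
        tc_src K (tc_dom K \<alpha>) = tc_trg K (tc_dom K \<beta>) \<and> tc_src K (tc_dom K \<beta>) = tc_trg K (tc_dom K \<gamma>) \<longrightarrow>
        tc_hcomp K (tc_hcomp K \<alpha> \<beta>) \<gamma> = tc_hcomp K \<alpha> (tc_hcomp K \<beta> \<gamma>)) \<and>
    (\<forall>u\<in>tc_arr1 K. \<forall>w\<in>tc_arr1 K. tc_src K u = tc_trg K w \<longrightarrow>
        tc_hcomp K (tc_id2 K u) (tc_id2 K w) = tc_id2 K (tc_comp1 K u w)) \<and>
    (\<forall>\<alpha>\<in>tc_arr2 K. tc_hcomp K (tc_id2 K (tc_id1 K (tc_trg K (tc_dom K \<alpha>)))) \<alpha> = \<alpha> \<and>
        tc_hcomp K \<alpha> (tc_id2 K (tc_id1 K (tc_src K (tc_dom K \<alpha>)))) = \<alpha>) \<and>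
    (\<forall>\<alpha>\<in>tc_arr2 K. \<forall>\<beta>\<in>tc_arr2 K. \<forall>\<gamma>\<in>tc_arr2 K. \<forall>\<delta>\<in>tc_arr2 K.
        tc_dom K \<alpha> = tc_cod K \<beta> \<and> tc_dom K \<gamma> = tc_cod K \<delta> \<and>
        tc_src K (tc_dom K \<alpha>) = tc_trg K (tc_dom K \<gamma>) \<longrightarrow>
        tc_hcomp K (tc_vcomp K \<alpha> \<beta>) (tc_vcomp K \<gamma> \<delta>) =
        tc_vcomp K (tc_hcomp K \<alpha> \<gamma>) (tc_hcomp K \<beta> \<delta>))"

definition wl :: "('o, 'a, 'c) tcat \<Rightarrow> 'a \<Rightarrow> 'c \<Rightarrow> 'c" where
  "wl L u \<alpha> = tc_hcomp L (tc_id2 L u) \<alpha>"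
definition wr :: "('o, 'a, 'c) tcat \<Rightarrow> 'c \<Rightarrow> 'a \<Rightarrow> 'c" where
  "wr L \<alpha> u = tc_hcomp L \<alpha> (tc_id2 L u)"

definition lic :: "('o, 'a, 'c) tcat \<Rightarrow> ('o, 'a \<times> 'c, 'c \<times> ('a \<times> 'c) \<times> ('a \<times> 'c)) tcat" where
  "lic K = \<lparr>
    tc_ob = tc_ob K,
    tc_arr1 = {(v, vb). v \<in> tc_arr1 K \<and> vb \<in> tc_arr2 K \<and> tc_dom K vb = v \<and> tc_cod K vb = v \<and>
                         tc_vcomp K vb vb = vb},
    tc_arr2 = {(\<omega>, (v, vb), (v', vb')).
                 v \<in> tc_arr1 K \<and> vb \<in> tc_arr2 K \<and> tc_dom K vb = v \<and> tc_cod K vb = v \<and> tc_vcomp K vb vb = vb \<and>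
                 v' \<in> tc_arr1 K \<and> vb' \<in> tc_arr2 K \<and> tc_dom K vb' = v' \<and> tc_cod K vb' = v' \<and> tc_vcomp K vb' vb' = vb' \<and>
                 \<omega> \<in> tc_arr2 K \<and> tc_dom K \<omega> = v \<and> tc_cod K \<omega> = v' \<and>
                 tc_vcomp K vb' \<omega> = \<omega> \<and> tc_vcomp K \<omega> vb = \<omega>},
    tc_src = (\<lambda>(v, vb). tc_src K v),
    tc_trg = (\<lambda>(v, vb). tc_trg K v),
    tc_dom = (\<lambda>(\<omega>, x, y). x),
    tc_cod = (\<lambda>(\<omega>, x, y). y),
    tc_id1 = (\<lambda>A. (tc_id1 K A, tc_id2 K (tc_id1 K A))),
    tc_id2 = (\<lambda>(v, vb). (vb, (v, vb), (v, vb))),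
    tc_comp1 = (\<lambda>(u, ub) (w, wb). (tc_comp1 K u w, tc_hcomp K ub wb)),
    tc_vcomp = (\<lambda>(\<omega>, x, y) (\<omega>', x', y'). (tc_vcomp K \<omega> \<omega>', x', y)),
    tc_hcomp = (\<lambda>(\<alpha>, (u, ub), (u', ub')) (\<beta>, (w, wb), (w', wb')).
                  (tc_hcomp K \<alpha> \<beta>, (tc_comp1 K u w, tc_hcomp K ub wb), (tc_comp1 K u' w', tc_hcomp K ub' wb')))
  \<rparr>"

definition retype :: "'c \<times> ('a \<times> 'c) \<times> ('a \<times> 'c) \<Rightarrow> 'a \<times> 'c \<Rightarrow> 'a \<times> 'c \<Rightarrow> 'c \<times> ('a \<times> 'c) \<times> ('a \<times> 'c)" where
  "retype \<omega> x y = (fst \<omega>, x, y)"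

definition is_monad :: "('o, 'a, 'c) tcat \<Rightarrow> 'o \<Rightarrow> 'a \<times> 'c \<times> 'c \<Rightarrow> bool" where
  "is_monad L A m = (case m of (t, \<mu>, \<eta>) \<Rightarrow>
     A \<in> tc_ob L \<and> t \<in> tc_arr1 L \<and> tc_src L t = A \<and> tc_trg L t = A \<and>
     \<mu> \<in> tc_arr2 L \<and> tc_dom L \<mu> = tc_comp1 L t t \<and> tc_cod L \<mu> = t \<and>
     \<eta> \<in> tc_arr2 L \<and> tc_dom L \<eta> = tc_id1 L A \<and> tc_cod L \<eta> = t \<and>
     tc_vcomp L \<mu> (wr L \<mu> t) = tc_vcomp L \<mu> (wl L t \<mu>) \<and>
     tc_vcomp L \<mu> (wl L t \<eta>) = tc_id2 L t \<and>
     tc_vcomp L \<mu> (wr L \<eta> t) = tc_id2 L t)"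

definition is_wdl :: "('o, 'a, 'c) tcat \<Rightarrow> 'o \<Rightarrow> 'a \<times> 'c \<times> 'c \<Rightarrow> 'a \<times> 'c \<times> 'c \<Rightarrow> 'c \<Rightarrow> bool" where
  "is_wdl L A tm sm lam = (case tm of (t, \<mu>t, \<eta>t) \<Rightarrow> case sm of (s, \<mu>s, \<eta>s) \<Rightarrow>
     is_monad L A tm \<and> is_monad L A sm \<and>
     lam \<in> tc_arr2 L \<and> tc_dom L lam = tc_comp1 L t s \<and> tc_cod L lam = tc_comp1 L s t \<and>
     tc_vcomp L lam (wr L \<mu>t s) = tc_vcomp L (wl L s \<mu>t) (tc_vcomp L (wr L lam t) (wl L t lam)) \<and>
     tc_vcomp L lam (wl L t \<mu>s) = tc_vcomp L (wr L \<mu>s t) (tc_vcomp L (wl L s lam) (wr L lam s)) \<and>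
     tc_vcomp L lam (wr L \<eta>t s) =
       tc_vcomp L (wr L \<mu>s t) (tc_vcomp L (wl L s lam) (tc_vcomp L (wl L (tc_comp1 L s t) \<eta>s) (wl L s \<eta>t))) \<and>
     tc_vcomp L lam (wl L t \<eta>s) =
       tc_vcomp L (wl L s \<mu>t) (tc_vcomp L (wr L lam t) (tc_vcomp L (wr L \<eta>t (tc_comp1 L s t)) (wr L \<eta>s t))))"

definition lambar :: "('o, 'a, 'c) tcat \<Rightarrow> 'a \<times> 'c \<times> 'c \<Rightarrow> 'a \<times> 'c \<times> 'c \<Rightarrow> 'c \<Rightarrow> 'c" where
  "lambar L tm sm lam = (case tm of (t, \<mu>t, \<eta>t) \<Rightarrow> case sm of (s, \<mu>s, \<eta>s) \<Rightarrow>
     tc_vcomp L (wr L \<mu>s t) (tc_vcomp L (wl L s lam) (wl L (tc_comp1 L s t) \<eta>s)))"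

definition is_mnd_mor :: "('o, 'a, 'c) tcat \<Rightarrow> 'a \<times> 'c \<times> 'c \<Rightarrow> 'a \<times> 'c \<times> 'c \<Rightarrow> 'a \<Rightarrow> 'c \<Rightarrow> bool" where
  "is_mnd_mor L tm tm' v \<psi> = (case tm of (t, \<mu>, \<eta>) \<Rightarrow> case tm' of (t', \<mu>', \<eta>') \<Rightarrow>
     v \<in> tc_arr1 L \<and> \<psi> \<in> tc_arr2 L \<and>
     tc_dom L \<psi> = tc_comp1 L t' v \<and> tc_cod L \<psi> = tc_comp1 L v t \<and>
     tc_vcomp L \<psi> (wr L \<mu>' v) = tc_vcomp L (wl L v \<mu>) (tc_vcomp L (wr L \<psi> t) (wl L t' \<psi>)) \<and>
     tc_vcomp L \<psi> (wr L \<eta>' v) = wl L v \<eta>)"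

definition wdl_mor_cond :: "('o, 'a, 'c) tcat \<Rightarrow> 'a \<times> 'c \<times> 'c \<Rightarrow> 'a \<times> 'c \<times> 'c \<Rightarrow> 'c \<Rightarrow>
    'a \<times> 'c \<times> 'c \<Rightarrow> 'a \<times> 'c \<times> 'c \<Rightarrow> 'c \<Rightarrow> 'a \<Rightarrow> 'c \<Rightarrow> 'c \<Rightarrow> bool" where
  "wdl_mor_cond L tm sm lam tm' sm' lam' v \<xi> \<zeta> =
     (tc_vcomp L (wl L v lam) (tc_vcomp L (wr L \<xi> (fst sm)) (wl L (fst tm') \<zeta>)) =
      tc_vcomp L (wl L v (lambar L tm sm lam))
        (tc_vcomp L (wr L \<zeta> (fst tm)) (tc_vcomp L (wl L (fst sm') \<xi>) (wr L lam' v))))"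

text \<open>A 0-cell: an object, monads s_0,...,s_m (a list of length m+1) and the laws
  wlam i j : s_j s_i -> s_i s_j for i < j <= m (other values irrelevant).\<close>

record ('o, 'a, 'c) wobj =
  wA :: 'o
  wmon :: "('a \<times> 'c \<times> 'c) list"
  wlam :: "nat \<Rightarrow> nat \<Rightarrow> 'c"

definition is_wobj :: "('o, 'a, 'c) tcat \<Rightarrow> nat \<Rightarrow> ('o, 'a, 'c) wobj \<Rightarrow> bool" where
  "is_wobj L m X \<longleftrightarrow>
     length (wmon X) = Suc m \<and>
     (\<forall>i\<le>m. is_monad L (wA X) (wmon X ! i)) \<and>
     (\<forall>i j. i < j \<and> j \<le> m \<longrightarrow> is_wdl L (wA X) (wmon X ! j) (wmon X ! i) (wlam X i j)) \<and>
     (\<forall>i j k. i < j \<and> j < k \<and> k \<le> m \<longrightarrow>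
        (let si = fst (wmon X ! i); sj = fst (wmon X ! j); sk = fst (wmon X ! k) in
         tc_vcomp L (wr L (wlam X i j) sk) (tc_vcomp L (wl L sj (wlam X i k)) (wr L (wlam X j k) si)) =
         tc_vcomp L (wl L si (wlam X j k)) (tc_vcomp L (wr L (wlam X i k) sj) (wl L sk (wlam X i j)))))"

record ('o, 'a, 'c) wmor =
  wsrc :: "('o, 'a, 'c) wobj"
  wtrg :: "('o, 'a, 'c) wobj"
  wv :: 'a
  wxi :: "'c list"

definition is_wmor :: "('o, 'a, 'c) tcat \<Rightarrow> nat \<Rightarrow> ('o, 'a, 'c) wmor \<Rightarrow> bool" where
  "is_wmor L m f \<longleftrightarrow>
     is_wobj L m (wsrc f) \<and> is_wobj L m (wtrg f) \<and>
     wv f \<in> tc_arr1 L \<and> tc_src L (wv f) = wA (wsrc f) \<and> tc_trg L (wv f) = wA (wtrg f) \<and>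
     length (wxi f) = Suc m \<and>
     (\<forall>i\<le>m. is_mnd_mor L (wmon (wsrc f) ! i) (wmon (wtrg f) ! i) (wv f) (wxi f ! i)) \<and>
     (\<forall>i j. i < j \<and> j \<le> m \<longrightarrow>
        wdl_mor_cond L (wmon (wsrc f) ! j) (wmon (wsrc f) ! i) (wlam (wsrc f) i j)
                       (wmon (wtrg f) ! j) (wmon (wtrg f) ! i) (wlam (wtrg f) i j)
                       (wv f) (wxi f ! j) (wxi f ! i))"

record ('o, 'a, 'c) w2cell =
  w2s :: "('o, 'a, 'c) wmor"
  w2c :: 'c
  w2t :: "('o, 'a, 'c) wmor"

definition is_w2cell :: "('o, 'a, 'c) tcat \<Rightarrow> nat \<Rightarrow> ('o, 'a, 'c) w2cell \<Rightarrow> bool" where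
  "is_w2cell L m \<alpha> \<longleftrightarrow>
     is_wmor L m (w2s \<alpha>) \<and> is_wmor L m (w2t \<alpha>) \<and>
     wsrc (w2s \<alpha>) = wsrc (w2t \<alpha>) \<and> wtrg (w2s \<alpha>) = wtrg (w2t \<alpha>) \<and>
     w2c \<alpha> \<in> tc_arr2 L \<and> tc_dom L (w2c \<alpha>) = wv (w2s \<alpha>) \<and> tc_cod L (w2c \<alpha>) = wv (w2t \<alpha>) \<and>
     (\<forall>i\<le>m. tc_vcomp L (wxi (w2t \<alpha>) ! i) (wl L (fst (wmon (wtrg (w2s \<alpha>)) ! i)) (w2c \<alpha>)) =
             tc_vcomp L (wr L (w2c \<alpha>) (fst (wmon (wsrc (w2s \<alpha>)) ! i))) (wxi (w2s \<alpha>) ! i))"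

type_synonym ('a, 'c) l1 = "'a \<times> 'c"
type_synonym ('a, 'c) l2 = "'c \<times> ('a \<times> 'c) \<times> ('a \<times> 'c)"
type_synonym ('a, 'c) lmon = "('a, 'c) l1 \<times> ('a, 'c) l2 \<times> ('a, 'c) l2"

definition wreath :: "('o, 'a, 'c) tcat \<Rightarrow> 'o \<Rightarrow> ('a, 'c) lmon \<Rightarrow> ('a, 'c) lmon \<Rightarrow> ('a, 'c) l2 \<Rightarrow> ('a, 'c) lmon" where
  "wreath K A tm sm lam = (let L = lic K in
     case tm of (t, \<mu>t, \<eta>t) \<Rightarrow> case sm of (s, \<mu>s, \<eta>s) \<Rightarrow>
     (let u = (tc_comp1 K (fst s) (fst t), fst (lambar L tm sm lam)) in
      (u,
       retype (tc_vcomp L (tc_hcomp L \<mu>s \<mu>t) (wl L s (wr L lam t))) (tc_comp1 L u u) u,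
       retype (tc_vcomp L lam (tc_hcomp L \<eta>t \<eta>s)) (tc_id1 L A) u)))"

text \<open>Old index of a new (unmerged) index after merging positions k-1 and k.\<close>

definition oldidx :: "nat \<Rightarrow> nat \<Rightarrow> nat" where
  "oldidx k i = (if i < k - 1 then i else Suc i)"

definition Cobj :: "('o, 'a, 'c) tcat \<Rightarrow> nat \<Rightarrow> ('o, 'a \<times> 'c, ('a, 'c) l2) wobj \<Rightarrow> ('o, 'a \<times> 'c, ('a, 'c) l2) wobj" where
  "Cobj K k X = (let L = lic K; A = wA X; ms = wmon X; lam = wlam X; s = (\<lambda>i. ms ! i);
      lb = lambar L (s k) (s (k - 1)) (lam (k - 1) k);
      u = fst (wreath K A (s k) (s (k - 1)) (lam (k - 1) k));
      sk1 = fst (s (k - 1)); sk = fst (s k);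
      newms = take (k - 1) ms @ [wreath K A (s k) (s (k - 1)) (lam (k - 1) k)] @ drop (Suc k) ms in
    \<lparr> wA = A,
      wmon = newms,
      wlam = (\<lambda>i j.
        if i < j \<and> j < length newms then
          (if i = k - 1 then
             (let j' = Suc j; sj = fst (s j') in
              retype (tc_vcomp L (wl L sk1 (lam k j'))
                        (tc_vcomp L (wr L (lam (k - 1) j') sk) (wl L sj lb)))
                     (tc_comp1 L sj u) (tc_comp1 L u sj))
           else if j = k - 1 then
             (let si = fst (s i) in
              retype (tc_vcomp L (wr L (lam i (k - 1)) sk)
                        (tc_vcomp L (wl L sk1 (lam i k)) (wr L lb si)))
                     (tc_comp1 L u si) (tc_comp1 L si u))
           else lam (oldidx k i) (oldidx k j))
        else undefined) \<rparr>)"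

definition Cmor :: "('o, 'a, 'c) tcat \<Rightarrow> nat \<Rightarrow> ('o, 'a \<times> 'c, ('a, 'c) l2) wmor \<Rightarrow> ('o, 'a \<times> 'c, ('a, 'c) l2) wmor" where
  "Cmor K k f = (let L = lic K; X = wsrc f; Y = wtrg f; v = wv f; xi = wxi f;
      lb = lambar L (wmon X ! k) (wmon X ! (k - 1)) (wlam X (k - 1) k);
      u = fst (wreath K (wA X) (wmon X ! k) (wmon X ! (k - 1)) (wlam X (k - 1) k));
      u' = fst (wreath K (wA Y) (wmon Y ! k) (wmon Y ! (k - 1)) (wlam Y (k - 1) k));
      newxi = retype (tc_vcomp L (wl L v lb)
                        (tc_vcomp L (wr L (xi ! (k - 1)) (fst (wmon X ! k)))
                                    (wl L (fst (wmon Y ! (k - 1))) (xi ! k))))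
                     (tc_comp1 L u' v) (tc_comp1 L v u) in
    \<lparr> wsrc = Cobj K k X, wtrg = Cobj K k Y, wv = v,
      wxi = take (k - 1) xi @ [newxi] @ drop (Suc k) xi \<rparr>)"

definition C2cell :: "('o, 'a, 'c) tcat \<Rightarrow> nat \<Rightarrow> ('o, 'a \<times> 'c, ('a, 'c) l2) w2cell \<Rightarrow> ('o, 'a \<times> 'c, ('a, 'c) l2) w2cell" where
  "C2cell K k \<alpha> = \<lparr> w2s = Cmor K k (w2s \<alpha>), w2c = w2c \<alpha>, w2t = Cmor K k (w2t \<alpha>) \<rparr>"

text \<open>Admissible index sequences [k_1, ..., k_n] with k_i in {1..i}; the composite
  C_{k_1} o C_{k_2} o ... o C_{k_n} is foldr.\<close>

definition admissible :: "nat \<Rightarrow> nat list \<Rightarrow> bool" where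
  "admissible n ks \<longleftrightarrow> length ks = n \<and> (\<forall>i<n. 1 \<le> ks ! i \<and> ks ! i \<le> Suc i)"

end

(* The idempotent of a weak wreath product is determined by its multiplication and unit, and a
   2-cell of the closure is a 2-cell of K that absorbs the idempotents of its ends. So all
   properties of merged monads are equations between string diagrams in the original monads, in
   which the identity of a merged 1-cell is replaced by the idempotent of its law.

   For three consecutive monads a, b, c both ways of merging give the same idempotent on abc: both
   idempotents are left a-linear and right c-linear, hence determined by their restriction to b
   along the units of a and c, and there the Yang-Baxter relation identifies them. Equality of
   multiplications, units and induced laws follows.

   Since the C_k preserve all axioms, it suffices that C_1 C_{l+1} = C_l C_1 for l > 0: by
   induction on n every composite then equals C_1 ... C_1. *)

theory Submission
  imports Defs
begin

section \<open>Strict 2-categories and the local idempotent closure\<close>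

text \<open>Composition in \<open>tcat\<close> is partial, so each use of associativity or
  interchange carries typing conditions, and the diagrams to be compared have a dozen or more
  generators. Moreover a weak law is not unital: its idempotent takes the place of every identity of
  a merged 1-cell and has to be created, moved and absorbed throughout. The equations are therefore
  not proved inside the 2-category. A diagram is encoded as a list of slices and a derivation as a
  list of rewrite steps; a computed check of the steps is justified once and for all, and every
  later equation costs only its step list. A single parametrized system of monads covers a 0-cell as
  well as a 1-cell with both of its ends, so that all rules are derived once. Commuting only
  \<open>C_1\<close> with \<open>C_{l+1}\<close> leaves two situations. For \<open>l = 1\<close> the
  merges overlap in three consecutive monads, which is where associativity of merging enters; for
  \<open>l > 1\<close> the pairs are disjoint, and the one law obtained in two different ways is the
  law between the two merged monads.\<close>

locale two_category =
  fixes L :: "('o, 'a, 'c) tcat"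
  assumes twocat: "twocat L"
begin

abbreviation comp1 (infixr "\<circ>\<^sub>1" 75) where "comp1 \<equiv> tc_comp1 L"
abbreviation vcomp (infixr "\<cdot>" 65) where "vcomp \<equiv> tc_vcomp L"
abbreviation hcomp (infixr "\<star>" 70) where "hcomp \<equiv> tc_hcomp L"

lemmas rest0 = twocat[unfolded twocat_def]
lemmas ax1 = rest0[THEN conjunct1] and rest1 = rest0[THEN conjunct2]
lemmas ax2 = rest1[THEN conjunct1] and rest2 = rest1[THEN conjunct2]
lemmas ax3 = rest2[THEN conjunct1] and rest3 = rest2[THEN conjunct2]
lemmas ax4 = rest3[THEN conjunct1] and rest4 = rest3[THEN conjunct2]
lemmas ax5 = rest4[THEN conjunct1] and rest5 = rest4[THEN conjunct2]
lemmas ax6 = rest5[THEN conjunct1] and rest6 = rest5[THEN conjunct2]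
lemmas ax7 = rest6[THEN conjunct1] and rest7 = rest6[THEN conjunct2]
lemmas ax8 = rest7[THEN conjunct1] and rest8 = rest7[THEN conjunct2]
lemmas ax9 = rest8[THEN conjunct1] and rest9 = rest8[THEN conjunct2]
lemmas ax10 = rest9[THEN conjunct1] and rest10 = rest9[THEN conjunct2]
lemmas ax11 = rest10[THEN conjunct1] and rest11 = rest10[THEN conjunct2]
lemmas ax12 = rest11[THEN conjunct1] and rest12 = rest11[THEN conjunct2]
lemmas ax13 = rest12[THEN conjunct1] and rest13 = rest12[THEN conjunct2]
lemmas ax14 = rest13[THEN conjunct1] and rest14 = rest13[THEN conjunct2]

lemma src_ob [simp]: "v \<in> tc_arr1 L \<Longrightarrow> tc_src L v \<in> tc_ob L"
  and trg_ob [simp]: "v \<in> tc_arr1 L \<Longrightarrow> tc_trg L v \<in> tc_ob L"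
  and id1_arr [simp]: "A \<in> tc_ob L \<Longrightarrow> tc_id1 L A \<in> tc_arr1 L"
  and id1_src [simp]: "A \<in> tc_ob L \<Longrightarrow> tc_src L (tc_id1 L A) = A"
  and id1_trg [simp]: "A \<in> tc_ob L \<Longrightarrow> tc_trg L (tc_id1 L A) = A"
  using ax1 ax2 by meson+

lemma comp1_arr [simp]:
    "\<lbrakk>u \<in> tc_arr1 L; w \<in> tc_arr1 L; tc_src L u = tc_trg L w\<rbrakk> \<Longrightarrow> u
        \<circ>\<^sub>1 w \<in> tc_arr1 L"
  and comp1_src [simp]:
    "\<lbrakk>u \<in> tc_arr1 L; w \<in> tc_arr1 L; tc_src L u = tc_trg L w\<rbrakk> \<Longrightarrow> tc_src L (u
        \<circ>\<^sub>1 w) = tc_src L w"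
  and comp1_trg [simp]:
    "\<lbrakk>u \<in> tc_arr1 L; w \<in> tc_arr1 L; tc_src L u = tc_trg L w\<rbrakk> \<Longrightarrow> tc_trg L (u
        \<circ>\<^sub>1 w) = tc_trg L u"
  using ax3 by meson+

lemma comp1_assoc:
    "\<lbrakk>u \<in> tc_arr1 L; v \<in> tc_arr1 L; w \<in> tc_arr1 L; tc_src L u = tc_trg L v; tc_src L v = tc_trg L
        w\<rbrakk>
      \<Longrightarrow> (u \<circ>\<^sub>1 v) \<circ>\<^sub>1 w = u \<circ>\<^sub>1 v \<circ>\<^sub>1 w"
  using ax4 by meson

lemma comp1_id_left [simp]:
    "\<lbrakk>v \<in> tc_arr1 L; tc_trg L v = B\<rbrakk> \<Longrightarrow> tc_id1 L B \<circ>\<^sub>1 v = v"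
  and comp1_id_right [simp]:
    "\<lbrakk>v \<in> tc_arr1 L; tc_src L v = A\<rbrakk> \<Longrightarrow> v \<circ>\<^sub>1 tc_id1 L A = v"
  using ax5 by meson+

lemma dom_arr [simp]: "\<alpha> \<in> tc_arr2 L \<Longrightarrow> tc_dom L \<alpha> \<in> tc_arr1 L"
  and cod_arr [simp]: "\<alpha> \<in> tc_arr2 L \<Longrightarrow> tc_cod L \<alpha> \<in> tc_arr1 L"
  and src_cod: "\<alpha> \<in> tc_arr2 L \<Longrightarrow> tc_src L (tc_cod L \<alpha>) = tc_src L (tc_dom L \<alpha>)"
  and trg_cod: "\<alpha> \<in> tc_arr2 L \<Longrightarrow> tc_trg L (tc_cod L \<alpha>) = tc_trg L (tc_dom L \<alpha>)"
  using ax6 by metis+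

lemma id2_arr [simp]: "v \<in> tc_arr1 L \<Longrightarrow> tc_id2 L v \<in> tc_arr2 L"
  and id2_dom [simp]: "v \<in> tc_arr1 L \<Longrightarrow> tc_dom L (tc_id2 L v) = v"
  and id2_cod [simp]: "v \<in> tc_arr1 L \<Longrightarrow> tc_cod L (tc_id2 L v) = v"
  using ax7 by meson+

lemma vcomp_arr [simp]:
    "\<lbrakk>\<alpha> \<in> tc_arr2 L; \<beta> \<in> tc_arr2 L; tc_dom L \<alpha> = tc_cod L \<beta>\<rbrakk>
        \<Longrightarrow> \<alpha> \<cdot> \<beta> \<in> tc_arr2 L"
  and vcomp_dom [simp]:
    "\<lbrakk>\<alpha> \<in> tc_arr2 L; \<beta> \<in> tc_arr2 L; tc_dom L \<alpha> = tc_cod L \<beta>\<rbrakk>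
        \<Longrightarrow> tc_dom L (\<alpha> \<cdot> \<beta>) = tc_dom L \<beta>"
  and vcomp_cod [simp]:
    "\<lbrakk>\<alpha> \<in> tc_arr2 L; \<beta> \<in> tc_arr2 L; tc_dom L \<alpha> = tc_cod L \<beta>\<rbrakk>
        \<Longrightarrow> tc_cod L (\<alpha> \<cdot> \<beta>) = tc_cod L \<alpha>"
  using ax8 by meson+

lemma vcomp_assoc:
    "\<lbrakk>\<alpha> \<in> tc_arr2 L; \<beta> \<in> tc_arr2 L; \<gamma> \<in> tc_arr2 L; tc_dom L \<alpha> = tc_cod
        L \<beta>; tc_dom L \<beta> = tc_cod L \<gamma>\<rbrakk>
      \<Longrightarrow> (\<alpha> \<cdot> \<beta>) \<cdot> \<gamma> = \<alpha> \<cdot> \<beta> \<cdot> \<gamma>"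
  using ax9 by meson

lemma vcomp_id_left [simp]: "\<lbrakk>\<alpha> \<in> tc_arr2 L; tc_cod L \<alpha> = v\<rbrakk> \<Longrightarrow>
    tc_id2 L v \<cdot> \<alpha> = \<alpha>"
  and vcomp_id_right [simp]: "\<lbrakk>\<alpha> \<in> tc_arr2 L; tc_dom L \<alpha> = v\<rbrakk> \<Longrightarrow>
      \<alpha> \<cdot> tc_id2 L v = \<alpha>"
  using ax10 by meson+

lemma hcomp_arr [simp]:
    "\<lbrakk>\<alpha> \<in> tc_arr2 L; \<beta> \<in> tc_arr2 L; tc_src L (tc_dom L \<alpha>) = tc_trg L (tc_dom L
        \<beta>)\<rbrakk>
      \<Longrightarrow> \<alpha> \<star> \<beta> \<in> tc_arr2 L"
  and hcomp_dom [simp]: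
    "\<lbrakk>\<alpha> \<in> tc_arr2 L; \<beta> \<in> tc_arr2 L; tc_src L (tc_dom L \<alpha>) = tc_trg L (tc_dom L
        \<beta>)\<rbrakk>
      \<Longrightarrow> tc_dom L (\<alpha> \<star> \<beta>) = tc_dom L \<alpha> \<circ>\<^sub>1 tc_dom L \<beta>"
  and hcomp_cod [simp]:
    "\<lbrakk>\<alpha> \<in> tc_arr2 L; \<beta> \<in> tc_arr2 L; tc_src L (tc_dom L \<alpha>) = tc_trg L (tc_dom L
        \<beta>)\<rbrakk>
      \<Longrightarrow> tc_cod L (\<alpha> \<star> \<beta>) = tc_cod L \<alpha> \<circ>\<^sub>1 tc_cod L \<beta>"
  using ax11 by meson+

lemma hcomp_assoc:
    "\<lbrakk>\<alpha> \<in> tc_arr2 L; \<beta> \<in> tc_arr2 L; \<gamma> \<in> tc_arr2 L;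
      tc_src L (tc_dom L \<alpha>) = tc_trg L (tc_dom L \<beta>); tc_src L (tc_dom L \<beta>) = tc_trg L (tc_dom L
          \<gamma>)\<rbrakk>
      \<Longrightarrow> (\<alpha> \<star> \<beta>) \<star> \<gamma> = \<alpha> \<star> \<beta> \<star> \<gamma>"
  using ax12 by meson

lemma hcomp_id2:
    "\<lbrakk>u \<in> tc_arr1 L; w \<in> tc_arr1 L; tc_src L u = tc_trg L w\<rbrakk>
      \<Longrightarrow> tc_id2 L u \<star> tc_id2 L w = tc_id2 L (u \<circ>\<^sub>1 w)"
  using ax13 by meson

lemma hcomp_id_left [simp]:
    "\<lbrakk>\<alpha> \<in> tc_arr2 L; tc_trg L (tc_dom L \<alpha>) = B\<rbrakk> \<Longrightarrow> tc_id2 L (tc_id1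
        L B) \<star> \<alpha> = \<alpha>"
  and hcomp_id_right [simp]:
    "\<lbrakk>\<alpha> \<in> tc_arr2 L; tc_src L (tc_dom L \<alpha>) = A\<rbrakk> \<Longrightarrow> \<alpha> \<star>
        tc_id2 L (tc_id1 L A) = \<alpha>"
  using ax14 by meson+

lemma interchange:
    "\<lbrakk>\<alpha> \<in> tc_arr2 L; \<beta> \<in> tc_arr2 L; \<gamma> \<in> tc_arr2 L; \<delta> \<in> tc_arr2 L;
      tc_dom L \<alpha> = tc_cod L \<beta>; tc_dom L \<gamma> = tc_cod L \<delta>; tc_src L (tc_dom L \<alpha>) =
          tc_trg L (tc_dom L \<gamma>)\<rbrakk>
      \<Longrightarrow> (\<alpha> \<cdot> \<beta>) \<star> (\<gamma> \<cdot> \<delta>) = (\<alpha> \<star> \<gamma>)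
          \<cdot> (\<beta> \<star> \<delta>)"
  using rest14 by meson

end

section \<open>The local idempotent closure as a 2-category\<close>

lemma lic_simps [simp]:
  "tc_ob (lic K) = tc_ob K"
  "tc_src (lic K) u = tc_src K (fst u)"
  "tc_trg (lic K) u = tc_trg K (fst u)"
  "tc_dom (lic K) x = fst (snd x)"
  "tc_cod (lic K) x = snd (snd x)"
  "fst (tc_id1 (lic K) A) = tc_id1 K A"
  "snd (tc_id1 (lic K) A) = tc_id2 K (tc_id1 K A)"
  "fst (tc_id2 (lic K) u) = snd u"
  "snd (tc_id2 (lic K) u) = (u, u)"
  "fst (tc_comp1 (lic K) u w) = tc_comp1 K (fst u) (fst w)"
  "snd (tc_comp1 (lic K) u w) = tc_hcomp K (snd u) (snd w)"
  "fst (tc_vcomp (lic K) x y) = tc_vcomp K (fst x) (fst y)"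
  "snd (tc_vcomp (lic K) x y) = (fst (snd y), snd (snd x))"
  "fst (tc_hcomp (lic K) x y) = tc_hcomp K (fst x) (fst y)"
  "snd (tc_hcomp (lic K) x y) = (tc_comp1 (lic K) (fst (snd x)) (fst (snd y)), tc_comp1 (lic K) (snd (snd x)) (snd (snd y)))"
  by (simp_all add: lic_def case_prod_unfold)

lemma lic_arr1: "u \<in> tc_arr1 (lic K) \<longleftrightarrow>
    fst u \<in> tc_arr1 K \<and> snd u \<in> tc_arr2 K \<and> tc_dom K (snd u) = fst u \<and> tc_cod K (snd u) = fst u \<and>
    tc_vcomp K (snd u) (snd u) = snd u"
  by (auto simp: lic_def)

lemma lic_arr2: "x \<in> tc_arr2 (lic K) \<longleftrightarrow>
    fst (snd x) \<in> tc_arr1 (lic K) \<and> snd (snd x) \<in> tc_arr1 (lic K) \<and> fst x \<in> tc_arr2 K \<and>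
    tc_dom K (fst x) = fst (fst (snd x)) \<and> tc_cod K (fst x) = fst (snd (snd x)) \<and>
    tc_vcomp K (snd (snd (snd x))) (fst x) = fst x \<and> tc_vcomp K (fst x) (snd (fst (snd x))) = fst x"
  by (cases x) (auto simp: lic_arr1, auto simp: lic_def)

text \<open>All equations reduce to first components, where they hold in \<open>K\<close>; what has
  to be checked is that composites are again idempotent, or absorb the idempotents of their ends.
  The result allows diagrams to be interpreted in \<open>lic K\<close> itself.\<close>

theorem twocat_lic:
  assumes "twocat K"
  shows "twocat (lic K)"
proof -
  interpret two_category K by unfold_locales fact
  have c1: "tc_comp1 (lic K) u w \<in> tc_arr1 (lic K)"
    if "u \<in> tc_arr1 (lic K)" "w \<in> tc_arr1 (lic K)" "tc_src K (fst u) = tc_trg K (fst w)" for u w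
    using that by (auto simp: lic_arr1 interchange[symmetric])
  \<comment> \<open>Membership in \<open>tc_arr2 (lic K)\<close> does not mention parallel ends.
    They come from \<open>K\<close>, and they make the codomains composable whenever the domains
    are.\<close>
  have par: "tc_src K (fst (snd (snd x))) = tc_src K (fst (fst (snd x))) \<and>
      tc_trg K (fst (snd (snd x))) = tc_trg K (fst (fst (snd x)))" if "x \<in> tc_arr2 (lic K)" for x
    using that src_cod[of "fst x"] trg_cod[of "fst x"] by (auto simp: lic_arr2)
  have v1: "tc_vcomp (lic K) x y \<in> tc_arr2 (lic K)"
    if "x \<in> tc_arr2 (lic K)" "y \<in> tc_arr2 (lic K)" "fst (snd x) = snd (snd y)" for x y
  proof -
    have "tc_vcomp K (snd (snd (snd x))) (tc_vcomp K (fst x) (fst y)) = tc_vcomp K (fst x) (fst y)"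
      using that vcomp_assoc[of "snd (snd (snd x))" "fst x" "fst y"] by (auto simp: lic_arr2 lic_arr1)
    moreover have "tc_vcomp K (tc_vcomp K (fst x) (fst y)) (snd (fst (snd y))) = tc_vcomp K (fst x) (fst y)"
      using that vcomp_assoc[of "fst x" "fst y" "snd (fst (snd y))"] by (auto simp: lic_arr2 lic_arr1)
    ultimately show ?thesis using that by (auto simp: lic_arr2)
  qed
  have h1: "tc_hcomp (lic K) x y \<in> tc_arr2 (lic K)"
    if xy: "x \<in> tc_arr2 (lic K)" "y \<in> tc_arr2 (lic K)" "tc_src K (fst (fst (snd x))) = tc_trg K (fst (fst
        (snd y)))" for x y
    using that par[OF xy(1)] par[OF xy(2)] c1 by (auto simp: lic_arr2 lic_arr1 interchange[symmetric])
  have eqI: "x = y" if "fst x = fst y" "fst (snd x) = fst (snd y)" "snd (snd x) = snd (snd y)" for x y :: "'c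
      \<times> ('b \<times> 'c) \<times> ('b \<times> 'c)"
    using that by (simp add: prod_eq_iff)
  have ca: "tc_comp1 (lic K) (tc_comp1 (lic K) u w) z = tc_comp1 (lic K) u (tc_comp1 (lic K) w z)"
    if "u \<in> tc_arr1 (lic K)" "w \<in> tc_arr1 (lic K)" "z \<in> tc_arr1 (lic K)"
      "tc_src K (fst u) = tc_trg K (fst w)" "tc_src K (fst w) = tc_trg K (fst z)" for u w z
    using that by (auto simp: prod_eq_iff lic_arr1 comp1_assoc hcomp_assoc)
  have ci: "tc_comp1 (lic K) (tc_id1 (lic K) (tc_trg K (fst u))) u = u"
    "tc_comp1 (lic K) u (tc_id1 (lic K) (tc_src K (fst u))) = u"
    if "u \<in> tc_arr1 (lic K)" for u
    using that by (auto simp: prod_eq_iff lic_arr1)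
  show ?thesis
    unfolding twocat_def
  proof (intro conjI, goal_cases)
    case 1 then show ?case by (auto simp: lic_arr1)
  next
    case 2 then show ?case by (auto simp: lic_arr1)
  next
    case 3 then show ?case using c1 by (auto simp: lic_arr1)
  next
    case 4 then show ?case using ca by auto
  next
    case 5 then show ?case using ci by auto
  next
    case 6 then show ?case using par by (auto simp: lic_arr2)
  next
    case 7 then show ?case by (auto simp: lic_arr2 lic_arr1)
  next
    case 8 then show ?case using v1 by auto
  next
    case 9 then show ?case by (auto simp: prod_eq_iff lic_arr2 intro!: vcomp_assoc)
  next
    case 10 then show ?case by (auto simp: prod_eq_iff lic_arr2)
  next
    case 11 then show ?case using h1 by auto
  next
    case 12 then show ?case using ca par
      by (auto intro!: eqI hcomp_assoc simp: lic_arr2)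
  next
    case 13 then show ?case by (auto simp: prod_eq_iff)
  next
    case 14
    have "tc_hcomp (lic K) (tc_id2 (lic K) (tc_id1 (lic K) (tc_trg (lic K) (tc_dom (lic K) x)))) x = x \<and>
        tc_hcomp (lic K) x (tc_id2 (lic K) (tc_id1 (lic K) (tc_src (lic K) (tc_dom (lic K) x)))) = x"
      if "x \<in> tc_arr2 (lic K)" for x
      using that ci[of "fst (snd x)"] ci[of "snd (snd x)"] par[of x] by (intro conjI eqI) (auto simp: lic_arr2)
    then show ?case by blast
  next
    case 15 then show ?case by (auto intro!: eqI interchange simp: lic_arr2)
  qed
qed

section \<open>Rewriting of string diagrams\<close>

text \<open>\<open>S p i\<close> stands for the \<open>i\<close>-th monad of the source (\<open>p = False\<close>) or
    of the target (\<open>p = True\<close>) of a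
  1-cell of systems of monads, and \<open>V\<close> for its underlying 1-cell \<open>v\<close>. A slice \<open>(i,
      g)\<close> applies the
  generator \<open>g\<close> to the letters of a word from position \<open>i\<close> on; in a list of slices the head is
  applied first.\<close>

datatype letter = S bool nat | V
datatype gen = Mu bool nat | Eta bool nat | Lam bool nat nat | Xi nat

type_synonym word = "letter list"
type_synonym slices = "(nat \<times> gen) list"

text \<open>The booleans also name the two objects: \<open>False\<close> the source and
  \<open>True\<close> the target of the 1-cell. A monad stays on its own object, while
  \<open>V\<close> runs from \<open>False\<close> to \<open>True\<close>.\<close>

fun ltrg :: "letter \<Rightarrow> bool" where
  "ltrg (S p i) = p"
| "ltrg V = True"

fun lsrc :: "letter \<Rightarrow> bool" where
  "lsrc (S p i) = p"
| "lsrc V = False"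

fun gdom :: "gen \<Rightarrow> word" where
  "gdom (Mu p i) = [S p i, S p i]"
| "gdom (Eta p i) = []"
| "gdom (Lam p i j) = [S p j, S p i]"
| "gdom (Xi i) = [S True i, V]"

fun gcod :: "gen \<Rightarrow> word" where
  "gcod (Mu p i) = [S p i]"
| "gcod (Eta p i) = [S p i]"
| "gcod (Lam p i j) = [S p i, S p j]"
| "gcod (Xi i) = [V, S False i]"

fun gtrg :: "gen \<Rightarrow> bool" where
  "gtrg (Mu p i) = p"
| "gtrg (Eta p i) = p"
| "gtrg (Lam p i j) = p"
| "gtrg (Xi i) = True"

fun gsrc :: "gen \<Rightarrow> bool" where
  "gsrc (Mu p i) = p"
| "gsrc (Eta p i) = p"
| "gsrc (Lam p i j) = p"
| "gsrc (Xi i) = False"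

text \<open>In a signature \<open>(r, h)\<close>, the indices of the monads are bounded by \<open>r\<close>, and
    \<open>h\<close> says whether the
  data of a 1-cell (\<open>p = True\<close>, \<open>V\<close>, \<open>Xi\<close>) may occur.\<close>

fun letok :: "nat \<times> bool \<Rightarrow> letter \<Rightarrow> bool" where
  "letok (r, h) (S p i) \<longleftrightarrow> i \<le> r \<and> (p \<longrightarrow> h)"
| "letok (r, h) V \<longleftrightarrow> h"

fun genok :: "nat \<times> bool \<Rightarrow> gen \<Rightarrow> bool" where
  "genok (r, h) (Mu p i) \<longleftrightarrow> i \<le> r \<and> (p \<longrightarrow> h)"
| "genok (r, h) (Eta p i) \<longleftrightarrow> i \<le> r \<and> (p \<longrightarrow> h)"
| "genok (r, h) (Lam p i j) \<longleftrightarrow> i < j \<and> j \<le> r \<and> (p \<longrightarrow> h)"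
| "genok (r, h) (Xi i) \<longleftrightarrow> i \<le> r \<and> h"

fun path :: "nat \<times> bool \<Rightarrow> bool \<Rightarrow> word \<Rightarrow> bool \<Rightarrow> bool" where
  "path sg x [] y \<longleftrightarrow> x = y"
| "path sg x (l # w) y \<longleftrightarrow> letok sg l \<and> ltrg l = x \<and> path sg (lsrc l) w y"

fun upd :: "word \<Rightarrow> nat \<times> gen \<Rightarrow> word" where
  "upd w (i, g) = take i w @ gcod g @ drop (i + length (gdom g)) w"

text \<open>A unit has an empty domain and would match between any two letters; the path conditions
  force the chosen place to lie at the object to which the generator belongs.\<close>

fun sliceok :: "nat \<times> bool \<Rightarrow> bool \<Rightarrow> bool \<Rightarrow> word \<Rightarrow> nat \<times>
    gen \<Rightarrow> bool" where
  "sliceok sg x y w (i, g) \<longleftrightarrow>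
     genok sg g \<and> i \<le> length w \<and> take (length (gdom g)) (drop i w) = gdom g \<and>
     path sg x (take i w) (gtrg g) \<and> path sg (gsrc g) (drop (i + length (gdom g)) w) y"

fun slicesok :: "nat \<times> bool \<Rightarrow> bool \<Rightarrow> bool \<Rightarrow> word \<Rightarrow> slices
    \<Rightarrow> bool" where
  "slicesok sg x y w [] \<longleftrightarrow> path sg x w y"
| "slicesok sg x y w (d # ds) \<longleftrightarrow> sliceok sg x y w d \<and> slicesok sg x y (upd w d) ds"

fun outw :: "word \<Rightarrow> slices \<Rightarrow> word" where
  "outw w [] = w"
| "outw w (d # ds) = outw (upd w d) ds"

definition shift :: "nat \<Rightarrow> slices \<Rightarrow> slices" where
  "shift n = map (\<lambda>(i, g). (n + i, g))"

text \<open>All ways to move the slice \<open>t\<close> to the front of a diagram by interchange, where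
    \<open>t\<close> carries the
  position that it then has. There can be several, because a unit has an empty domain and may be
  passed on either side at the same position.\<close>

fun pull :: "nat \<times> gen \<Rightarrow> slices \<Rightarrow> slices list" where
  "pull t [] = []"
| "pull (j, h) ((i, g) # ds) =
     (if (i, g) = (j, h) then [ds] else []) @
     (if j + length (gdom h) \<le> i
      then map ((#) (i - length (gdom h) + length (gcod h), g)) (pull (j, h) ds) else []) @
     (if i + length (gdom g) \<le> j
      then map ((#) (i, g)) (pull (j - length (gdom g) + length (gcod g), h) ds) else [])"

fun pulls :: "slices \<Rightarrow> slices \<Rightarrow> slices list" where
  "pulls [] ds = [ds]"
| "pulls (t # ts) ds = concat (map (pulls ts) (pull t ds))"

section \<open>Terms, their slices, and derivations\<close>

datatype tm = G gen | I letter | Vc tm tm (infixr "\<bullet>" 65) | Hc tm tm (infixr "\<otimes>" 70)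

fun tdom :: "tm \<Rightarrow> word" where
  "tdom (G g) = gdom g"
| "tdom (I l) = [l]"
| "tdom (s \<bullet> t) = tdom t"
| "tdom (s \<otimes> t) = tdom s @ tdom t"

fun tcod :: "tm \<Rightarrow> word" where
  "tcod (G g) = gcod g"
| "tcod (I l) = [l]"
| "tcod (s \<bullet> t) = tcod s"
| "tcod (s \<otimes> t) = tcod s @ tcod t"

fun ttrg :: "tm \<Rightarrow> bool" where
  "ttrg (G g) = gtrg g"
| "ttrg (I l) = ltrg l"
| "ttrg (s \<bullet> t) = ttrg s"
| "ttrg (s \<otimes> t) = ttrg s"

fun tsrc :: "tm \<Rightarrow> bool" where
  "tsrc (G g) = gsrc g"
| "tsrc (I l) = lsrc l"
| "tsrc (s \<bullet> t) = tsrc s"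
| "tsrc (s \<otimes> t) = tsrc t"

fun tmok :: "nat \<times> bool \<Rightarrow> tm \<Rightarrow> bool" where
  "tmok sg (G g) \<longleftrightarrow> genok sg g"
| "tmok sg (I l) \<longleftrightarrow> letok sg l"
| "tmok sg (s \<bullet> t) \<longleftrightarrow> tmok sg s \<and> tmok sg t \<and> tdom s = tcod t \<and> ttrg s =
    ttrg t \<and> tsrc s = tsrc t"
| "tmok sg (s \<otimes> t) \<longleftrightarrow> tmok sg s \<and> tmok sg t \<and> tsrc s = ttrg t"

text \<open>The right factor of a horizontal composite is executed before the left one, so that the
  left factor keeps its positions and the shift is by the length of a domain.\<close>

fun slices :: "tm \<Rightarrow> slices" where
  "slices (G g) = [(0, g)]"
| "slices (I l) = []"
| "slices (s \<bullet> t) = slices t @ slices s"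
| "slices (s \<otimes> t) = shift (length (tdom s)) (slices t) @ slices s"

text \<open>The step \<open>(n, i, q)\<close> rewrites with the rule \<open>q\<close> at position \<open>i\<close> of
    the word reached after
  \<open>n\<close> slices; the slices of the left-hand side may be scattered over the rest of the diagram.\<close>

type_synonym rule = "tm \<times> tm"
type_synonym step = "nat \<times> nat \<times> rule"

definition ruleok :: "nat \<times> bool \<Rightarrow> rule \<Rightarrow> bool" where
  "ruleok sg = (\<lambda>(s, t). tmok sg s \<and> tmok sg t \<and> tdom s = tdom t \<and> tcod s = tcod t \<and>
     ttrg s = ttrg t \<and> tsrc s = tsrc t)"

fun rewr :: "nat \<times> bool \<Rightarrow> bool \<Rightarrow> bool \<Rightarrow> word \<Rightarrow> slices
    \<Rightarrow> step \<Rightarrow> slices list" where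
  "rewr sg x y w ds (n, i, (s, t)) =
     (let v = outw w (take n ds); d = tdom s; z = i + length d in
      if ruleok sg (s, t) \<and> i \<le> length v \<and> take (length d) (drop i v) = d \<and>
         path sg x (take i v) (ttrg s) \<and> path sg (tsrc s) (drop z v) y
      then map (\<lambda>es. take n ds @ shift i (slices t) @ es) (pulls (shift i (slices s)) (drop n ds))
      else [])"

fun rewrs :: "nat \<times> bool \<Rightarrow> bool \<Rightarrow> bool \<Rightarrow> word \<Rightarrow> slices
    \<Rightarrow> step list \<Rightarrow> slices list" where
  "rewrs sg x y w ds [] = [ds]"
| "rewrs sg x y w ds (p # ps) = concat (map (\<lambda>es. rewrs sg x y w es ps) (rewr sg x y w ds p))"

text \<open>Diagrams have no computed normal form. Equality up to interchange is tested by pulling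
  the slices of \<open>t\<close> one by one out of the final diagram until nothing is left, and one
  successful branch among all choices suffices.\<close>

definition derives :: "nat \<times> bool \<Rightarrow> step list \<Rightarrow> rule \<Rightarrow> bool" where
  "derives sg ps = (\<lambda>(s, t). ruleok sg (s, t) \<and>
     list_ex (\<lambda>ds. list_ex ((=) []) (pulls (slices t) ds))
       (rewrs sg (ttrg s) (tsrc s) (tdom s) (slices s) ps))"

section \<open>Soundness of diagram rewriting\<close>

locale interpretation_of_diagrams = two_category L for L :: "('o, 'a, 'c) tcat" +
  fixes sg :: "nat \<times> bool" and ob :: "bool \<Rightarrow> 'o" and lt :: "letter \<Rightarrow> 'a" and gi ::
      "gen \<Rightarrow> 'c"
  assumes ob [simp]: "ob x \<in> tc_ob L"
    and lt: "letok sg l \<Longrightarrow> lt l \<in> tc_arr1 L \<and> tc_src L (lt l) = ob (lsrc l) \<and> tc_trg L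
        (lt l) = ob (ltrg l)"
    and gi: "genok sg g \<Longrightarrow> gi g \<in> tc_arr2 L \<and>
      tc_dom L (gi g) = foldr (tc_comp1 L) (map lt (gdom g)) (tc_id1 L (ob (gsrc g))) \<and>
      tc_cod L (gi g) = foldr (tc_comp1 L) (map lt (gcod g)) (tc_id1 L (ob (gsrc g)))"
begin

text \<open>The composite ends in an identity 1-cell, which strictness removes. It gives a value to
  the empty word, and the argument \<open>y\<close> supplies the object that an empty word cannot
  name.\<close>

fun ew :: "bool \<Rightarrow> word \<Rightarrow> 'a" where
  "ew y [] = tc_id1 L (ob y)"
| "ew y (l # w) = lt l \<circ>\<^sub>1 ew y w"

abbreviation ei where "ei y w \<equiv> tc_id2 L (ew y w)"

abbreviation pth where "pth \<equiv> path sg"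

lemma path_appendI:
  "pth x u y \<Longrightarrow> pth y w z \<Longrightarrow> pth x (u @ w) z"
  by (induction u arbitrary: x) auto

lemma path_split: "pth x u y \<Longrightarrow> pth x (u @ w) z \<longleftrightarrow> pth y w z"
  by (induction u arbitrary: x) auto

lemma ew_typed:
  "pth x w y \<Longrightarrow> ew y w \<in> tc_arr1 L \<and> tc_src L (ew y w) = ob y \<and> tc_trg L (ew y w) = ob x"
  by (induction w arbitrary: x) (use lt in force)+

lemmas ew_simps [simp] = ew_typed[THEN conjunct1] ew_typed[THEN conjunct2, THEN conjunct1]
  ew_typed[THEN conjunct2, THEN conjunct2]

lemma ew_append:
  "pth x u y \<Longrightarrow> pth y w z \<Longrightarrow> ew z (u @ w) = ew y u \<circ>\<^sub>1 ew z w"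
proof (induction u arbitrary: x)
  case (Cons l u)
  have "ew z (u @ w) = ew y u \<circ>\<^sub>1 ew z w"
    using Cons.IH[of "lsrc l"] Cons.prems by simp
  then show ?case
    using Cons.prems comp1_assoc[of "lt l" "ew y u" "ew z w"] by (metis append_Cons ew.simps(2) ew_typed lt path.simps(2))
qed auto

lemma path_gen: "genok sg g \<Longrightarrow> pth (gtrg g) (gdom g) (gsrc g) \<and> pth (gtrg g) (gcod g) (gsrc g)"
  by (cases sg; cases g) auto

lemma gi_typed:
  assumes "genok sg g"
  shows "gi g \<in> tc_arr2 L" "tc_dom L (gi g) = ew (gsrc g) (gdom g)" "tc_cod L (gi g) = ew (gsrc g) (gcod g)"
proof -
  have "foldr (tc_comp1 L) (map lt w) (tc_id1 L (ob y)) = ew y w" for y w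
    by (induction w) auto
  then show "gi g \<in> tc_arr2 L" "tc_dom L (gi g) = ew (gsrc g) (gdom g)" "tc_cod L (gi g) = ew (gsrc g) (gcod g)"
    using gi[OF assms] by auto
qed

text \<open>All typing information is collected in one predicate, so that the side conditions of
  interchange and associativity can be met by composing facts.\<close>

definition cell :: "bool \<Rightarrow> bool \<Rightarrow> word \<Rightarrow> word \<Rightarrow> 'c \<Rightarrow> bool" where
  "cell x y p q \<alpha> \<longleftrightarrow> pth x p y \<and> pth x q y \<and> \<alpha> \<in> tc_arr2 L \<and>
      tc_dom L \<alpha> = ew y p \<and> tc_cod L \<alpha> = ew y q"

lemma cell_id: "pth x p y \<Longrightarrow> cell x y p p (ei y p)"
  by (simp add: cell_def)

lemma cell_gen: "genok sg g \<Longrightarrow> cell (gtrg g) (gsrc g) (gdom g) (gcod g) (gi g)"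
  by (simp add: cell_def gi_typed path_gen)

lemma cell_hcomp: "cell x y p q \<alpha> \<Longrightarrow> cell y z p' q' \<beta> \<Longrightarrow> cell x z (p @ p')
    (q @ q') (\<alpha> \<star> \<beta>)"
  using path_appendI by (auto simp: cell_def ew_append)

lemma cell_vcomp: "cell x y q r \<alpha> \<Longrightarrow> cell x y p q \<beta> \<Longrightarrow> cell x y p r
    (\<alpha> \<cdot> \<beta>)"
  by (auto simp: cell_def)

lemma cell_exchange:
  "cell x y q r \<alpha> \<Longrightarrow> cell x y p q \<beta> \<Longrightarrow> cell y z q' r' \<gamma>
      \<Longrightarrow> cell y z p' q' \<delta> \<Longrightarrow>
    (\<alpha> \<cdot> \<beta>) \<star> (\<gamma> \<cdot> \<delta>) = (\<alpha> \<star> \<gamma>) \<cdot> (\<beta>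
        \<star> \<delta>)"
  by (auto simp: cell_def intro!: interchange)

lemma cell_hassoc:
  "cell x y p q \<alpha> \<Longrightarrow> cell y z p' q' \<beta> \<Longrightarrow> cell z w p'' q'' \<gamma>
      \<Longrightarrow> (\<alpha> \<star> \<beta>) \<star> \<gamma> = \<alpha> \<star> \<beta> \<star> \<gamma>"
  by (auto simp: cell_def intro!: hcomp_assoc)

lemma cell_vassoc:
  "cell x y r s \<alpha> \<Longrightarrow> cell x y q r \<beta> \<Longrightarrow> cell x y p q \<gamma>
      \<Longrightarrow> (\<alpha> \<cdot> \<beta>) \<cdot> \<gamma> = \<alpha> \<cdot> \<beta> \<cdot> \<gamma>"
  by (auto simp: cell_def intro!: vcomp_assoc)

lemma cell_vid: "cell x y p q \<alpha> \<Longrightarrow> ei y q \<cdot> \<alpha> = \<alpha>" "cell x y p q \<alpha>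
    \<Longrightarrow> \<alpha> \<cdot> ei y p = \<alpha>"
  by (auto simp: cell_def)

lemma cell_hid: "cell x y p q \<alpha> \<Longrightarrow> ei x [] \<star> \<alpha> = \<alpha>" "cell x y p q \<alpha>
    \<Longrightarrow> \<alpha> \<star> ei y [] = \<alpha>"
  by (auto simp: cell_def)

lemma ei_append: "pth x u y \<Longrightarrow> pth y w z \<Longrightarrow> ei y u \<star> ei z w = ei z (u @ w)"
  by (simp add: ew_append hcomp_id2)

lemma cell_path: "cell x y p q \<alpha> \<Longrightarrow> pth x p y" "cell x y p q \<alpha> \<Longrightarrow> pth x q y"
  by (auto simp: cell_def)

lemma cell_slide:
  assumes a: "cell x y p q \<alpha>" and b: "cell y z p' q' \<beta>"
  shows "(\<alpha> \<star> ei z q') \<cdot> (ei y p \<star> \<beta>) = \<alpha> \<star> \<beta>" "(ei y q \<star>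
      \<beta>) \<cdot> (\<alpha> \<star> ei z p') = \<alpha> \<star> \<beta>"
proof -
  note P = cell_path[OF a] cell_path[OF b]
  show "(\<alpha> \<star> ei z q') \<cdot> (ei y p \<star> \<beta>) = \<alpha> \<star> \<beta>"
    using cell_exchange[OF a cell_id[OF P(1)] cell_id[OF P(4)] b] cell_vid[OF a] cell_vid[OF b] by simp
  show "(ei y q \<star> \<beta>) \<cdot> (\<alpha> \<star> ei z p') = \<alpha> \<star> \<beta>"
    using cell_exchange[OF cell_id[OF P(2)] a b cell_id[OF P(3)]] cell_vid[OF a] cell_vid[OF b] by simp
qed

fun ssem :: "bool \<Rightarrow> word \<Rightarrow> nat \<times> gen \<Rightarrow> 'c" where
  "ssem y w (i, g) = ei (gtrg g) (take i w) \<star> gi g \<star> ei y (drop (i + length (gdom g)) w)"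

fun sem :: "bool \<Rightarrow> word \<Rightarrow> slices \<Rightarrow> 'c" where
  "sem y w [] = ei y w"
| "sem y w (d # ds) = sem y (upd w d) ds \<cdot> ssem y w d"

lemma sliceokE:
  assumes "sliceok sg x y w (i, g)"
  obtains l r where "w = l @ gdom g @ r" "i = length l" "genok sg g" "pth x l (gtrg g)" "pth (gsrc g) r y"
proof
  let ?l = "take i w" and ?r = "drop (i + length (gdom g)) w"
  have "drop i w = gdom g @ ?r"
    using assms append_take_drop_id[of "length (gdom g)" "drop i w"] by (simp add: add.commute)
  then show "w = ?l @ gdom g @ ?r"
    using append_take_drop_id[of i w] by simp
qed (use assms in auto)

lemma sliceokI:
  "genok sg g \<Longrightarrow> pth x l (gtrg g) \<Longrightarrow> pth (gsrc g) r y \<Longrightarrow> i = length l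
      \<Longrightarrow> sliceok sg x y (l @ gdom g @ r) (i, g)"
  by simp

lemma ssem_split: "ssem y (l @ gdom g @ r) (length l, g) = ei (gtrg g) l \<star> gi g \<star> ei y r"
  by simp

lemma upd_split: "upd (l @ gdom g @ r) (length l, g) = l @ gcod g @ r"
  by simp

lemma cell_ssem: "sliceok sg x y w d \<Longrightarrow> cell x y w (upd w d) (ssem y w d)"
proof -
  assume a: "sliceok sg x y w d"
  obtain i g where d: "d = (i, g)" by fastforce
  obtain l r where w: "w = l @ gdom g @ r" "i = length l" "genok sg g" "pth x l (gtrg g)" "pth (gsrc g) r y"
    using a unfolding d by (rule sliceokE)
  show ?thesis
    unfolding d w(1,2) ssem_split upd_split
    by (rule cell_hcomp[OF cell_id[OF w(4)] cell_hcomp[OF cell_gen[OF w(3)] cell_id[OF w(5)]]])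
qed

lemma cell_sem: "slicesok sg x y w ds \<Longrightarrow> cell x y w (outw w ds) (sem y w ds)"
  by (induction ds arbitrary: w) (auto intro: cell_id cell_vcomp cell_ssem)

lemma outw_append [simp]: "outw w (ds @ es) = outw (outw w ds) es"
  by (induction ds arbitrary: w) auto

lemma slicesok_path: "slicesok sg x y w ds \<Longrightarrow> pth x w y" "slicesok sg x y w ds \<Longrightarrow> pth x
    (outw w ds) y"
  using cell_sem cell_path by blast+

lemma slicesok_append:
  "slicesok sg x y w (ds @ es) \<longleftrightarrow> slicesok sg x y w ds \<and> slicesok sg x y (outw w ds) es"
proof (induction ds arbitrary: w)
  case Nil
  then show ?case using slicesok_path by auto
qed auto

lemma sem_append:
  "slicesok sg x y w (ds @ es) \<Longrightarrow> sem y w (ds @ es) = sem y (outw w ds) es \<cdot> sem y w ds"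
proof (induction ds arbitrary: w)
  case Nil
  then show ?case using cell_sem[of x y w es] cell_vid by auto
next
  case (Cons d ds)
  then have "slicesok sg x y (upd w d) ds" "slicesok sg x y (outw (upd w d) ds) es"
    "sliceok sg x y w d"
    by (auto simp: slicesok_append)
  with Cons show ?case
    using cell_vassoc[of x y "outw (upd w d) ds" _ "sem y (outw (upd w d) ds) es" "upd w d" "sem y (upd w d) ds" w
        "ssem y w d"]
      cell_sem[of x y "outw (upd w d) ds" es] cell_sem[of x y "upd w d" ds] cell_ssem[of x y w d]
    by (simp del: upd.simps ssem.simps sliceok.simps)
qed

text \<open>Whiskering passes through vertical composites by interchange, so a diagram keeps its
  meaning inside a longer word. This serves both for the factors of a horizontal composite and for
  applying a rule in a context.\<close>

lemma slicesok_shift: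
  assumes "slicesok sg x y w ds" "pth x' l x" "pth y r y'"
  shows "slicesok sg x' y' (l @ w @ r) (shift (length l) ds) \<and>
         outw (l @ w @ r) (shift (length l) ds) = l @ outw w ds @ r \<and>
         sem y' (l @ w @ r) (shift (length l) ds) = ei x l \<star> sem y w ds \<star> ei y' r"
  using assms(1)
proof (induction ds arbitrary: w)
  case Nil
  then show ?case
    using assms(2,3) by (auto simp: shift_def ei_append path_appendI intro: path_appendI)
next
  case (Cons d ds)
  obtain i g where d: "d = (i, g)" by fastforce
  have so: "sliceok sg x y w (i, g)" and ok: "slicesok sg x y (upd w (i, g)) ds"
    using Cons.prems d by auto
  obtain l' r' where w: "w = l' @ gdom g @ r'" "i = length l'" "genok sg g" "pth x l' (gtrg g)" "pth (gsrc g) r' y"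
    using so by (rule sliceokE)
  have w': "l @ w @ r = (l @ l') @ gdom g @ (r' @ r)" and i': "length l + i = length (l @ l')"
    using w by auto
  have so': "sliceok sg x' y' (l @ w @ r) (length l + i, g)"
    unfolding w' i' by (rule sliceokI) (use w assms path_appendI in blast)+
  have up: "upd (l @ w @ r) (length l + i, g) = l @ upd w (i, g) @ r"
    unfolding w' i' upd_split unfolding w(1,2) upd_split by simp
  let ?m = "ssem y w (i, g)"
  have c: "cell x y w (upd w (i, g)) ?m" using so by (rule cell_ssem)
  have cg: "cell (gtrg g) (gsrc g) (gdom g) (gcod g) (gi g)" using w cell_gen by auto
  have cl: "cell x' x l l (ei x l)" "cell y y' r r (ei y' r)" "cell x (gtrg g) l' l' (ei (gtrg g) l')"
    "cell (gsrc g) y r' r' (ei y r')"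
    using assms w cell_id by auto
  have "ssem y' (l @ w @ r) (length l + i, g) = ei (gtrg g) (l @ l') \<star> gi g \<star> ei y' (r' @ r)"
    unfolding w' i' ssem_split ..
  also have "\<dots> = (ei x l \<star> ei (gtrg g) l') \<star> gi g \<star> (ei y r' \<star> ei y' r)"
    using w assms by (simp add: ei_append)
  also have "\<dots> = ei x l \<star> (ei (gtrg g) l' \<star> gi g \<star> ei y r') \<star> ei y' r"
    using cell_hassoc[OF cl(1) cl(3) cell_hcomp[OF cg cell_hcomp[OF cl(4) cl(2)]]]
      cell_hassoc[OF cl(3) cell_hcomp[OF cg cl(4)] cl(2)] cell_hassoc[OF cg cl(4) cl(2)] by simp
  finally have ss: "ssem y' (l @ w @ r) (length l + i, g) = ei x l \<star> ?m \<star> ei y' r"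
    unfolding w(1,2) ssem_split .
  have cs: "cell x y (upd w (i, g)) (outw (upd w (i, g)) ds) (sem y (upd w (i, g)) ds)"
    using ok by (rule cell_sem)
  have "ei x l \<star> sem y w ((i, g) # ds) \<star> ei y' r =
      (ei x l \<star> sem y (upd w (i, g)) ds \<star> ei y' r) \<cdot> (ei x l \<star> ?m \<star> ei y' r)"
    using cell_exchange[OF cl(1) cl(1) cell_hcomp[OF cs cl(2)] cell_hcomp[OF c cl(2)]]
      cell_exchange[OF cs c cl(2) cl(2)] cell_vid(2)[OF cl(1)] cell_vid(2)[OF cl(2)] by simp
  then show ?case
    using Cons.IH[OF ok] so' up ss by (simp add: d shift_def)
qed

text \<open>Both orders equal the horizontal composite of \<open>gi g\<close> with
  \<open>\<gamma>\<close>, that is, with \<open>h\<close> and the letters \<open>m\<close> and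
  \<open>r\<close> around it, whiskered by \<open>l\<close>. Only the position of \<open>h\<close>
  depends on the order, since \<open>g\<close> changes the number of letters before it.\<close>

lemma swap_slices:
  assumes g: "genok sg g" and h: "genok sg h"
    and P: "pth x l (gtrg g)" "pth (gsrc g) m (gtrg h)" "pth (gsrc h) r y"
  defines "w \<equiv> l @ gdom g @ m @ gdom h @ r"
  defines "a \<equiv> (length l, g)" and "b' \<equiv> (length l + length (gcod g) + length m, h)"
    and "b \<equiv> (length l + length (gdom g) + length m, h)"
  shows "sliceok sg x y w b" "sliceok sg x y (upd w b) a" "sliceok sg x y w a" "sliceok sg x y (upd w a) b'"
    "upd (upd w b) a = upd (upd w a) b'"
    "ssem y (upd w b) a \<cdot> ssem y w b = ssem y (upd w a) b' \<cdot> ssem y w a"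
proof -
  have w1: "w = l @ gdom g @ (m @ gdom h @ r)" and w2: "w = (l @ gdom g @ m) @ gdom h @ r"
    by (auto simp: w_def)
  have b: "b = (length (l @ gdom g @ m), h)" and b': "b' = (length (l @ gcod g @ m), h)"
    by (auto simp: b_def b'_def)
  have ua: "upd w a = (l @ gcod g @ m) @ gdom h @ r"
    unfolding w1 a_def upd_split by simp
  have ub: "upd w b = l @ gdom g @ (m @ gcod h @ r)"
    unfolding w2 b upd_split by simp
  note pg = path_gen[OF g] path_gen[OF h]
  note pp = path_appendI[OF P(1) path_appendI[OF pg(1)[THEN conjunct1] P(2)]]
    path_appendI[OF P(1) path_appendI[OF pg(1)[THEN conjunct2] P(2)]]
    path_appendI[OF P(2) path_appendI[OF pg(2)[THEN conjunct1] P(3)]]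
    path_appendI[OF P(2) path_appendI[OF pg(2)[THEN conjunct2] P(3)]]
  show "sliceok sg x y w b" unfolding w2 b
    by (rule sliceokI) (use pp h P in auto)
  show "sliceok sg x y (upd w b) a" unfolding ub a_def
    by (rule sliceokI) (use pp g P in auto)
  show "sliceok sg x y w a" unfolding w1 a_def
    by (rule sliceokI) (use pp g P in auto)
  show "sliceok sg x y (upd w a) b'" unfolding ua b'
    by (rule sliceokI) (use pp h P in auto)
  show "upd (upd w b) a = upd (upd w a) b'"
  proof -
    have "upd (upd w b) a = l @ gcod g @ m @ gcod h @ r"
      unfolding ub a_def upd_split ..
    moreover have "upd (upd w a) b' = (l @ gcod g @ m) @ gcod h @ r"
      unfolding ua b' upd_split ..
    ultimately show ?thesis by simp
  qed
  note cg = cell_gen[OF g] and ch = cell_gen[OF h]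
  note ci = cell_id[OF P(1)] cell_id[OF P(2)] cell_id[OF P(3)]
  note cd = cell_path[OF cg] cell_path[OF ch]
  let ?l = "ei (gtrg g) l" and ?m = "ei (gtrg h) m" and ?r = "ei y r"
  have e1: "ssem y (upd w b) a = ?l \<star> gi g \<star> ei y (m @ gcod h @ r)"
    unfolding ub a_def ssem_split ..
  have e2: "ssem y w b = ei (gtrg h) (l @ gdom g @ m) \<star> gi h \<star> ?r"
    unfolding w2 b ssem_split ..
  have e3: "ssem y (upd w a) b' = ei (gtrg h) (l @ gcod g @ m) \<star> gi h \<star> ?r"
    unfolding ua b' ssem_split ..
  have e4: "ssem y w a = ?l \<star> gi g \<star> ei y (m @ gdom h @ r)"
    unfolding w1 a_def ssem_split ..
  define \<beta> where "\<beta> = gi h \<star> ?r"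
  have cb: "cell (gtrg h) y (gdom h @ r) (gcod h @ r) \<beta>"
    unfolding \<beta>_def by (rule cell_hcomp[OF ch ci(3)])
  define \<gamma> where "\<gamma> = ?m \<star> \<beta>"
  have cc: "cell (gsrc g) y (m @ gdom h @ r) (m @ gcod h @ r) \<gamma>"
    unfolding \<gamma>_def by (rule cell_hcomp[OF ci(2) cb])
  have wh: "ei (gtrg h) (l @ q @ m) \<star> \<beta> = ?l \<star> (ei (gsrc g) q \<star> \<gamma>)" if q: "pth (gtrg
      g) q (gsrc g)" for q
  proof -
    note cq = cell_id[OF q]
    have "ei (gtrg h) (l @ q @ m) = ?l \<star> (ei (gsrc g) q \<star> ?m)"
      using P q path_appendI by (simp add: ei_append[of x l "gtrg g"] ei_append)
    then show ?thesis
      using cell_hassoc[OF ci(1) cell_hcomp[OF cq ci(2)] cb] cell_hassoc[OF cq ci(2) cb] by (simp add: \<gamma>_def)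
  qed
  have e2': "ssem y w b = ?l \<star> (ei (gsrc g) (gdom g) \<star> \<gamma>)"
    and e3': "ssem y (upd w a) b' = ?l \<star> (ei (gsrc g) (gcod g) \<star> \<gamma>)"
    unfolding e2 e3 using wh pg by (auto simp: \<beta>_def[symmetric])
  have cw: "cell (gtrg g) y (gcod g @ m @ gdom h @ r) (gcod g @ m @ gcod h @ r) (ei (gsrc g) (gcod g) \<star> \<gamma>)"
    "cell (gtrg g) y (gdom g @ m @ gdom h @ r) (gdom g @ m @ gcod h @ r) (ei (gsrc g) (gdom g) \<star> \<gamma>)"
    "cell (gtrg g) y (gdom g @ m @ gcod h @ r) (gcod g @ m @ gcod h @ r) (gi g \<star> ei y (m @ gcod h @ r))"
    "cell (gtrg g) y (gdom g @ m @ gdom h @ r) (gcod g @ m @ gdom h @ r) (gi g \<star> ei y (m @ gdom h @ r))"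
    using cell_hcomp[OF cell_id[OF cd(2)] cc] cell_hcomp[OF cell_id[OF cd(1)] cc]
      cell_hcomp[OF cg cell_id[OF cell_path(2)[OF cc]]] cell_hcomp[OF cg cell_id[OF cell_path(1)[OF cc]]] by auto
  show "ssem y (upd w b) a \<cdot> ssem y w b = ssem y (upd w a) b' \<cdot> ssem y w a"
    unfolding e1 e2' e3' e4
    using cell_slide[OF cg cc] cell_exchange[OF ci(1) ci(1) cw(1) cw(4)]
      cell_exchange[OF ci(1) ci(1) cw(3) cw(2)] cell_vid(2)[OF ci(1)] by simp
qed

lemma append_prefix:
  "a @ b = c @ d \<Longrightarrow> length c \<le> length a \<Longrightarrow> a = c @ drop (length c) a \<and> drop
      (length c) a @ b = d"
  by (auto simp: append_eq_append_conv2)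

text \<open>By induction the slice is already at the head of the tail; it is either the head of the
  whole list itself or passes it by a single interchange, to the left or to the right.\<close>

lemma pull_sound:
  assumes "slicesok sg x y w ds" "es \<in> set (pull t ds)"
  shows "slicesok sg x y w (t # es) \<and> outw w (t # es) = outw w ds \<and> sem y w (t # es) = sem y w ds"
  using assms
proof (induction ds arbitrary: w t es)
  case Nil
  then show ?case by simp
next
  case (Cons d ds)
  obtain i g where d: "d = (i, g)" by fastforce
  obtain j h where t: "t = (j, h)" by fastforce
  have so: "sliceok sg x y w (i, g)" and ok: "slicesok sg x y (upd w (i, g)) ds"
    using Cons.prems d by auto
  obtain l r where w: "w = l @ gdom g @ r" "i = length l" "genok sg g" "pth x l (gtrg g)" "pth (gsrc g) r y"
    using so by (rule sliceokE)
  have uw: "upd w (i, g) = l @ gcod g @ r"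
    unfolding w(1,2) upd_split ..
  consider (eq) "d = t" "es = ds"
    | (left) fs where "j + length (gdom h) \<le> i" "fs \<in> set (pull (j, h) ds)"
        "es = (i - length (gdom h) + length (gcod h), g) # fs"
    | (right) fs where "i + length (gdom g) \<le> j"
        "fs \<in> set (pull (j - length (gdom g) + length (gcod g), h) ds)" "es = (i, g) # fs"
    using Cons.prems(2) by (auto simp: d t split: if_splits)
  then show ?case
  proof cases
    case eq
    then show ?thesis using Cons.prems by (simp add: d t)
  next
    case left
    note fs = left(2) and es = left(3)
    note IH = Cons.IH[OF ok fs]
    have so2: "sliceok sg x y (upd w (i, g)) (j, h)" using IH by simp
    obtain l' r' where v: "upd w (i, g) = l' @ gdom h @ r'" "j = length l'" "genok sg h" "pth x l' (gtrg h)" "pth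
        (gsrc h) r' y"
      using so2 by (rule sliceokE)
    \<comment> \<open>The domain of \<open>h\<close> ends before position \<open>i\<close>, so it
      lies inside \<open>l\<close>; \<open>m\<close> is the stretch of letters between the two
      generators.\<close>
    define m where "m = drop (length (l' @ gdom h)) l"
    have l: "l = l' @ gdom h @ m" and r': "r' = m @ gcod g @ r"
    proof -
      have le: "length (l' @ gdom h) \<le> length l" using left w v by simp
      have "l @ (gcod g @ r) = (l' @ gdom h) @ r'" using v uw by simp
      then have e: "l = (l' @ gdom h) @ m \<and> m @ gcod g @ r = r'"
        unfolding m_def using append_prefix[OF _ le] by metis
      then show "l = l' @ gdom h @ m" "r' = m @ gcod g @ r" by auto
    qed
    have pm: "pth (gsrc h) m (gtrg g)"
      using w(4) unfolding l using path_split[OF v(4)] path_split path_gen[OF v(3)] by blast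
    have weq: "w = l' @ gdom h @ m @ gdom g @ r" using w l by simp
    note sw = swap_slices[OF v(3) w(3) v(4) pm w(5), folded weq]
    have i: "length l' + length (gdom h) + length m = i"
      "length l' + length (gcod h) + length m = i - length (gdom h) + length (gcod h)"
      using w(2) l by auto
    note sw = sw[unfolded i, folded v(2)]
    have ok3: "slicesok sg x y (upd (upd w (i, g)) (j, h)) fs" using IH by simp
    have c: "cell x y (upd (upd w (i, g)) (j, h)) (outw (upd (upd w (i, g)) (j, h)) fs) (sem y (upd (upd w (i, g))
        (j, h)) fs)"
      using ok3 by (rule cell_sem)
    have "sem y w (d # ds) = sem y (upd (upd w (i, g)) (j, h)) fs \<cdot> (ssem y (upd w (i, g)) (j, h) \<cdot> ssem
        y w (i, g))"
      using IH cell_vassoc[OF c cell_ssem[OF sw(2)] cell_ssem[OF sw(1)]] by (simp del: upd.simps ssem.simps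
          sliceok.simps add: d)
    also have "\<dots> = sem y w (t # es)"
      using sw(5,6) c cell_vassoc[OF _ cell_ssem[OF sw(4)] cell_ssem[OF sw(3)]]
      by (simp del: upd.simps ssem.simps sliceok.simps add: t es)
    finally show ?thesis
      using IH sw by (simp del: upd.simps ssem.simps sliceok.simps add: t es d)
  next
    case right
    note fs = right(2) and es = right(3)
    define j' where "j' = j - length (gdom g) + length (gcod g)"
    note IH = Cons.IH[OF ok fs, folded j'_def]
    have so2: "sliceok sg x y (upd w (i, g)) (j', h)" using IH by simp
    obtain l' r' where v: "upd w (i, g) = l' @ gdom h @ r'" "j' = length l'" "genok sg h" "pth x l' (gtrg h)" "pth
        (gsrc h) r' y"
      using so2 by (rule sliceokE)
    define m where "m = drop (length (l @ gcod g)) l'"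
    have l: "l' = l @ gcod g @ m" and r: "r = m @ gdom h @ r'"
    proof -
      have le: "length (l @ gcod g) \<le> length l'" using right w v by (simp add: j'_def)
      have "l' @ (gdom h @ r') = (l @ gcod g) @ r" using v uw by simp
      then have e: "l' = (l @ gcod g) @ m \<and> m @ gdom h @ r' = r"
        unfolding m_def using append_prefix[OF _ le] by metis
      then show "l' = l @ gcod g @ m" "r = m @ gdom h @ r'" by auto
    qed
    have pm: "pth (gsrc g) m (gtrg h)"
      using v(4) unfolding l using path_split[OF w(4)] path_split path_gen[OF w(3)] by blast
    have weq: "w = l @ gdom g @ m @ gdom h @ r'" using w r by simp
    note sw = swap_slices[OF w(3) v(3) w(4) pm v(5), folded weq]
    have j: "length l + length (gdom g) + length m = j" "length l + length (gcod g) + length m = j'"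
      using v(2) l right w(2) unfolding j'_def by auto
    note sw = sw[unfolded j, folded w(2)]
    have ok3: "slicesok sg x y (upd (upd w (i, g)) (j', h)) fs" using IH by simp
    have c: "cell x y (upd (upd w (i, g)) (j', h)) (outw (upd (upd w (i, g)) (j', h)) fs) (sem y (upd (upd w (i, g))
        (j', h)) fs)"
      using ok3 by (rule cell_sem)
    have "sem y w (d # ds) = sem y (upd (upd w (i, g)) (j', h)) fs \<cdot> (ssem y (upd w (i, g)) (j', h) \<cdot>
        ssem y w (i, g))"
      using IH cell_vassoc[OF c cell_ssem[OF sw(4)] cell_ssem[OF sw(3)]] by (simp del: upd.simps ssem.simps
          sliceok.simps add: d)
    also have "\<dots> = sem y w (t # es)"
      using sw(5,6) c cell_vassoc[OF _ cell_ssem[OF sw(2)] cell_ssem[OF sw(1)]]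
      by (simp del: upd.simps ssem.simps sliceok.simps add: t es)
    finally show ?thesis
      using IH sw by (simp del: upd.simps ssem.simps sliceok.simps add: t es d)
  qed
qed

lemma pulls_sound:
  assumes "slicesok sg x y w ds" "es \<in> set (pulls ts ds)"
  shows "slicesok sg x y w (ts @ es) \<and> outw w (ts @ es) = outw w ds \<and> sem y w (ts @ es) = sem y w ds"
  using assms
proof (induction ts arbitrary: w ds)
  case (Cons t ts)
  then obtain fs where fs: "fs \<in> set (pull t ds)" and p: "es \<in> set (pulls ts fs)"
    by auto
  note ps = pull_sound[OF Cons.prems(1) fs]
  then have "slicesok sg x y (upd w t) fs" by simp
  from Cons.IH[OF this p] ps show ?case by simp
qed simp

fun ev :: "tm \<Rightarrow> 'c" where
  "ev (G g) = gi g"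
| "ev (I l) = tc_id2 L (lt l)"
| "ev (s \<bullet> t) = ev s \<cdot> ev t"
| "ev (s \<otimes> t) = ev s \<star> ev t"

lemma slices_sound:
  "tmok sg t \<Longrightarrow> slicesok sg (ttrg t) (tsrc t) (tdom t) (slices t) \<and> outw (tdom t) (slices t) =
      tcod t \<and>
     sem (tsrc t) (tdom t) (slices t) = ev t"
proof (induction t)
  case (G g)
  then have c: "cell (gtrg g) (gsrc g) (gdom g) (gcod g) (gi g)" by (simp add: cell_gen)
  note c' = cell_hid[OF c, simplified] cell_vid[OF c] cell_path[OF c]
  show ?case using G c' by simp
next
  case (I l)
  then show ?case using lt[of l] by (cases sg) auto
next
  case (Vc s t)
  then have *: "slicesok sg (ttrg s) (tsrc s) (tdom t) (slices t @ slices s)"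
    by (auto simp: slicesok_append)
  with Vc show ?case
    using sem_append[OF *] by auto
next
  case (Hc s t)
  then have s: "slicesok sg (ttrg s) (tsrc s) (tdom s) (slices s)" "outw (tdom s) (slices s) = tcod s"
      "sem (tsrc s) (tdom s) (slices s) = ev s"
    and t: "slicesok sg (ttrg t) (tsrc t) (tdom t) (slices t)" "outw (tdom t) (slices t) = tcod t"
      "sem (tsrc t) (tdom t) (slices t) = ev t"
    and m: "ttrg t = tsrc s" by auto
  note cs = cell_sem[OF s(1), unfolded s(2,3)] and ct = cell_sem[OF t(1), unfolded t(2,3)]
  note ps = cell_path[OF cs] and pt = cell_path[OF ct]
  have 1: "slicesok sg (ttrg s) (tsrc t) (tdom s @ tdom t) (shift (length (tdom s)) (slices t)) \<and>
     outw (tdom s @ tdom t) (shift (length (tdom s)) (slices t)) = tdom s @ tcod t \<and>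
     sem (tsrc t) (tdom s @ tdom t) (shift (length (tdom s)) (slices t)) = ei (tsrc s) (tdom s) \<star> ev t"
    using slicesok_shift[OF t(1) ps(1)[folded m], of "[]" "tsrc t"] t(2,3) m cell_hid(2)[OF ct] by simp
  have sh0: "shift 0 ds = ds" for ds by (simp add: shift_def)
  have 2: "slicesok sg (ttrg s) (tsrc t) (tdom s @ tcod t) (slices s) \<and>
     outw (tdom s @ tcod t) (slices s) = tcod s @ tcod t \<and>
     sem (tsrc t) (tdom s @ tcod t) (slices s) = ev s \<star> ei (tsrc t) (tcod t)"
    using slicesok_shift[OF s(1) _ pt(2)[unfolded m], of "ttrg s" "[]"] s(2,3) sh0
      cell_hid(1)[OF cell_hcomp[OF cs cell_id[OF pt(2)[unfolded m]]]] by simp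
  have ok: "slicesok sg (ttrg s) (tsrc t) (tdom s @ tdom t) (shift (length (tdom s)) (slices t) @ slices s)"
    using 1 2 by (simp add: slicesok_append)
  show ?case
    using ok sem_append[OF ok] 1 2 cell_slide(1)[OF cs ct[unfolded m]] by simp
qed

definition valid :: "rule \<Rightarrow> bool" where
  "valid = (\<lambda>(s, t). ev s = ev t)"

text \<open>Once the scattered slices of \<open>s\<close> are pulled together behind the first
  \<open>n\<close> slices, they form the whiskered value of \<open>s\<close>, which may be exchanged
  for that of \<open>t\<close>.\<close>

lemma rewr_sound:
  assumes ok: "slicesok sg x y w ds" and r: "fs \<in> set (rewr sg x y w ds (n, i, s, t))" and v: "valid (s, t)"
  shows "slicesok sg x y w fs \<and> outw w fs = outw w ds \<and> sem y w fs = sem y w ds"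
proof -
  let ?v = "outw w (take n ds)" and ?d = "tdom s"
  let ?l = "take i ?v" and ?r = "drop (i + length ?d) ?v"
  obtain es where rk: "ruleok sg (s, t)" and i: "i \<le> length ?v" and td: "take (length ?d) (drop i ?v) = ?d"
    and P: "path sg x ?l (ttrg s)" "path sg (tsrc s) ?r y"
    and pl: "es \<in> set (pulls (shift i (slices s)) (drop n ds))"
    and fs: "fs = take n ds @ shift i (slices t) @ es"
    using r by (auto simp: Let_def split: if_splits)
  have ve: "?v = ?l @ ?d @ ?r"
    using td append_take_drop_id[of i ?v] append_take_drop_id[of "length ?d" "drop i ?v"]
    by (simp add: add.commute)
  have li: "length ?l = i" using i by simp
  have ok1: "slicesok sg x y w (take n ds)" "slicesok sg x y ?v (drop n ds)"
    using ok slicesok_append[of x y w "take n ds" "drop n ds"] by auto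
  have e: "sem y w ds = sem y ?v (drop n ds) \<cdot> sem y w (take n ds)" "outw w ds = outw ?v (drop n ds)"
    using sem_append[of x y w "take n ds" "drop n ds"] ok outw_append[of w "take n ds" "drop n ds"] by auto
  note ps = pulls_sound[OF ok1(2) pl]
  have oks: "slicesok sg (ttrg s) (tsrc s) (tdom s) (slices s)" "outw ?d (slices s) = tcod s"
     "sem (tsrc s) (tdom s) (slices s) = ev s"
    using rk slices_sound[of s] by (auto simp: ruleok_def)
  have okt: "slicesok sg (ttrg s) (tsrc s) (tdom s) (slices t)" "outw ?d (slices t) = tcod s"
     "sem (tsrc s) (tdom s) (slices t) = ev s"
    using rk slices_sound[of t] v by (auto simp: ruleok_def valid_def)
  note ss = slicesok_shift[OF oks(1) P, unfolded li, folded ve]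
    and st = slicesok_shift[OF okt(1) P, unfolded li, folded ve]
  have o: "outw ?v (shift i (slices s)) = outw ?v (shift i (slices t))"
    using ss st oks okt by simp
  have A: "slicesok sg x y ?v (shift i (slices t) @ es)" "outw ?v (shift i (slices t) @ es) = outw ?v (drop n ds)"
    using ps st o by (auto simp: slicesok_append)
  have "sem y ?v (shift i (slices t) @ es) = sem y ?v (shift i (slices s) @ es)"
    using sem_append[OF A(1)] sem_append[of x y ?v "shift i (slices s)" es] ps ss st o oks okt by simp
  then have B: "sem y ?v (shift i (slices t) @ es) = sem y ?v (drop n ds)"
    using ps by simp
  have ok2: "slicesok sg x y w (take n ds @ shift i (slices t) @ es)"
    using ok1 A by (simp add: slicesok_append)
  show ?thesis
    unfolding fs using ok2 sem_append[OF ok2] A B e by simp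
qed

lemma rewrs_sound:
  assumes "slicesok sg x y w ds" "fs \<in> set (rewrs sg x y w ds ps)" "\<forall>(n, i, r)\<in>set ps. valid r"
  shows "slicesok sg x y w fs \<and> outw w fs = outw w ds \<and> sem y w fs = sem y w ds"
  using assms
proof (induction ps arbitrary: ds)
  case (Cons p ps)
  obtain n i s t where p: "p = (n, i, s, t)" by (cases p) auto
  obtain es where es: "es \<in> set (rewr sg x y w ds p)" and "fs \<in> set (rewrs sg x y w es ps)"
    using Cons.prems(2) by auto
  moreover have "valid (s, t)" using Cons.prems(3) p by auto
  ultimately show ?case
    using Cons.IH[of es] Cons.prems rewr_sound[OF Cons.prems(1) es[unfolded p]] by auto
qed auto

text \<open>The reflection principle: an equation of 2-cells follows from evaluating
  \<open>derives\<close>, which \<open>simp\<close> does with symbolic indices under their order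
  assumptions.\<close>

theorem derives_sound:
  assumes d: "derives sg ps (s, t)" and v: "\<forall>(n, i, r)\<in>set ps. valid r"
  shows "valid (s, t)"
proof -
  obtain ds where r: "ruleok sg (s, t)" and ds: "ds \<in> set (rewrs sg (ttrg s) (tsrc s) (tdom s) (slices s) ps)"
    and pl: "[] \<in> set (pulls (slices t) ds)"
    using d by (auto simp: derives_def list_ex_iff)
  have s: "slicesok sg (ttrg s) (tsrc s) (tdom s) (slices s)" "sem (tsrc s) (tdom s) (slices s) = ev s"
    using r slices_sound[of s] by (auto simp: ruleok_def)
  have t: "sem (tsrc s) (tdom s) (slices t) = ev t"
    using r slices_sound[of t] by (auto simp: ruleok_def)
  note rs = rewrs_sound[OF s(1) ds v]
  from pulls_sound[OF conjunct1[OF rs] pl] rs s(2) t show ?thesis by (simp add: valid_def)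
qed

end

section \<open>Calculus of weak distributive laws\<close>

abbreviation (input) "mu p i \<equiv> G (Mu p i)"
abbreviation (input) "eta p i \<equiv> G (Eta p i)"
abbreviation (input) "lm p i j \<equiv> G (Lam p i j)"
abbreviation (input) "xi' i \<equiv> G (Xi i)"
abbreviation (input) "one p i \<equiv> I (S p i)"

definition flip :: "rule \<Rightarrow> rule" where "flip = (\<lambda>(s, t). (t, s))"
text \<open>A step with a trivial rule only moves a generator to an earlier place.\<close>

definition triv :: "gen \<Rightarrow> rule" where "triv g = (G g, G g)"

text \<open>\<open>bar\<close> is the idempotent of a law, \<open>wmult\<close> and \<open>wunit\<close> are the
    structure of the weak wreath
  product, \<open>lamR p i j k\<close> is the law between \<open>s\<^sub>k\<close> and
      \<open>s\<^sub>is\<^sub>j\<close>, \<open>lamL p i j k\<close> that between \<open>s\<^sub>js\<^sub>k\<close>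
      and \<open>s\<^sub>i\<close>,
  and \<open>barR\<close>, \<open>barL\<close> are their idempotents; \<open>rawR\<close>, \<open>rawL\<close> are
      not yet normalized by \<open>bar\<close>.\<close>

definition bar :: "bool \<Rightarrow> nat \<Rightarrow> nat \<Rightarrow> tm" where
  "bar p i j = (mu p i \<otimes> one p j) \<bullet> (one p i \<otimes> lm p i j) \<bullet> ((one p i \<otimes> one p
      j) \<otimes> eta p i)"
definition bar2 :: "bool \<Rightarrow> nat \<Rightarrow> nat \<Rightarrow> tm" where
  "bar2 p i j = (one p i \<otimes> mu p j) \<bullet> (lm p i j \<otimes> one p j) \<bullet> (eta p j \<otimes> one p
      i \<otimes> one p j)"
definition wmult :: "bool \<Rightarrow> nat \<Rightarrow> nat \<Rightarrow> tm" where
  "wmult p i j = (mu p i \<otimes> mu p j) \<bullet> (one p i \<otimes> lm p i j \<otimes> one p j)"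
definition wunit :: "bool \<Rightarrow> nat \<Rightarrow> nat \<Rightarrow> tm" where
  "wunit p i j = lm p i j \<bullet> (eta p j \<otimes> eta p i)"
definition rawR :: "bool \<Rightarrow> nat \<Rightarrow> nat \<Rightarrow> nat \<Rightarrow> tm" where
  "rawR p i j k = (one p i \<otimes> lm p j k) \<bullet> (lm p i k \<otimes> one p j)"
definition lamR :: "bool \<Rightarrow> nat \<Rightarrow> nat \<Rightarrow> nat \<Rightarrow> tm" where
  "lamR p i j k = (one p i \<otimes> lm p j k) \<bullet> (lm p i k \<otimes> one p j) \<bullet> (one p k \<otimes>
      bar p i j)"
definition rawL :: "bool \<Rightarrow> nat \<Rightarrow> nat \<Rightarrow> nat \<Rightarrow> tm" where
  "rawL p i j k = (lm p i j \<otimes> one p k) \<bullet> (one p j \<otimes> lm p i k)"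
definition lamL :: "bool \<Rightarrow> nat \<Rightarrow> nat \<Rightarrow> nat \<Rightarrow> tm" where
  "lamL p i j k = (lm p i j \<otimes> one p k) \<bullet> (one p j \<otimes> lm p i k) \<bullet> (bar p j k \<otimes>
      one p i)"
definition barR :: "bool \<Rightarrow> nat \<Rightarrow> nat \<Rightarrow> nat \<Rightarrow> tm" where
  "barR p i j k = (wmult p i j \<otimes> one p k) \<bullet> (bar p i j \<otimes> lamR p i j k) \<bullet> ((bar p i j
      \<otimes> one p k) \<otimes> wunit p i j)"
definition barL :: "bool \<Rightarrow> nat \<Rightarrow> nat \<Rightarrow> nat \<Rightarrow> tm" where
  "barL p i j k = (mu p i \<otimes> bar p j k) \<bullet> (one p i \<otimes> lamL p i j k) \<bullet> ((one p i
      \<otimes> bar p j k) \<otimes> eta p i)"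
definition xiw :: "nat \<Rightarrow> nat \<Rightarrow> tm" where
  "xiw i j = (I V \<otimes> bar False i j) \<bullet> (xi' i \<otimes> one False j) \<bullet> (one True i \<otimes> xi' j)"

lemmas tm_defs = bar_def bar2_def wmult_def wunit_def rawR_def lamR_def rawL_def lamL_def barR_def barL_def xiw_def

section \<open>The axioms as rewrite rules\<close>

definition assoc :: "bool \<Rightarrow> nat \<Rightarrow> rule" where
  "assoc p i = (mu p i \<bullet> (mu p i \<otimes> one p i), mu p i \<bullet> (one p i \<otimes> mu p i))"
definition unit_right :: "bool \<Rightarrow> nat \<Rightarrow> rule" where
  "unit_right p i = (mu p i \<bullet> (one p i \<otimes> eta p i), one p i)"
definition unit_left :: "bool \<Rightarrow> nat \<Rightarrow> rule" where
  "unit_left p i = (mu p i \<bullet> (eta p i \<otimes> one p i), one p i)"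
definition mult_left :: "bool \<Rightarrow> nat \<Rightarrow> nat \<Rightarrow> rule" where
  "mult_left p i j = (lm p i j \<bullet> (mu p j \<otimes> one p i),
     (one p i \<otimes> mu p j) \<bullet> (lm p i j \<otimes> one p j) \<bullet> (one p j \<otimes> lm p i j))"
definition mult_right :: "bool \<Rightarrow> nat \<Rightarrow> nat \<Rightarrow> rule" where
  "mult_right p i j = (lm p i j \<bullet> (one p j \<otimes> mu p i),
     (mu p i \<otimes> one p j) \<bullet> (one p i \<otimes> lm p i j) \<bullet> (lm p i j \<otimes> one p i))"
definition weak_unit_left :: "bool \<Rightarrow> nat \<Rightarrow> nat \<Rightarrow> rule" where
  "weak_unit_left p i j = (lm p i j \<bullet> (eta p j \<otimes> one p i),
     (mu p i \<otimes> one p j) \<bullet> (one p i \<otimes> lm p i j) \<bullet> ((one p i \<otimes> one p j)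
         \<otimes> eta p i) \<bullet> (one p i \<otimes> eta p j))"
definition weak_unit_right :: "bool \<Rightarrow> nat \<Rightarrow> nat \<Rightarrow> rule" where
  "weak_unit_right p i j = (lm p i j \<bullet> (one p j \<otimes> eta p i),
     (one p i \<otimes> mu p j) \<bullet> (lm p i j \<otimes> one p j) \<bullet> (eta p j \<otimes> one p i \<otimes>
         one p j) \<bullet> (eta p i \<otimes> one p j))"
definition yang_baxter :: "bool \<Rightarrow> nat \<Rightarrow> nat \<Rightarrow> nat \<Rightarrow> rule" where
  "yang_baxter p i j k = ((lm p i j \<otimes> one p k) \<bullet> (one p j \<otimes> lm p i k) \<bullet> (lm p j k
      \<otimes> one p i),
     (one p i \<otimes> lm p j k) \<bullet> (lm p i k \<otimes> one p j) \<bullet> (one p k \<otimes> lm p i j))"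
definition xi_mult :: "nat \<Rightarrow> rule" where
  "xi_mult i = (xi' i \<bullet> (mu True i \<otimes> I V),
     (I V \<otimes> mu False i) \<bullet> (xi' i \<otimes> one False i) \<bullet> (one True i \<otimes> xi' i))"
definition xi_unit :: "nat \<Rightarrow> rule" where
  "xi_unit i = (xi' i \<bullet> (eta True i \<otimes> I V), I V \<otimes> eta False i)"
definition xi_lam :: "nat \<Rightarrow> nat \<Rightarrow> rule" where
  "xi_lam i j = ((I V \<otimes> lm False i j) \<bullet> (xi' j \<otimes> one False i) \<bullet> (one True j \<otimes> xi' i),
     (I V \<otimes> bar False i j) \<bullet> (xi' i \<otimes> one False j) \<bullet> (one True i \<otimes> xi' j)
         \<bullet> (lm True i j \<otimes> I V))"

lemmas rule_defs = flip_def triv_def assoc_def unit_right_def unit_left_def mult_left_def mult_right_def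
  weak_unit_left_def weak_unit_right_def yang_baxter_def xi_mult_def xi_unit_def xi_lam_def

section \<open>Derived rules\<close>

definition bar_alt_rule :: "bool \<Rightarrow> nat \<Rightarrow> nat \<Rightarrow> rule" where
  "bar_alt_rule p i j = (bar p i j,
     bar2 p i j)"

definition bar_lam_rule :: "bool \<Rightarrow> nat \<Rightarrow> nat \<Rightarrow> rule" where
  "bar_lam_rule p i j = (bar p i j \<bullet> lm p i j,
     lm p i j)"

definition bar_left_rule :: "bool \<Rightarrow> nat \<Rightarrow> nat \<Rightarrow> rule" where
  "bar_left_rule p i j = (bar p i j \<bullet> (mu p i \<otimes> one p j),
     (mu p i \<otimes> one p j) \<bullet> (one p i \<otimes> bar p i j))"

definition bar_right_rule :: "bool \<Rightarrow> nat \<Rightarrow> nat \<Rightarrow> rule" where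
  "bar_right_rule p i j = (bar p i j \<bullet> (one p i \<otimes> mu p j),
     (one p i \<otimes> mu p j) \<bullet> (bar p i j \<otimes> one p j))"

definition bar_idem_rule :: "bool \<Rightarrow> nat \<Rightarrow> nat \<Rightarrow> rule" where
  "bar_idem_rule p i j = (bar p i j \<bullet> bar p i j,
     bar p i j)"

definition wmult_bar_rule :: "bool \<Rightarrow> nat \<Rightarrow> nat \<Rightarrow> rule" where
  "wmult_bar_rule p i j = (bar p i j \<bullet> wmult p i j,
     wmult p i j)"

definition wmult_bar_left_rule :: "bool \<Rightarrow> nat \<Rightarrow> nat \<Rightarrow> rule" where
  "wmult_bar_left_rule p i j = (wmult p i j \<bullet> (bar p i j \<otimes> one p i \<otimes> one p j),
     wmult p i j)"

definition wmult_bar_right_rule :: "bool \<Rightarrow> nat \<Rightarrow> nat \<Rightarrow> rule" where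
  "wmult_bar_right_rule p i j = (wmult p i j \<bullet> ((one p i \<otimes> one p j) \<otimes> bar p i j),
     wmult p i j)"

definition wmult_bar_both_rule :: "bool \<Rightarrow> nat \<Rightarrow> nat \<Rightarrow> rule" where
  "wmult_bar_both_rule p i j = (wmult p i j \<bullet> (bar p i j \<otimes> bar p i j),
     wmult p i j)"

definition wmult_assoc_rule :: "bool \<Rightarrow> nat \<Rightarrow> nat \<Rightarrow> rule" where
  "wmult_assoc_rule p i j = (wmult p i j \<bullet> (wmult p i j \<otimes> one p i \<otimes> one p j),
     wmult p i j \<bullet> ((one p i \<otimes> one p j) \<otimes> wmult p i j))"

definition wunit_bar_rule :: "bool \<Rightarrow> nat \<Rightarrow> nat \<Rightarrow> rule" where
  "wunit_bar_rule p i j = (bar p i j \<bullet> wunit p i j,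
     wunit p i j)"

definition wmult_wunit_right_rule :: "bool \<Rightarrow> nat \<Rightarrow> nat \<Rightarrow> rule" where
  "wmult_wunit_right_rule p i j = (wmult p i j \<bullet> ((one p i \<otimes> one p j) \<otimes> wunit p i j),
     bar p i j)"

definition wmult_wunit_left_rule :: "bool \<Rightarrow> nat \<Rightarrow> nat \<Rightarrow> rule" where
  "wmult_wunit_left_rule p i j = (wmult p i j \<bullet> (wunit p i j \<otimes> one p i \<otimes> one p j),
     bar p i j)"

definition wreath_assoc_rule :: "bool \<Rightarrow> nat \<Rightarrow> nat \<Rightarrow> rule" where
  "wreath_assoc_rule p i j = (wmult p i j \<bullet> (wmult p i j \<otimes> bar p i j),
     wmult p i j \<bullet> (bar p i j \<otimes> wmult p i j))"

definition wreath_unit_right_rule :: "bool \<Rightarrow> nat \<Rightarrow> nat \<Rightarrow> rule" where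
  "wreath_unit_right_rule p i j = (wmult p i j \<bullet> (bar p i j \<otimes> wunit p i j),
     bar p i j)"

definition wreath_unit_left_rule :: "bool \<Rightarrow> nat \<Rightarrow> nat \<Rightarrow> rule" where
  "wreath_unit_left_rule p i j = (wmult p i j \<bullet> (wunit p i j \<otimes> bar p i j),
     bar p i j)"

definition rawR_mult_left_rule :: "bool \<Rightarrow> nat \<Rightarrow> nat \<Rightarrow> nat \<Rightarrow> rule" where
  "rawR_mult_left_rule p i j k = (rawR p i j k \<bullet> (mu p k \<otimes> one p i \<otimes> one p j),
     ((one p i \<otimes> one p j) \<otimes> mu p k) \<bullet> (rawR p i j k \<otimes> one p k) \<bullet> (one p k
         \<otimes> rawR p i j k))"

definition rawR_mult_right_rule :: "bool \<Rightarrow> nat \<Rightarrow> nat \<Rightarrow> nat \<Rightarrow> rule" where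
  "rawR_mult_right_rule p i j k = (rawR p i j k \<bullet> (one p k \<otimes> wmult p i j),
     (wmult p i j \<otimes> one p k) \<bullet> ((one p i \<otimes> one p j) \<otimes> rawR p i j k) \<bullet> (rawR p
         i j k \<otimes> one p i \<otimes> one p j))"

definition rawR_unit_right_rule :: "bool \<Rightarrow> nat \<Rightarrow> nat \<Rightarrow> nat \<Rightarrow> rule" where
  "rawR_unit_right_rule p i j k = (rawR p i j k \<bullet> (one p k \<otimes> wunit p i j),
     ((one p i \<otimes> one p j) \<otimes> mu p k) \<bullet> (rawR p i j k \<otimes> one p k) \<bullet> (eta p k
         \<otimes> (one p i \<otimes> one p j) \<otimes> one p k) \<bullet> (wunit p i j \<otimes> one p k))"

definition rawR_unit_left_rule :: "bool \<Rightarrow> nat \<Rightarrow> nat \<Rightarrow> nat \<Rightarrow> rule" where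
  "rawR_unit_left_rule p i j k = (rawR p i j k \<bullet> (eta p k \<otimes> bar p i j),
     (wmult p i j \<otimes> one p k) \<bullet> ((one p i \<otimes> one p j) \<otimes> rawR p i j k) \<bullet> (((one
         p i \<otimes> one p j) \<otimes> one p k) \<otimes> wunit p i j) \<bullet> ((one p i \<otimes> one p j)
         \<otimes> eta p k))"

definition lamR_bar_rule :: "bool \<Rightarrow> nat \<Rightarrow> nat \<Rightarrow> nat \<Rightarrow> rule" where
  "lamR_bar_rule p i j k = (lamR p i j k \<bullet> (one p k \<otimes> bar p i j),
     lamR p i j k)"

definition bar_lamR_rule :: "bool \<Rightarrow> nat \<Rightarrow> nat \<Rightarrow> nat \<Rightarrow> rule" where
  "bar_lamR_rule p i j k = ((bar p i j \<otimes> one p k) \<bullet> lamR p i j k,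
     lamR p i j k)"

definition lamR_mult_left_rule :: "bool \<Rightarrow> nat \<Rightarrow> nat \<Rightarrow> nat \<Rightarrow> rule" where
  "lamR_mult_left_rule p i j k = (lamR p i j k \<bullet> (mu p k \<otimes> bar p i j),
     (bar p i j \<otimes> mu p k) \<bullet> (lamR p i j k \<otimes> one p k) \<bullet> (one p k \<otimes> lamR p i j k))"

definition lamR_mult_right_rule :: "bool \<Rightarrow> nat \<Rightarrow> nat \<Rightarrow> nat \<Rightarrow> rule" where
  "lamR_mult_right_rule p i j k = (lamR p i j k \<bullet> (one p k \<otimes> wmult p i j),
     (wmult p i j \<otimes> one p k) \<bullet> (bar p i j \<otimes> lamR p i j k) \<bullet> (lamR p i j k \<otimes>
         bar p i j))"

definition lamR_unit_left_rule :: "bool \<Rightarrow> nat \<Rightarrow> nat \<Rightarrow> nat \<Rightarrow> rule" where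
  "lamR_unit_left_rule p i j k = (lamR p i j k \<bullet> (eta p k \<otimes> bar p i j),
     (wmult p i j \<otimes> one p k) \<bullet> (bar p i j \<otimes> lamR p i j k) \<bullet> ((bar p i j \<otimes> one
         p k) \<otimes> wunit p i j) \<bullet> (bar p i j \<otimes> eta p k))"

definition lamR_unit_right_rule :: "bool \<Rightarrow> nat \<Rightarrow> nat \<Rightarrow> nat \<Rightarrow> rule" where
  "lamR_unit_right_rule p i j k = (lamR p i j k \<bullet> (one p k \<otimes> wunit p i j),
     (bar p i j \<otimes> mu p k) \<bullet> (lamR p i j k \<otimes> one p k) \<bullet> (eta p k \<otimes> bar p i j
         \<otimes> one p k) \<bullet> (wunit p i j \<otimes> one p k))"

definition rawL_mult_left_rule :: "bool \<Rightarrow> nat \<Rightarrow> nat \<Rightarrow> nat \<Rightarrow> rule" where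
  "rawL_mult_left_rule p i j k = (rawL p i j k \<bullet> (wmult p j k \<otimes> one p i),
     (one p i \<otimes> wmult p j k) \<bullet> (rawL p i j k \<otimes> one p j \<otimes> one p k) \<bullet> ((one p j
         \<otimes> one p k) \<otimes> rawL p i j k))"

definition rawL_mult_right_rule :: "bool \<Rightarrow> nat \<Rightarrow> nat \<Rightarrow> nat \<Rightarrow> rule" where
  "rawL_mult_right_rule p i j k = (rawL p i j k \<bullet> ((one p j \<otimes> one p k) \<otimes> mu p i),
     (mu p i \<otimes> one p j \<otimes> one p k) \<bullet> (one p i \<otimes> rawL p i j k) \<bullet> (rawL p i j k
         \<otimes> one p i))"

definition rawL_unit_left_rule :: "bool \<Rightarrow> nat \<Rightarrow> nat \<Rightarrow> nat \<Rightarrow> rule" where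
  "rawL_unit_left_rule p i j k = (rawL p i j k \<bullet> (wunit p j k \<otimes> one p i),
     (mu p i \<otimes> one p j \<otimes> one p k) \<bullet> (one p i \<otimes> rawL p i j k) \<bullet> ((one p i
         \<otimes> one p j \<otimes> one p k) \<otimes> eta p i) \<bullet> (one p i \<otimes> wunit p j k))"

definition rawL_unit_right_rule :: "bool \<Rightarrow> nat \<Rightarrow> nat \<Rightarrow> nat \<Rightarrow> rule" where
  "rawL_unit_right_rule p i j k = (rawL p i j k \<bullet> (bar p j k \<otimes> eta p i),
     (one p i \<otimes> wmult p j k) \<bullet> (rawL p i j k \<otimes> one p j \<otimes> one p k) \<bullet> (wunit p
         j k \<otimes> one p i \<otimes> one p j \<otimes> one p k) \<bullet> (eta p i \<otimes> one p j \<otimes> one p k))"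

definition lamL_bar_rule :: "bool \<Rightarrow> nat \<Rightarrow> nat \<Rightarrow> nat \<Rightarrow> rule" where
  "lamL_bar_rule p i j k = (lamL p i j k \<bullet> (bar p j k \<otimes> one p i),
     lamL p i j k)"

definition bar_lamL_rule :: "bool \<Rightarrow> nat \<Rightarrow> nat \<Rightarrow> nat \<Rightarrow> rule" where
  "bar_lamL_rule p i j k = ((one p i \<otimes> bar p j k) \<bullet> lamL p i j k,
     lamL p i j k)"

definition lamL_mult_left_rule :: "bool \<Rightarrow> nat \<Rightarrow> nat \<Rightarrow> nat \<Rightarrow> rule" where
  "lamL_mult_left_rule p i j k = (lamL p i j k \<bullet> (wmult p j k \<otimes> one p i),
     (one p i \<otimes> wmult p j k) \<bullet> (lamL p i j k \<otimes> bar p j k) \<bullet> (bar p j k \<otimes> lamL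
         p i j k))"

definition lamL_mult_right_rule :: "bool \<Rightarrow> nat \<Rightarrow> nat \<Rightarrow> nat \<Rightarrow> rule" where
  "lamL_mult_right_rule p i j k = (lamL p i j k \<bullet> (bar p j k \<otimes> mu p i),
     (mu p i \<otimes> bar p j k) \<bullet> (one p i \<otimes> lamL p i j k) \<bullet> (lamL p i j k \<otimes> one p i))"

definition lamL_unit_left_rule :: "bool \<Rightarrow> nat \<Rightarrow> nat \<Rightarrow> nat \<Rightarrow> rule" where
  "lamL_unit_left_rule p i j k = (lamL p i j k \<bullet> (wunit p j k \<otimes> one p i),
     (mu p i \<otimes> bar p j k) \<bullet> (one p i \<otimes> lamL p i j k) \<bullet> ((one p i \<otimes> bar p j k)
         \<otimes> eta p i) \<bullet> (one p i \<otimes> wunit p j k))"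

definition lamL_unit_right_rule :: "bool \<Rightarrow> nat \<Rightarrow> nat \<Rightarrow> nat \<Rightarrow> rule" where
  "lamL_unit_right_rule p i j k = (lamL p i j k \<bullet> (bar p j k \<otimes> eta p i),
     (one p i \<otimes> wmult p j k) \<bullet> (lamL p i j k \<otimes> bar p j k) \<bullet> (wunit p j k \<otimes>
         one p i \<otimes> bar p j k) \<bullet> (eta p i \<otimes> bar p j k))"

definition barR_mid_rule :: "bool \<Rightarrow> nat \<Rightarrow> nat \<Rightarrow> nat \<Rightarrow> rule" where
  "barR_mid_rule p i j k = (barR p i j k,
     (wmult p i j \<otimes> one p k) \<bullet> ((one p i \<otimes> one p j) \<otimes> lamR p i j k) \<bullet> (((one
         p i \<otimes> one p j) \<otimes> one p k) \<otimes> wunit p i j))"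

definition barL_mid_rule :: "bool \<Rightarrow> nat \<Rightarrow> nat \<Rightarrow> nat \<Rightarrow> rule" where
  "barL_mid_rule p i j k = (barL p i j k,
     (mu p i \<otimes> one p j \<otimes> one p k) \<bullet> (one p i \<otimes> lamL p i j k) \<bullet> ((one p i
         \<otimes> one p j \<otimes> one p k) \<otimes> eta p i))"

definition barR_short_rule :: "bool \<Rightarrow> nat \<Rightarrow> nat \<Rightarrow> nat \<Rightarrow> rule" where
  "barR_short_rule p i j k = (barR p i j k,
     ((one p i \<otimes> one p j) \<otimes> mu p k) \<bullet> (lamR p i j k \<otimes> one p k) \<bullet> (eta p k
         \<otimes> (one p i \<otimes> one p j) \<otimes> one p k))"

definition barL_short_rule :: "bool \<Rightarrow> nat \<Rightarrow> nat \<Rightarrow> nat \<Rightarrow> rule" where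
  "barL_short_rule p i j k = ((mu p i \<otimes> one p j \<otimes> one p k) \<bullet> (one p i \<otimes> lamL p i j k)
      \<bullet> ((one p i \<otimes> one p j \<otimes> one p k) \<otimes> eta p i),
     (one p i \<otimes> wmult p j k) \<bullet> (lamL p i j k \<otimes> one p j \<otimes> one p k) \<bullet> (wunit p
         j k \<otimes> one p i \<otimes> one p j \<otimes> one p k))"

definition barR_short_Z_rule :: "bool \<Rightarrow> nat \<Rightarrow> nat \<Rightarrow> nat \<Rightarrow> rule" where
  "barR_short_Z_rule p i j k = (((one p i \<otimes> one p j) \<otimes> mu p k) \<bullet> (lamR p i j k \<otimes> one
      p k) \<bullet> (eta p k \<otimes> (one p i \<otimes> one p j) \<otimes> one p k),
     (mu p i \<otimes> one p j \<otimes> mu p k) \<bullet> (one p i \<otimes> (rawR p i j k \<bullet> (eta p k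
         \<otimes> (lm p i j \<bullet> (one p j \<otimes> eta p i)))) \<otimes> one p k))"

definition Z_eq_rule :: "bool \<Rightarrow> nat \<Rightarrow> nat \<Rightarrow> nat \<Rightarrow> rule" where
  "Z_eq_rule p i j k = ((mu p i \<otimes> one p j \<otimes> mu p k) \<bullet> (one p i \<otimes> (rawR p i j k
      \<bullet> (eta p k \<otimes> (lm p i j \<bullet> (one p j \<otimes> eta p i)))) \<otimes> one p k),
     (mu p i \<otimes> one p j \<otimes> mu p k) \<bullet> (one p i \<otimes> (rawL p i j k \<bullet> ((lm p j k
         \<bullet> (eta p k \<otimes> one p j)) \<otimes> eta p i)) \<otimes> one p k))"

definition barL_short_Z_rule :: "bool \<Rightarrow> nat \<Rightarrow> nat \<Rightarrow> nat \<Rightarrow> rule" where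
  "barL_short_Z_rule p i j k = ((mu p i \<otimes> one p j \<otimes> one p k) \<bullet> (one p i \<otimes> lamL p i j
      k) \<bullet> ((one p i \<otimes> one p j \<otimes> one p k) \<otimes> eta p i),
     (mu p i \<otimes> one p j \<otimes> mu p k) \<bullet> (one p i \<otimes> (rawL p i j k \<bullet> ((lm p j k
         \<bullet> (eta p k \<otimes> one p j)) \<otimes> eta p i)) \<otimes> one p k))"

definition barR_barL_rule :: "bool \<Rightarrow> nat \<Rightarrow> nat \<Rightarrow> nat \<Rightarrow> rule" where
  "barR_barL_rule p i j k = (barR p i j k,
     barL p i j k)"

definition bar_barR_rule :: "bool \<Rightarrow> nat \<Rightarrow> nat \<Rightarrow> nat \<Rightarrow> rule" where
  "bar_barR_rule p i j k = ((bar p i j \<otimes> one p k) \<bullet> barR p i j k,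
     barR p i j k)"

definition bar_barL_rule :: "bool \<Rightarrow> nat \<Rightarrow> nat \<Rightarrow> nat \<Rightarrow> rule" where
  "bar_barL_rule p i j k = ((one p i \<otimes> bar p j k) \<bullet> barL p i j k,
     barL p i j k)"

definition barR_rawR_rule :: "bool \<Rightarrow> nat \<Rightarrow> nat \<Rightarrow> nat \<Rightarrow> rule" where
  "barR_rawR_rule p i j k = (barR p i j k \<bullet> rawR p i j k,
     lamR p i j k)"

definition barL_rawL_rule :: "bool \<Rightarrow> nat \<Rightarrow> nat \<Rightarrow> nat \<Rightarrow> rule" where
  "barL_rawL_rule p i j k = (barL p i j k \<bullet> rawL p i j k,
     lamL p i j k)"

text \<open>The factor absorbed by \<open>barR\<close> is the second formula for the idempotent of a
  law, with \<open>rawR\<close> put in the place of the law. The factor in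
  \<open>barL_F_rule\<close> is the first formula, with \<open>rawL\<close>.\<close>

definition barR_E_rule :: "bool \<Rightarrow> nat \<Rightarrow> nat \<Rightarrow> nat \<Rightarrow> rule" where
  "barR_E_rule p i j k = (barR p i j k \<bullet> ((one p i \<otimes> one p j) \<otimes> mu p k) \<bullet> (rawR p i j
      k \<otimes> one p k) \<bullet> (eta p k \<otimes> one p i \<otimes> one p j \<otimes> one p k),
     barR p i j k)"

definition barL_F_rule :: "bool \<Rightarrow> nat \<Rightarrow> nat \<Rightarrow> nat \<Rightarrow> rule" where
  "barL_F_rule p i j k = (barL p i j k \<bullet> (mu p i \<otimes> one p j \<otimes> one p k) \<bullet> (one p i
      \<otimes> rawL p i j k) \<bullet> ((one p i \<otimes> one p j \<otimes> one p k) \<otimes> eta p i),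
     barL p i j k)"

definition E_lam_rule :: "bool \<Rightarrow> nat \<Rightarrow> nat \<Rightarrow> nat \<Rightarrow> rule" where
  "E_lam_rule p i j k = ((((one p i \<otimes> one p j) \<otimes> mu p k) \<bullet> (rawR p i j k \<otimes> one p k)
      \<bullet> (eta p k \<otimes> one p i \<otimes> one p j \<otimes> one p k)) \<bullet> (one p i \<otimes> lm p j k),
     (one p i \<otimes> lm p j k) \<bullet> (bar p i k \<otimes> one p j))"

definition F_lam_rule :: "bool \<Rightarrow> nat \<Rightarrow> nat \<Rightarrow> nat \<Rightarrow> rule" where
  "F_lam_rule p i j k = (((mu p i \<otimes> one p j \<otimes> one p k) \<bullet> (one p i \<otimes> rawL p i j k)
      \<bullet> ((one p i \<otimes> one p j \<otimes> one p k) \<otimes> eta p i)) \<bullet> (lm p i j \<otimes> one p k),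
     (lm p i j \<otimes> one p k) \<bullet> (one p j \<otimes> bar p i k))"

text \<open>The compatibility of a 1-cell with \<open>lm p i k\<close> leaves a stray
  \<open>bar p i k\<close> in front of \<open>lm p j k\<close>; this rule removes it in the presence
  of \<open>barR\<close>.\<close>

definition barR_lam_rule :: "bool \<Rightarrow> nat \<Rightarrow> nat \<Rightarrow> nat \<Rightarrow> rule" where
  "barR_lam_rule p i j k = (barR p i j k \<bullet> (one p i \<otimes> lm p j k) \<bullet> (bar p i k \<otimes> one p j),
     barR p i j k \<bullet> (one p i \<otimes> lm p j k))"

definition barL_lam_rule :: "bool \<Rightarrow> nat \<Rightarrow> nat \<Rightarrow> nat \<Rightarrow> rule" where
  "barL_lam_rule p i j k = (barL p i j k \<bullet> (lm p i j \<otimes> one p k) \<bullet> (one p j \<otimes> bar p i k),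
     barL p i j k \<bullet> (lm p i j \<otimes> one p k))"

definition triple_mult_rule :: "bool \<Rightarrow> nat \<Rightarrow> nat \<Rightarrow> nat \<Rightarrow> rule" where
  "triple_mult_rule p i j k = ((wmult p i j \<otimes> mu p k) \<bullet> (bar p i j \<otimes> lamR p i j k \<otimes> one p k),
     (mu p i \<otimes> wmult p j k) \<bullet> (one p i \<otimes> lamL p i j k \<otimes> bar p j k))"

definition triple_unit_rule :: "bool \<Rightarrow> nat \<Rightarrow> nat \<Rightarrow> nat \<Rightarrow> rule" where
  "triple_unit_rule p i j k = (lamR p i j k \<bullet> (eta p k \<otimes> wunit p i j),
     lamL p i j k \<bullet> (wunit p j k \<otimes> eta p i))"

definition yang_baxter_RR_rule :: "bool \<Rightarrow> nat \<Rightarrow> nat \<Rightarrow> nat \<Rightarrow> nat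
    \<Rightarrow> rule" where
  "yang_baxter_RR_rule p i j k l = ((lamR p i j k \<otimes> one p l) \<bullet> (one p k \<otimes> lamR p i j l)
      \<bullet> (lm p k l \<otimes> bar p i j),
     (bar p i j \<otimes> lm p k l) \<bullet> (lamR p i j l \<otimes> one p k) \<bullet> (one p l \<otimes> lamR p i j k))"

definition yang_baxter_lawR_rule :: "bool \<Rightarrow> nat \<Rightarrow> nat \<Rightarrow> nat \<Rightarrow> nat
    \<Rightarrow> rule" where
  "yang_baxter_lawR_rule p i j k l = ((lamL p i j k \<otimes> one p l) \<bullet> (bar p j k \<otimes> lm p i l)
      \<bullet> (lamR p j k l \<otimes> one p i),
     (one p i \<otimes> lamR p j k l) \<bullet> (lm p i l \<otimes> bar p j k) \<bullet> (one p l \<otimes> lamL p i j k))"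

definition yang_baxter_lawL_rule :: "bool \<Rightarrow> nat \<Rightarrow> nat \<Rightarrow> nat \<Rightarrow> nat
    \<Rightarrow> rule" where
  "yang_baxter_lawL_rule p i j k l = ((lm p i j \<otimes> bar p k l) \<bullet> (one p j \<otimes> lamL p i k l)
      \<bullet> (lamL p j k l \<otimes> one p i),
     (one p i \<otimes> lamL p j k l) \<bullet> (lamL p i k l \<otimes> one p j) \<bullet> (bar p k l \<otimes> lm p i j))"

definition triple_law_rule :: "bool \<Rightarrow> nat \<Rightarrow> nat \<Rightarrow> nat \<Rightarrow> nat
    \<Rightarrow> rule" where
  "triple_law_rule p i j k l = ((bar p i j \<otimes> lm p k l) \<bullet> (lamR p i j l \<otimes> one p k) \<bullet>
      (one p l \<otimes> barR p i j k),
     (one p i \<otimes> lamR p j k l) \<bullet> (lm p i l \<otimes> bar p j k) \<bullet> (one p l \<otimes> barL p i j k))"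

definition disjoint_law_rule :: "bool \<Rightarrow> nat \<Rightarrow> nat \<Rightarrow> nat \<Rightarrow> nat
    \<Rightarrow> rule" where
  "disjoint_law_rule p i j k l = ((one p i \<otimes> lamL p j k l) \<bullet> (lamL p i k l \<otimes> one p j)
      \<bullet> (bar p k l \<otimes> bar p i j),
     (lamR p i j k \<otimes> one p l) \<bullet> (one p k \<otimes> lamR p i j l) \<bullet> (bar p k l \<otimes> bar p i j))"

definition xiw_cod_rule :: "nat \<Rightarrow> nat \<Rightarrow> rule" where
  "xiw_cod_rule i j = ((I V \<otimes> bar False i j) \<bullet> xiw i j,
     xiw i j)"

definition xiw_dom_rule :: "nat \<Rightarrow> nat \<Rightarrow> rule" where
  "xiw_dom_rule i j = (xiw i j \<bullet> (bar True i j \<otimes> I V),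
     xiw i j)"

definition xiw_mult_rule :: "nat \<Rightarrow> nat \<Rightarrow> rule" where
  "xiw_mult_rule i j = (xiw i j \<bullet> (wmult True i j \<otimes> I V),
     (I V \<otimes> wmult False i j) \<bullet> (xiw i j \<otimes> bar False i j) \<bullet> (bar True i j \<otimes> xiw i j))"

definition xiw_unit_rule :: "nat \<Rightarrow> nat \<Rightarrow> rule" where
  "xiw_unit_rule i j = (xiw i j \<bullet> (wunit True i j \<otimes> I V),
     I V \<otimes> wunit False i j)"

definition xi_lamR_rule :: "nat \<Rightarrow> nat \<Rightarrow> nat \<Rightarrow> rule" where
  "xi_lamR_rule i j k = ((I V \<otimes> lamR False i j k) \<bullet> (xi' k \<otimes> bar False i j) \<bullet> (one
      True k \<otimes> xiw i j),
     (I V \<otimes> barR False i j k) \<bullet> (xiw i j \<otimes> one False k) \<bullet> (bar True i j \<otimes> xi'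
         k) \<bullet> (lamR True i j k \<otimes> I V))"

definition xi_lamL_rule :: "nat \<Rightarrow> nat \<Rightarrow> nat \<Rightarrow> rule" where
  "xi_lamL_rule i j k = ((I V \<otimes> lamL False i j k) \<bullet> (xiw j k \<otimes> one False i) \<bullet> (bar
      True j k \<otimes> xi' i),
     (I V \<otimes> barL False i j k) \<bullet> (xi' i \<otimes> bar False j k) \<bullet> (one True i \<otimes> xiw j
         k) \<bullet> (lamL True i j k \<otimes> I V))"

definition xi_triple_rule :: "nat \<Rightarrow> nat \<Rightarrow> nat \<Rightarrow> rule" where
  "xi_triple_rule i j k = ((I V \<otimes> barR False i j k) \<bullet> (xiw i j \<otimes> one False k) \<bullet> (bar
      True i j \<otimes> xi' k),
     (I V \<otimes> barL False i j k) \<bullet> (xi' i \<otimes> bar False j k) \<bullet> (one True i \<otimes> xiw j k))"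

lemmas derivation_simps = derives_def ruleok_def shift_def tm_defs rule_defs

text \<open>The flag \<open>h\<close> decides between two uses. If it is false, the monads and laws
  at \<open>p = False\<close> form a 0-cell and nothing is assumed about \<open>v\<close> and
  \<open>xi\<close>; if it is true, there are two 0-cells and a 1-cell between them.\<close>

locale weak_system = two_category L for L :: "('o, 'a, 'c) tcat" +
  fixes r :: nat and h :: bool and A :: "bool \<Rightarrow> 'o" and mon :: "bool \<Rightarrow> nat \<Rightarrow> 'a
      \<times> 'c \<times> 'c"
    and lam :: "bool \<Rightarrow> nat \<Rightarrow> nat \<Rightarrow> 'c" and v :: 'a and xi :: "nat \<Rightarrow> 'c"
  assumes A_ob: "A p \<in> tc_ob L"
    and mon: "i \<le> r \<Longrightarrow> (p \<longrightarrow> h) \<Longrightarrow> is_monad L (A p) (mon p i)"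
    and wdl: "i < j \<Longrightarrow> j \<le> r \<Longrightarrow> (p \<longrightarrow> h) \<Longrightarrow> is_wdl L
        (A p) (mon p j) (mon p i) (lam p i j)"
    and yb: "i < j \<Longrightarrow> j < k \<Longrightarrow> k \<le> r \<Longrightarrow> (p \<longrightarrow> h)
        \<Longrightarrow>
      tc_vcomp L (wr L (lam p i j) (fst (mon p k)))
        (tc_vcomp L (wl L (fst (mon p j)) (lam p i k)) (wr L (lam p j k) (fst (mon p i)))) =
      tc_vcomp L (wl L (fst (mon p i)) (lam p j k))
        (tc_vcomp L (wr L (lam p i k) (fst (mon p j))) (wl L (fst (mon p k)) (lam p i j)))"
    and v: "h \<Longrightarrow> v \<in> tc_arr1 L \<and> tc_src L v = A False \<and> tc_trg L v = A True"
    and xi: "i \<le> r \<Longrightarrow> h \<Longrightarrow> is_mnd_mor L (mon False i) (mon True i) v (xi i)"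
    and xi_wdl: "i < j \<Longrightarrow> j \<le> r \<Longrightarrow> h \<Longrightarrow>
      wdl_mor_cond L (mon False j) (mon False i) (lam False i j) (mon True j) (mon True i) (lam True i j) v (xi j) (xi i)"
begin

fun lt :: "letter \<Rightarrow> 'a" where
  "lt (S p i) = fst (mon p i)"
| "lt V = v"

fun gi :: "gen \<Rightarrow> 'c" where
  "gi (Mu p i) = fst (snd (mon p i))"
| "gi (Eta p i) = snd (snd (mon p i))"
| "gi (Lam p i j) = lam p i j"
| "gi (Xi i) = xi i"

lemma lt_typed:
  "letok (r, h) l \<Longrightarrow> lt l \<in> tc_arr1 L \<and> tc_src L (lt l) = A (lsrc l) \<and> tc_trg L (lt l) =
      A (ltrg l)"
  using mon v by (cases l) (auto simp: is_monad_def case_prod_unfold)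

lemma gi_typed:
  "genok (r, h) g \<Longrightarrow> gi g \<in> tc_arr2 L \<and>
      tc_dom L (gi g) = foldr (tc_comp1 L) (map lt (gdom g)) (tc_id1 L (A (gsrc g))) \<and>
      tc_cod L (gi g) = foldr (tc_comp1 L) (map lt (gcod g)) (tc_id1 L (A (gsrc g)))"
proof (cases g)
  case (Lam p i j)
  assume "genok (r, h) g"
  with Lam show ?thesis
    using wdl[of i j p] lt_typed[of "S p i"] lt_typed[of "S p j"] by (auto simp: is_wdl_def case_prod_unfold)
next
  case (Xi i)
  assume "genok (r, h) g"
  with Xi show ?thesis
    using xi[of i] lt_typed[of V] lt_typed[of "S False i"] lt_typed[of "S True i"]
    by (auto simp: is_mnd_mor_def case_prod_unfold)
qed (use mon in \<open>auto simp: is_monad_def case_prod_unfold\<close>)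

sublocale interpretation_of_diagrams L "(r, h)" A lt gi
  by unfold_locales (use A_ob lt_typed gi_typed in auto)

lemma valid_flip [simp]: "valid (flip q) \<longleftrightarrow> valid q"
  by (auto simp: valid_def flip_def split: prod.splits)

lemma valid_triv [simp]: "valid (triv g)"
  by (simp add: valid_def triv_def)

lemma valid_by: "derives (r, h) ps q \<Longrightarrow> \<forall>(n, i, q)\<in>set ps. valid q \<Longrightarrow> valid q"
  using derives_sound by (cases q) auto

lemma valid_monad:
  assumes "i \<le> r" "p \<longrightarrow> h"
  shows "valid (assoc p i)" "valid (unit_right p i)" "valid (unit_left p i)"
  using mon[OF assms]
  by (simp_all add: valid_def assoc_def unit_right_def unit_left_def is_monad_def wl_def wr_def case_prod_unfold)

lemma valid_wdl:
  assumes "i < j" "j \<le> r" "p \<longrightarrow> h"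
  shows "valid (mult_left p i j)" "valid (mult_right p i j)"
    "valid (weak_unit_left p i j)" "valid (weak_unit_right p i j)"
  using wdl[OF assms] mon[of i p] mon[of j p] assms
  by (simp_all add: valid_def mult_left_def mult_right_def weak_unit_left_def weak_unit_right_def
      is_wdl_def is_monad_def wl_def wr_def case_prod_unfold hcomp_id2)

lemma valid_yang_baxter:
  assumes "i < j" "j < k" "k \<le> r" "p \<longrightarrow> h"
  shows "valid (yang_baxter p i j k)"
  using yb[OF assms] by (simp add: valid_def yang_baxter_def wl_def wr_def)

lemma ev_bar:
  "i < j \<Longrightarrow> j \<le> r \<Longrightarrow> (p \<longrightarrow> h) \<Longrightarrow> ev (bar p i j) =
      lambar L (mon p j) (mon p i) (lam p i j)"
  using mon[of i p] mon[of j p]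
  by (simp add: bar_def lambar_def wl_def wr_def case_prod_unfold is_monad_def hcomp_id2)

lemma valid_xi:
  assumes h
  shows "i \<le> r \<Longrightarrow> valid (xi_mult i)" "i \<le> r \<Longrightarrow> valid (xi_unit i)"
    "i < j \<Longrightarrow> j \<le> r \<Longrightarrow> valid (xi_lam i j)"
  using xi[of i] xi_wdl[of i j] assms
  by (simp_all add: valid_def xi_mult_def xi_unit_def xi_lam_def ev_bar is_mnd_mor_def wdl_mor_cond_def
      wl_def wr_def case_prod_unfold)

lemmas base_valid = valid_monad valid_wdl valid_yang_baxter valid_xi

section \<open>One law: its idempotent and its weak wreath product\<close>

lemma valid_bar_alt:
  assumes "i < j" "j \<le> r" "p \<longrightarrow> h"
  shows "valid (bar_alt_rule p i j)"
  \<comment> \<open>\<open>weak_unit_right\<close> expresses the law on \<open>eta p i\<close>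
    through a new unit \<open>eta p j\<close>. Together with the outer \<open>mu p i\<close> this
    completes the right-hand side of \<open>weak_unit_left\<close>, which is then read
    backwards.\<close>
  by (rule valid_by[where ps = "[
    (0, 1, weak_unit_right p i j), (0, 0, flip (weak_unit_left p i j))]"])
    (use assms in \<open>simp add: bar_alt_rule_def derivation_simps\<close>,
     use assms in \<open>simp add: base_valid\<close>)

text \<open>Two successive crossings followed by \<open>mu p i\<close> are one crossing after
  multiplying, by \<open>mult_right\<close> read backwards; the unit inside the idempotent then
  cancels.\<close>

lemma valid_bar_lam:
  assumes "i < j" "j \<le> r" "p \<longrightarrow> h"
  shows "valid (bar_lam_rule p i j)"
  by (rule valid_by[where ps = "[
    (0, 2, triv (Eta p i)), (1, 0, flip (mult_right p i j)), (0, 1, unit_right p i)]"])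
    (use assms in \<open>simp add: bar_lam_rule_def derivation_simps\<close>,
     use assms in \<open>simp add: base_valid\<close>)

lemma valid_bar_left:
  assumes "i < j" "j \<le> r" "p \<longrightarrow> h"
  shows "valid (bar_left_rule p i j)"
  by (rule valid_by[where ps = "[
    (0, 3, triv (Eta p i)), (1, 2, triv (Lam p i j)), (2, 0, assoc p i)]"])
    (use assms in \<open>simp add: bar_left_rule_def derivation_simps\<close>,
     use assms in \<open>simp add: base_valid\<close>)

text \<open>Left linearity is visible in the formula defining \<open>bar\<close>, right linearity
  only in \<open>bar2\<close>; the weak unit axiom leads from the one to the other and back.\<close>

lemma valid_bar_right:
  assumes "i < j" "j \<le> r" "p \<longrightarrow> h"
  shows "valid (bar_right_rule p i j)"
  by (rule valid_by[where ps = "[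
    (1, 1, weak_unit_right p i j), (0, 1, triv (Eta p i)), (1, 1, triv (Eta p j)),
    (2, 1, triv (Lam p i j)), (3, 2, flip (assoc p j)), (0, 1, flip (weak_unit_right p i j))]"])
    (use assms in \<open>simp add: bar_right_rule_def derivation_simps\<close>,
     use assms in \<open>simp add: base_valid\<close>)

lemma valid_bar_idem:
  assumes "i < j" "j \<le> r" "p \<longrightarrow> h"
  shows "valid (bar_idem_rule p i j)"
  by (rule valid_by[where ps = "[
    (2, 0, bar_left_rule p i j), (1, 1, bar_lam_rule p i j)]"])
    (use assms in \<open>simp add: bar_idem_rule_def bar_lam_rule_def bar_left_rule_def derivation_simps\<close>,
     use assms in \<open>simp add: base_valid valid_bar_lam valid_bar_left\<close>)

text \<open>Linearity on both sides carries the idempotent through the two multiplications to the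
  law in the middle, which absorbs it.\<close>

lemma valid_wmult_bar:
  assumes "i < j" "j \<le> r" "p \<longrightarrow> h"
  shows "valid (wmult_bar_rule p i j)"
  by (rule valid_by[where ps = "[
    (1, 0, triv (Mu p i)), (2, 0, bar_right_rule p i j), (1, 0, bar_left_rule p i j),
    (0, 1, bar_lam_rule p i j)]"])
    (use assms in \<open>simp add: wmult_bar_rule_def bar_lam_rule_def bar_left_rule_def bar_right_rule_def
        derivation_simps\<close>,
     use assms in \<open>simp add: base_valid valid_bar_lam valid_bar_left valid_bar_right\<close>)

lemma valid_wmult_bar_left:
  assumes "i < j" "j \<le> r" "p \<longrightarrow> h"
  shows "valid (wmult_bar_left_rule p i j)"
  by (rule valid_by[where ps = "[
    (2, 2, triv (Lam p i j)), (3, 0, assoc p i), (1, 1, flip (mult_right p i j)), (0, 2, unit_left p i)]"])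
    (use assms in \<open>simp add: wmult_bar_left_rule_def derivation_simps\<close>,
     use assms in \<open>simp add: base_valid\<close>)

lemma valid_wmult_bar_right:
  assumes "i < j" "j \<le> r" "p \<longrightarrow> h"
  shows "valid (wmult_bar_right_rule p i j)"
  by (rule valid_by[where ps = "[
    (0, 2, bar_alt_rule p i j), (2, 1, triv (Lam p i j)), (3, 2, flip (assoc p j)),
    (1, 1, flip (mult_left p i j)), (0, 1, unit_right p j)]"])
    (use assms in \<open>simp add: wmult_bar_right_rule_def bar_alt_rule_def derivation_simps\<close>,
     use assms in \<open>simp add: base_valid valid_bar_alt\<close>)

lemma valid_wmult_bar_both:
  assumes "i < j" "j \<le> r" "p \<longrightarrow> h"
  shows "valid (wmult_bar_both_rule p i j)"
  by (rule valid_by[where ps = "[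
    (0, 2, triv (Eta p i)), (1, 1, triv (Lam p i j)), (2, 0, triv (Mu p i)),
    (3, 0, wmult_bar_right_rule p i j), (0, 0, wmult_bar_left_rule p i j)]"])
    (use assms in \<open>simp add: wmult_bar_both_rule_def wmult_bar_left_rule_def wmult_bar_right_rule_def
        derivation_simps\<close>,
     use assms in \<open>simp add: base_valid valid_wmult_bar_left valid_wmult_bar_right\<close>)

lemma valid_wmult_assoc:
  assumes "i < j" "j \<le> r" "p \<longrightarrow> h"
  shows "valid (wmult_assoc_rule p i j)"
  by (rule valid_by[where ps = "[
    (1, 2, mult_left p i j), (3, 0, assoc p i), (0, 3, triv (Lam p i j)), (1, 1, flip (mult_right p i j)),
    (3, 2, assoc p j)]"])
    (use assms in \<open>simp add: wmult_assoc_rule_def derivation_simps\<close>,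
     use assms in \<open>simp add: base_valid\<close>)

lemma valid_wunit_bar:
  assumes "i < j" "j \<le> r" "p \<longrightarrow> h"
  shows "valid (wunit_bar_rule p i j)"
  by (rule valid_by[where ps = "[
    (2, 0, bar_lam_rule p i j)]"])
    (use assms in \<open>simp add: wunit_bar_rule_def bar_lam_rule_def derivation_simps\<close>,
     use assms in \<open>simp add: base_valid valid_bar_lam\<close>)

text \<open>By \<open>mult_left\<close> read backwards the unit of \<open>s\<^sub>j\<close> meets
  its multiplication and cancels; what remains is the formula defining the idempotent. Hence the
  merged unit is neutral up to exactly this idempotent.\<close>

lemma valid_wmult_wunit_right:
  assumes "i < j" "j \<le> r" "p \<longrightarrow> h"
  shows "valid (wmult_wunit_right_rule p i j)"
  by (rule valid_by[where ps = "[
    (2, 1, flip (mult_left p i j)), (0, 1, unit_right p j)]"])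
    (use assms in \<open>simp add: wmult_wunit_right_rule_def derivation_simps\<close>,
     use assms in \<open>simp add: base_valid\<close>)

lemma valid_wmult_wunit_left:
  assumes "i < j" "j \<le> r" "p \<longrightarrow> h"
  shows "valid (wmult_wunit_left_rule p i j)"
  by (rule valid_by[where ps = "[
    (2, 0, flip (mult_right p i j)), (0, 0, unit_left p i), (0, 0, weak_unit_left p i j),
    (0, 1, flip (weak_unit_right p i j))]"])
    (use assms in \<open>simp add: wmult_wunit_left_rule_def derivation_simps\<close>,
     use assms in \<open>simp add: base_valid\<close>)

text \<open>This and the two unit rules after it are the monad axioms in the form they take in the
  closure, where whiskering by the merged monad is horizontal composition with
  \<open>bar\<close>.\<close>

lemma valid_wreath_assoc:
  assumes "i < j" "j \<le> r" "p \<longrightarrow> h"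
  shows "valid (wreath_assoc_rule p i j)"
  by (rule valid_by[where ps = "[
    (0, 1, triv (Lam p i j)), (1, 2, triv (Mu p j)), (2, 0, triv (Mu p i)), (3, 0, wmult_bar_right_rule p i j),
    (0, 0, wmult_assoc_rule p i j), (3, 0, flip (wmult_bar_left_rule p i j))]"])
    (use assms in \<open>simp add: wreath_assoc_rule_def wmult_assoc_rule_def wmult_bar_left_rule_def
        wmult_bar_right_rule_def derivation_simps\<close>,
     use assms in \<open>simp add: base_valid valid_wmult_assoc valid_wmult_bar_left valid_wmult_bar_right\<close>)

lemma valid_wreath_unit_right:
  assumes "i < j" "j \<le> r" "p \<longrightarrow> h"
  shows "valid (wreath_unit_right_rule p i j)"
  by (rule valid_by[where ps = "[
    (3, 0, wmult_bar_left_rule p i j), (0, 0, wmult_wunit_right_rule p i j)]"])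
    (use assms in \<open>simp add: wreath_unit_right_rule_def wmult_wunit_right_rule_def wmult_bar_left_rule_def
        derivation_simps\<close>,
     use assms in \<open>simp add: base_valid valid_wmult_wunit_right valid_wmult_bar_left\<close>)

lemma valid_wreath_unit_left:
  assumes "i < j" "j \<le> r" "p \<longrightarrow> h"
  shows "valid (wreath_unit_left_rule p i j)"
  by (rule valid_by[where ps = "[
    (3, 0, wmult_wunit_left_rule p i j), (0, 0, bar_idem_rule p i j), (0, 0, flip (wmult_wunit_left_rule p i j)),
    (0, 0, wmult_wunit_left_rule p i j)]"])
    (use assms in \<open>simp add: wreath_unit_left_rule_def bar_idem_rule_def wmult_wunit_left_rule_def
        derivation_simps\<close>,
     use assms in \<open>simp add: base_valid valid_bar_idem valid_wmult_wunit_left\<close>)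

section \<open>A merged pair and a monad of higher index\<close>

lemma valid_rawR_mult_left:
  assumes "i < j" "j < k" "k \<le> r" "p \<longrightarrow> h"
  shows "valid (rawR_mult_left_rule p i j k)"
  by (rule valid_by[where ps = "[
    (0, 0, mult_left p i k), (2, 1, mult_left p j k)]"])
    (use assms in \<open>simp add: rawR_mult_left_rule_def derivation_simps\<close>,
     use assms in \<open>simp add: base_valid\<close>)

text \<open>The merged multiplication contains a crossing of \<open>s\<^sub>j\<close> and
  \<open>s\<^sub>i\<close>, which has to be moved past \<open>s\<^sub>k\<close>; this is what the
  Yang-Baxter relation does.\<close>

lemma valid_rawR_mult_right:
  assumes "i < j" "j < k" "k \<le> r" "p \<longrightarrow> h"
  shows "valid (rawR_mult_right_rule p i j k)"
  by (rule valid_by[where ps = "[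
    (1, 1, triv (Mu p i)), (2, 0, triv (Lam p i k)), (3, 1, mult_right p j k), (1, 0, mult_right p i k),
    (0, 0, triv (Lam p i k)), (1, 1, flip (yang_baxter p i j k))]"])
    (use assms in \<open>simp add: rawR_mult_right_rule_def derivation_simps\<close>,
     use assms in \<open>simp add: base_valid\<close>)

text \<open>Yang-Baxter moves the crossing of the merged unit behind the two others, so that both of
  these meet a unit and the weak unit axioms apply. The two multiplications of
  \<open>s\<^sub>k\<close> that arise combine by associativity, after which the same moves are
  undone.\<close>

lemma valid_rawR_unit_right:
  assumes "i < j" "j < k" "k \<le> r" "p \<longrightarrow> h"
  shows "valid (rawR_unit_right_rule p i j k)"
  by (rule valid_by[where ps = "[
    (2, 0, flip (yang_baxter p i j k)), (0, 1, triv (Eta p j)), (1, 0, triv (Lam p j k)),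
    (2, 1, weak_unit_right p i k), (0, 0, weak_unit_right p j k), (3, 1, triv (Eta p i)),
    (4, 1, triv (Eta p k)), (5, 1, triv (Lam p i k)), (6, 2, flip (assoc p k)),
    (3, 1, flip (weak_unit_right p i k)), (2, 2, triv (Eta p i)), (3, 0, yang_baxter p i j k)]"])
    (use assms in \<open>simp add: rawR_unit_right_rule_def derivation_simps\<close>,
     use assms in \<open>simp add: base_valid\<close>)

lemma valid_rawR_unit_left:
  assumes "i < j" "j < k" "k \<le> r" "p \<longrightarrow> h"
  shows "valid (rawR_unit_left_rule p i j k)"
  by (rule valid_by[where ps = "[
    (3, 0, weak_unit_left p i k), (2, 2, triv (Eta p k)), (3, 0, bar_left_rule p i k),
    (2, 1, flip (weak_unit_left p i k)), (1, 1, triv (Eta p k)), (2, 1, flip (yang_baxter p i j k)),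
    (0, 1, weak_unit_left p j k), (3, 4, triv (Eta p i)), (4, 3, triv (Lam p i k)),
    (5, 1, mult_left p i j), (2, 4, triv (Eta p i)), (3, 2, yang_baxter p i j k)]"])
    (use assms in \<open>simp add: rawR_unit_left_rule_def bar_left_rule_def derivation_simps\<close>,
     use assms in \<open>simp add: base_valid valid_bar_left\<close>)

lemma valid_lamR_bar:
  assumes "i < j" "j < k" "k \<le> r" "p \<longrightarrow> h"
  shows "valid (lamR_bar_rule p i j k)"
  by (rule valid_by[where ps = "[
    (0, 1, bar_idem_rule p i j)]"])
    (use assms in \<open>simp add: lamR_bar_rule_def bar_idem_rule_def derivation_simps\<close>,
     use assms in \<open>simp add: base_valid valid_bar_idem\<close>)

text \<open>By a weak unit axiom \<open>bar p i j\<close> is the merged multiplication with both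
  units inserted in the middle. Carried through \<open>rawR\<close>, the result ends in a merged
  multiplication, and this absorbs the idempotent.\<close>

lemma valid_bar_lamR:
  assumes "i < j" "j < k" "k \<le> r" "p \<longrightarrow> h"
  shows "valid (bar_lamR_rule p i j k)"
  by (rule valid_by[where ps = "[
    (0, 1, flip (wmult_wunit_right_rule p i j)), (0, 1, wmult_wunit_right_rule p i j), (0, 2, weak_unit_right p i j),
    (2, 0, rawR_mult_right_rule p i j k), (6, 0, wmult_bar_rule p i j),
    (2, 0, flip (rawR_mult_right_rule p i j k)), (0, 2, flip (weak_unit_right p i j))]"])
    (use assms in \<open>simp add: bar_lamR_rule_def rawR_mult_right_rule_def wmult_wunit_right_rule_def
        wmult_bar_rule_def derivation_simps\<close>,
     use assms in \<open>simp add: base_valid valid_rawR_mult_right valid_wmult_wunit_right valid_wmult_bar\<close>)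

text \<open>This and the next three rules transfer the identities from \<open>rawR\<close> to the
  law \<open>lamR\<close>; the idempotents required by the closure are inserted by absorption rules
  read backwards.\<close>

lemma valid_lamR_mult_left:
  assumes "i < j" "j < k" "k \<le> r" "p \<longrightarrow> h"
  shows "valid (lamR_mult_left_rule p i j k)"
  by (rule valid_by[where ps = "[
    (0, 2, bar_idem_rule p i j), (3, 0, rawR_mult_left_rule p i j k), (0, 1, flip (bar_lamR_rule p i j k)),
    (5, 0, flip (bar_lamR_rule p i j k))]"])
    (use assms in \<open>simp add: lamR_mult_left_rule_def bar_idem_rule_def bar_lamR_rule_def
        rawR_mult_left_rule_def derivation_simps\<close>,
     use assms in \<open>simp add: base_valid valid_bar_idem valid_bar_lamR valid_rawR_mult_left\<close>)

lemma valid_lamR_mult_right: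
  assumes "i < j" "j < k" "k \<le> r" "p \<longrightarrow> h"
  shows "valid (lamR_mult_right_rule p i j k)"
  by (rule valid_by[where ps = "[
    (0, 1, wmult_bar_rule p i j), (0, 1, flip (wmult_bar_left_rule p i j)), (3, 1, flip (wmult_bar_right_rule p i j)),
    (6, 0, rawR_mult_right_rule p i j k), (0, 0, flip (bar_lamR_rule p i j k)),
    (0, 3, flip (bar_idem_rule p i j))]"])
    (use assms in \<open>simp add: lamR_mult_right_rule_def bar_idem_rule_def bar_lamR_rule_def
        rawR_mult_right_rule_def wmult_bar_rule_def wmult_bar_left_rule_def wmult_bar_right_rule_def
        derivation_simps\<close>,
     use assms in \<open>simp add: base_valid valid_bar_idem valid_bar_lamR valid_rawR_mult_right valid_wmult_bar
         valid_wmult_bar_left valid_wmult_bar_right\<close>)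

lemma valid_lamR_unit_left:
  assumes "i < j" "j < k" "k \<le> r" "p \<longrightarrow> h"
  shows "valid (lamR_unit_left_rule p i j k)"
  by (rule valid_by[where ps = "[
    (0, 0, bar_idem_rule p i j), (0, 0, rawR_unit_left_rule p i j k), (0, 2, flip (wunit_bar_rule p i j)),
    (9, 0, flip (wmult_bar_left_rule p i j)), (0, 0, flip (bar_idem_rule p i j)),
    (0, 0, flip (bar_idem_rule p i j))]"])
    (use assms in \<open>simp add: lamR_unit_left_rule_def wunit_bar_rule_def bar_idem_rule_def
        rawR_unit_left_rule_def wmult_bar_left_rule_def derivation_simps\<close>,
     use assms in \<open>simp add: base_valid valid_wunit_bar valid_bar_idem valid_rawR_unit_left
         valid_wmult_bar_left\<close>)

lemma valid_lamR_unit_right: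
  assumes "i < j" "j < k" "k \<le> r" "p \<longrightarrow> h"
  shows "valid (lamR_unit_right_rule p i j k)"
  by (rule valid_by[where ps = "[
    (0, 1, wunit_bar_rule p i j), (0, 0, rawR_unit_right_rule p i j k), (0, 0, flip (wunit_bar_rule p i j)),
    (3, 0, triv (Eta p k)), (4, 0, flip (bar_lamR_rule p i j k)), (0, 0, flip (wunit_bar_rule p i j))]"])
    (use assms in \<open>simp add: lamR_unit_right_rule_def wunit_bar_rule_def bar_lamR_rule_def
        rawR_unit_right_rule_def derivation_simps\<close>,
     use assms in \<open>simp add: base_valid valid_wunit_bar valid_bar_lamR valid_rawR_unit_right\<close>)

section \<open>A merged pair and a monad of lower index\<close>

lemma valid_rawL_mult_left:
  assumes "i < j" "j < k" "k \<le> r" "p \<longrightarrow> h"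
  shows "valid (rawL_mult_left_rule p i j k)"
  by (rule valid_by[where ps = "[
    (2, 2, triv (Lam p i k)), (3, 0, mult_left p i j), (1, 2, mult_left p i k), (0, 3, triv (Lam p i k)),
    (1, 1, yang_baxter p i j k)]"])
    (use assms in \<open>simp add: rawL_mult_left_rule_def derivation_simps\<close>,
     use assms in \<open>simp add: base_valid\<close>)

lemma valid_rawL_mult_right:
  assumes "i < j" "j < k" "k \<le> r" "p \<longrightarrow> h"
  shows "valid (rawL_mult_right_rule p i j k)"
  by (rule valid_by[where ps = "[
    (0, 1, mult_right p i k), (2, 0, mult_right p i j)]"])
    (use assms in \<open>simp add: rawL_mult_right_rule_def derivation_simps\<close>,
     use assms in \<open>simp add: base_valid\<close>)

lemma valid_rawL_unit_left:
  assumes "i < j" "j < k" "k \<le> r" "p \<longrightarrow> h"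
  shows "valid (rawL_unit_left_rule p i j k)"
  by (rule valid_by[where ps = "[
    (2, 0, yang_baxter p i j k), (1, 0, triv (Lam p i j)), (2, 0, weak_unit_left p i k),
    (0, 0, weak_unit_left p i j), (3, 2, triv (Eta p k)), (4, 0, bar_left_rule p i k),
    (3, 1, flip (weak_unit_left p i k)), (2, 1, triv (Eta p k)), (3, 1, flip (yang_baxter p i j k))]"])
    (use assms in \<open>simp add: rawL_unit_left_rule_def bar_left_rule_def derivation_simps\<close>,
     use assms in \<open>simp add: base_valid valid_bar_left\<close>)

lemma valid_rawL_unit_right:
  assumes "i < j" "j < k" "k \<le> r" "p \<longrightarrow> h"
  shows "valid (rawL_unit_right_rule p i j k)"
  by (rule valid_by[where ps = "[
    (0, 0, bar_alt_rule p j k), (3, 1, weak_unit_right p i k), (2, 1, triv (Eta p i)),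
    (3, 1, triv (Eta p k)), (4, 1, triv (Lam p i k)), (5, 2, flip (assoc p k)),
    (2, 1, flip (weak_unit_right p i k)), (1, 2, triv (Eta p i)), (2, 0, yang_baxter p i j k),
    (0, 0, weak_unit_right p i j), (3, 0, triv (Eta p k)), (4, 0, triv (Lam p i k)),
    (5, 1, mult_right p j k), (2, 0, triv (Eta p k)), (3, 0, flip (yang_baxter p i j k))]"])
    (use assms in \<open>simp add: rawL_unit_right_rule_def bar_alt_rule_def derivation_simps\<close>,
     use assms in \<open>simp add: base_valid valid_bar_alt\<close>)

lemma valid_lamL_bar:
  assumes "i < j" "j < k" "k \<le> r" "p \<longrightarrow> h"
  shows "valid (lamL_bar_rule p i j k)"
  by (rule valid_by[where ps = "[
    (0, 0, bar_idem_rule p j k)]"])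
    (use assms in \<open>simp add: lamL_bar_rule_def bar_idem_rule_def derivation_simps\<close>,
     use assms in \<open>simp add: base_valid valid_bar_idem\<close>)

lemma valid_bar_lamL:
  assumes "i < j" "j < k" "k \<le> r" "p \<longrightarrow> h"
  shows "valid (bar_lamL_rule p i j k)"
  by (rule valid_by[where ps = "[
    (0, 0, flip (wmult_wunit_left_rule p j k)), (0, 0, wmult_wunit_left_rule p j k), (0, 1, weak_unit_right p j k),
    (2, 0, rawL_mult_left_rule p i j k), (6, 1, wmult_bar_rule p j k),
    (2, 0, flip (rawL_mult_left_rule p i j k)), (0, 1, flip (weak_unit_right p j k))]"])
    (use assms in \<open>simp add: bar_lamL_rule_def rawL_mult_left_rule_def wmult_wunit_left_rule_def
        wmult_bar_rule_def derivation_simps\<close>,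
     use assms in \<open>simp add: base_valid valid_rawL_mult_left valid_wmult_wunit_left valid_wmult_bar\<close>)

lemma valid_lamL_mult_left:
  assumes "i < j" "j < k" "k \<le> r" "p \<longrightarrow> h"
  shows "valid (lamL_mult_left_rule p i j k)"
  by (rule valid_by[where ps = "[
    (0, 0, wmult_bar_rule p j k), (0, 0, flip (wmult_bar_left_rule p j k)), (3, 0, flip (wmult_bar_right_rule p j k)),
    (6, 0, rawL_mult_left_rule p i j k), (0, 2, flip (bar_lamL_rule p i j k)), (0, 0, flip (bar_idem_rule p j k))]"])
    (use assms in \<open>simp add: lamL_mult_left_rule_def bar_idem_rule_def bar_lamL_rule_def
        rawL_mult_left_rule_def wmult_bar_rule_def wmult_bar_left_rule_def wmult_bar_right_rule_def derivation_simps\<close>,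
     use assms in \<open>simp add: base_valid valid_bar_idem valid_bar_lamL valid_rawL_mult_left valid_wmult_bar
         valid_wmult_bar_left valid_wmult_bar_right\<close>)

lemma valid_lamL_mult_right:
  assumes "i < j" "j < k" "k \<le> r" "p \<longrightarrow> h"
  shows "valid (lamL_mult_right_rule p i j k)"
  by (rule valid_by[where ps = "[
    (0, 0, bar_idem_rule p j k), (3, 0, rawL_mult_right_rule p i j k), (0, 0, flip (bar_lamL_rule p i j k)),
    (5, 1, flip (bar_lamL_rule p i j k))]"])
    (use assms in \<open>simp add: lamL_mult_right_rule_def bar_idem_rule_def bar_lamL_rule_def
        rawL_mult_right_rule_def derivation_simps\<close>,
     use assms in \<open>simp add: base_valid valid_bar_idem valid_bar_lamL valid_rawL_mult_right\<close>)

lemma valid_lamL_unit_left: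
  assumes "i < j" "j < k" "k \<le> r" "p \<longrightarrow> h"
  shows "valid (lamL_unit_left_rule p i j k)"
  by (rule valid_by[where ps = "[
    (0, 0, wunit_bar_rule p j k), (0, 0, rawL_unit_left_rule p i j k), (0, 1, flip (wunit_bar_rule p j k)),
    (3, 3, triv (Eta p i)), (4, 1, flip (bar_lamL_rule p i j k)), (0, 1, flip (wunit_bar_rule p j k))]"])
    (use assms in \<open>simp add: lamL_unit_left_rule_def wunit_bar_rule_def bar_lamL_rule_def
        rawL_unit_left_rule_def derivation_simps\<close>,
     use assms in \<open>simp add: base_valid valid_wunit_bar valid_bar_lamL valid_rawL_unit_left\<close>)

lemma valid_lamL_unit_right:
  assumes "i < j" "j < k" "k \<le> r" "p \<longrightarrow> h"
  shows "valid (lamL_unit_right_rule p i j k)"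
  by (rule valid_by[where ps = "[
    (0, 0, bar_idem_rule p j k), (0, 0, rawL_unit_right_rule p i j k), (0, 0, flip (wunit_bar_rule p j k)),
    (9, 1, flip (wmult_bar_right_rule p j k)), (0, 0, flip (bar_idem_rule p j k)),
    (0, 0, flip (bar_idem_rule p j k))]"])
    (use assms in \<open>simp add: lamL_unit_right_rule_def wunit_bar_rule_def bar_idem_rule_def
        rawL_unit_right_rule_def wmult_bar_right_rule_def derivation_simps\<close>,
     use assms in \<open>simp add: base_valid valid_wunit_bar valid_bar_idem valid_rawL_unit_right
         valid_wmult_bar_right\<close>)

section \<open>The two idempotents on three monads\<close>

lemma valid_barR_mid:
  assumes "i < j" "j < k" "k \<le> r" "p \<longrightarrow> h"
  shows "valid (barR_mid_rule p i j k)"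
  by (rule valid_by[where ps = "[
    (0, 0, bar_idem_rule p i j), (0, 3, triv (Eta p i)), (1, 3, triv (Eta p j)), (2, 3, triv (Lam p i j)),
    (3, 5, triv (Eta p i)), (4, 4, triv (Lam p i j)), (5, 3, triv (Mu p i)), (6, 2, triv (Lam p i k)),
    (7, 3, triv (Lam p j k)), (8, 0, wmult_bar_left_rule p i j)]"])
    (use assms in \<open>simp add: barR_mid_rule_def bar_idem_rule_def wmult_bar_left_rule_def derivation_simps\<close>,
     use assms in \<open>simp add: base_valid valid_bar_idem valid_wmult_bar_left\<close>)

lemma valid_barL_mid:
  assumes "i < j" "j < k" "k \<le> r" "p \<longrightarrow> h"
  shows "valid (barL_mid_rule p i j k)"
  by (rule valid_by[where ps = "[
    (4, 1, bar_lamL_rule p i j k), (0, 1, bar_idem_rule p j k)]"])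
    (use assms in \<open>simp add: barL_mid_rule_def bar_idem_rule_def bar_lamL_rule_def derivation_simps\<close>,
     use assms in \<open>simp add: base_valid valid_bar_idem valid_bar_lamL\<close>)

text \<open>The analogue of \<open>valid_bar_alt\<close> for the merged law: the weak unit rules for
  the pair replace the weak unit axioms, and associativity of \<open>wmult\<close> collects the
  multiplications.\<close>

lemma valid_barR_short:
  assumes "i < j" "j < k" "k \<le> r" "p \<longrightarrow> h"
  shows "valid (barR_short_rule p i j k)"
  by (rule valid_by[where ps = "[
    (0, 0, barR_mid_rule p i j k), (0, 2, lamR_unit_right_rule p i j k), (7, 2, bar_lamR_rule p i j k),
    (0, 2, wunit_bar_rule p i j), (0, 2, flip (wunit_bar_rule p i j)), (6, 2, rawR_unit_left_rule p i j k),
    (0, 2, wunit_bar_rule p i j), (0, 2, flip (wunit_bar_rule p i j)), (12, 0, flip (wmult_assoc_rule p i j)),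
    (0, 0, wmult_wunit_right_rule p i j), (0, 2, wunit_bar_rule p i j), (0, 2, triv (Eta p i)),
    (1, 1, triv (Lam p i j)), (2, 0, triv (Mu p i)), (3, 0, flip (rawR_unit_left_rule p i j k)),
    (0, 0, bar_idem_rule p i j)]"])
    (use assms in \<open>simp add: barR_short_rule_def wunit_bar_rule_def bar_idem_rule_def bar_lamR_rule_def
        rawR_unit_left_rule_def lamR_unit_right_rule_def wmult_assoc_rule_def wmult_wunit_right_rule_def
        barR_mid_rule_def derivation_simps\<close>,
     use assms in \<open>simp add: base_valid valid_wunit_bar valid_bar_idem valid_bar_lamR valid_rawR_unit_left
         valid_lamR_unit_right valid_wmult_assoc valid_wmult_wunit_right valid_barR_mid\<close>)

lemma valid_barL_short:
  assumes "i < j" "j < k" "k \<le> r" "p \<longrightarrow> h"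
  shows "valid (barL_short_rule p i j k)"
  by (rule valid_by[where ps = "[
    (0, 1, rawL_unit_right_rule p i j k), (0, 0, flip (rawL_unit_left_rule p i j k)),
    (0, 0, flip (wunit_bar_rule p j k))]"])
    (use assms in \<open>simp add: barL_short_rule_def wunit_bar_rule_def rawL_unit_left_rule_def
        rawL_unit_right_rule_def derivation_simps\<close>,
     use assms in \<open>simp add: base_valid valid_wunit_bar valid_rawL_unit_left valid_rawL_unit_right\<close>)

text \<open>By the weak unit axiom the crossing of \<open>eta p k\<close> with
  \<open>s\<^sub>i\<close> is \<open>bar p i k\<close> after that unit, hence left linear over
  \<open>s\<^sub>i\<close>. So \<open>mu p i\<close> from the inner idempotent moves to the very
  end.\<close>

lemma valid_barR_short_Z:
  assumes "i < j" "j < k" "k \<le> r" "p \<longrightarrow> h"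
  shows "valid (barR_short_Z_rule p i j k)"
  by (rule valid_by[where ps = "[
    (0, 2, triv (Eta p i)), (1, 1, triv (Lam p i j)), (2, 0, triv (Mu p i)), (3, 0, weak_unit_left p i k),
    (2, 2, triv (Eta p k)), (3, 0, bar_left_rule p i k), (2, 1, flip (weak_unit_left p i k))]"])
    (use assms in \<open>simp add: barR_short_Z_rule_def bar_left_rule_def derivation_simps\<close>,
     use assms in \<open>simp add: base_valid valid_bar_left\<close>)

lemma valid_Z_eq:
  assumes "i < j" "j < k" "k \<le> r" "p \<longrightarrow> h"
  shows "valid (Z_eq_rule p i j k)"
  by (rule valid_by[where ps = "[
    (1, 1, triv (Eta p k)), (2, 1, flip (yang_baxter p i j k))]"])
    (use assms in \<open>simp add: Z_eq_rule_def derivation_simps\<close>,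
     use assms in \<open>simp add: base_valid\<close>)

lemma valid_barL_short_Z:
  assumes "i < j" "j < k" "k \<le> r" "p \<longrightarrow> h"
  shows "valid (barL_short_Z_rule p i j k)"
  by (rule valid_by[where ps = "[
    (0, 1, bar_alt_rule p j k), (3, 2, weak_unit_right p i k), (2, 2, triv (Eta p i)),
    (3, 2, triv (Eta p k)), (4, 2, triv (Lam p i k)), (5, 3, flip (assoc p k)),
    (2, 2, flip (weak_unit_right p i k))]"])
    (use assms in \<open>simp add: barL_short_Z_rule_def bar_alt_rule_def derivation_simps\<close>,
     use assms in \<open>simp add: base_valid valid_bar_alt\<close>)

text \<open>The rules \<open>barR_short_Z\<close> and \<open>barL_short_Z\<close> express an idempotent by its
    restriction along the units of
  \<open>s\<^sub>i\<close> and \<open>s\<^sub>k\<close>, and \<open>Z_eq\<close> compares the restrictions by the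
      Yang--Baxter relation.\<close>

lemma valid_barR_barL:
  assumes "i < j" "j < k" "k \<le> r" "p \<longrightarrow> h"
  shows "valid (barR_barL_rule p i j k)"
  by (rule valid_by[where ps = "[
    (0, 0, barR_short_rule p i j k), (0, 0, barR_short_Z_rule p i j k), (0, 0, Z_eq_rule p i j k),
    (0, 0, flip (barL_short_Z_rule p i j k)), (0, 0, flip (barL_mid_rule p i j k))]"])
    (use assms in \<open>simp add: barR_barL_rule_def Z_eq_rule_def barR_short_rule_def barR_short_Z_rule_def
        barL_mid_rule_def barL_short_Z_rule_def derivation_simps\<close>,
     use assms in \<open>simp add: base_valid valid_Z_eq valid_barR_short valid_barR_short_Z valid_barL_mid
         valid_barL_short_Z\<close>)

lemma valid_bar_barR:
  assumes "i < j" "j < k" "k \<le> r" "p \<longrightarrow> h"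
  shows "valid (bar_barR_rule p i j k)"
  by (rule valid_by[where ps = "[
    (0, 0, barR_short_rule p i j k), (1, 0, bar_lamR_rule p i j k), (0, 0, flip (barR_short_rule p i j k))]"])
    (use assms in \<open>simp add: bar_barR_rule_def bar_lamR_rule_def barR_short_rule_def derivation_simps\<close>,
     use assms in \<open>simp add: base_valid valid_bar_lamR valid_barR_short\<close>)

lemma valid_bar_barL:
  assumes "i < j" "j < k" "k \<le> r" "p \<longrightarrow> h"
  shows "valid (bar_barL_rule p i j k)"
  by (rule valid_by[where ps = "[
    (0, 0, barL_mid_rule p i j k), (1, 1, bar_lamL_rule p i j k), (0, 0, flip (barL_mid_rule p i j k))]"])
    (use assms in \<open>simp add: bar_barL_rule_def bar_lamL_rule_def barL_mid_rule_def derivation_simps\<close>,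
     use assms in \<open>simp add: base_valid valid_bar_lamL valid_barL_mid\<close>)

text \<open>The argument by which a law absorbs its own idempotent, except that the merged unit
  leaves \<open>bar p i j\<close> behind instead of an identity. This is precisely the normalization
  that turns \<open>rawR\<close> into \<open>lamR\<close>.\<close>

lemma valid_barR_rawR:
  assumes "i < j" "j < k" "k \<le> r" "p \<longrightarrow> h"
  shows "valid (barR_rawR_rule p i j k)"
  by (rule valid_by[where ps = "[
    (2, 0, barR_mid_rule p i j k), (0, 3, wunit_bar_rule p i j), (3, 0, flip (rawR_mult_right_rule p i j k)),
    (0, 1, wmult_wunit_right_rule p i j)]"])
    (use assms in \<open>simp add: barR_rawR_rule_def wunit_bar_rule_def rawR_mult_right_rule_def
        wmult_wunit_right_rule_def barR_mid_rule_def derivation_simps\<close>,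
     use assms in \<open>simp add: base_valid valid_wunit_bar valid_rawR_mult_right valid_wmult_wunit_right
         valid_barR_mid\<close>)

lemma valid_barL_rawL:
  assumes "i < j" "j < k" "k \<le> r" "p \<longrightarrow> h"
  shows "valid (barL_rawL_rule p i j k)"
  by (rule valid_by[where ps = "[
    (2, 0, barL_mid_rule p i j k), (2, 0, barL_short_rule p i j k), (0, 0, wunit_bar_rule p j k),
    (3, 0, flip (rawL_mult_left_rule p i j k)), (0, 0, wmult_wunit_left_rule p j k)]"])
    (use assms in \<open>simp add: barL_rawL_rule_def wunit_bar_rule_def rawL_mult_left_rule_def
        wmult_wunit_left_rule_def barL_mid_rule_def barL_short_rule_def derivation_simps\<close>,
     use assms in \<open>simp add: base_valid valid_wunit_bar valid_rawL_mult_left valid_wmult_wunit_left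
         valid_barL_mid valid_barL_short\<close>)

lemma valid_barR_E:
  assumes "i < j" "j < k" "k \<le> r" "p \<longrightarrow> h"
  shows "valid (barR_E_rule p i j k)"
  by (rule valid_by[where ps = "[
    (4, 0, barR_short_rule p i j k), (3, 0, triv (Eta p k)), (4, 3, triv (Eta p i)),
    (5, 2, triv (Lam p i j)), (6, 1, triv (Mu p i)), (7, 0, triv (Lam p i k)), (8, 1, triv (Lam p j k)),
    (9, 2, flip (assoc p k)), (3, 0, flip (barR_short_rule p i j k)), (1, 0, barR_rawR_rule p i j k),
    (0, 0, flip (barR_short_rule p i j k))]"])
    (use assms in \<open>simp add: barR_E_rule_def barR_rawR_rule_def barR_short_rule_def derivation_simps\<close>,
     use assms in \<open>simp add: base_valid valid_barR_rawR valid_barR_short\<close>)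

lemma valid_barL_F:
  assumes "i < j" "j < k" "k \<le> r" "p \<longrightarrow> h"
  shows "valid (barL_F_rule p i j k)"
  by (rule valid_by[where ps = "[
    (4, 0, barL_mid_rule p i j k), (3, 4, triv (Eta p i)), (4, 4, triv (Eta p j)), (5, 3, triv (Lam p j k)),
    (6, 2, triv (Mu p j)), (7, 3, triv (Lam p i k)), (8, 2, triv (Lam p i j)), (9, 0, assoc p i),
    (3, 1, flip (barL_mid_rule p i j k)), (1, 1, barL_rawL_rule p i j k), (0, 0, flip (barL_mid_rule p i j k))]"])
    (use assms in \<open>simp add: barL_F_rule_def barL_rawL_rule_def barL_mid_rule_def derivation_simps\<close>,
     use assms in \<open>simp add: base_valid valid_barL_rawL valid_barL_mid\<close>)

text \<open>Its \<open>mu p k\<close> goes back through \<open>lm p j k\<close> by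
  \<open>mult_left\<close>; what is left in front of that crossing is the second formula for
  \<open>bar p i k\<close>.\<close>

lemma valid_E_lam:
  assumes "i < j" "j < k" "k \<le> r" "p \<longrightarrow> h"
  shows "valid (E_lam_rule p i j k)"
  by (rule valid_by[where ps = "[
    (0, 0, triv (Eta p k)), (1, 0, triv (Lam p i k)), (2, 1, flip (mult_left p j k)),
    (0, 0, flip (bar_alt_rule p i k))]"])
    (use assms in \<open>simp add: E_lam_rule_def bar_alt_rule_def derivation_simps\<close>,
     use assms in \<open>simp add: base_valid valid_bar_alt\<close>)

lemma valid_F_lam:
  assumes "i < j" "j < k" "k \<le> r" "p \<longrightarrow> h"
  shows "valid (F_lam_rule p i j k)"
  by (rule valid_by[where ps = "[
    (0, 3, triv (Eta p i)), (1, 2, triv (Lam p i k)), (2, 0, flip (mult_right p i j))]"])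
    (use assms in \<open>simp add: F_lam_rule_def derivation_simps\<close>,
     use assms in \<open>simp add: base_valid\<close>)

lemma valid_barR_lam:
  assumes "i < j" "j < k" "k \<le> r" "p \<longrightarrow> h"
  shows "valid (barR_lam_rule p i j k)"
  by (rule valid_by[where ps = "[
    (0, 0, flip (E_lam_rule p i j k)), (1, 0, barR_E_rule p i j k)]"])
    (use assms in \<open>simp add: barR_lam_rule_def E_lam_rule_def barR_E_rule_def derivation_simps\<close>,
     use assms in \<open>simp add: base_valid valid_E_lam valid_barR_E\<close>)

lemma valid_barL_lam:
  assumes "i < j" "j < k" "k \<le> r" "p \<longrightarrow> h"
  shows "valid (barL_lam_rule p i j k)"
  by (rule valid_by[where ps = "[
    (0, 0, flip (F_lam_rule p i j k)), (1, 0, barL_F_rule p i j k)]"])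
    (use assms in \<open>simp add: barL_lam_rule_def F_lam_rule_def barL_F_rule_def derivation_simps\<close>,
     use assms in \<open>simp add: base_valid valid_F_lam valid_barL_F\<close>)

section \<open>Merged structure on three and four monads\<close>

lemma valid_triple_mult:
  assumes "i < j" "j < k" "k \<le> r" "p \<longrightarrow> h"
  shows "valid (triple_mult_rule p i j k)"
  \<comment> \<open>The second formula is chosen for the idempotent inside \<open>lamR\<close>
    because it puts \<open>eta p j\<close> between \<open>s\<^sub>k\<close> and
    \<open>s\<^sub>i\<close>, where it also serves as the unit in \<open>bar p j k\<close> on the
    other side.\<close>
  by (rule valid_by[where ps = "[
    (0, 3, bar_alt_rule p i j), (5, 0, wmult_bar_left_rule p i j), (2, 2, triv (Lam p i k)),
    (3, 3, mult_right p j k), (1, 2, flip (yang_baxter p i j k)), (5, 1, triv (Lam p i j)),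
    (6, 2, flip (assoc p j)), (3, 1, flip (mult_left p i j)), (5, 2, flip (wmult_bar_right_rule p j k))]"])
    (use assms in \<open>simp add: triple_mult_rule_def bar_alt_rule_def wmult_bar_left_rule_def
        wmult_bar_right_rule_def derivation_simps\<close>,
     use assms in \<open>simp add: base_valid valid_bar_alt valid_wmult_bar_left valid_wmult_bar_right\<close>)

lemma valid_triple_unit:
  assumes "i < j" "j < k" "k \<le> r" "p \<longrightarrow> h"
  shows "valid (triple_unit_rule p i j k)"
  by (rule valid_by[where ps = "[
    (0, 0, wunit_bar_rule p i j), (2, 0, triv (Eta p k)), (3, 0, flip (yang_baxter p i j k)),
    (0, 0, flip (wunit_bar_rule p j k))]"])
    (use assms in \<open>simp add: triple_unit_rule_def wunit_bar_rule_def derivation_simps\<close>,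
     use assms in \<open>simp add: base_valid valid_wunit_bar\<close>)

text \<open>With the idempotents absorbed, one Yang-Baxter move is made for each monad of the merged
  pair. The same holds for the pair in the middle and the pair at the end, treated next.\<close>

lemma valid_yang_baxter_RR:
  assumes "i < j" "j < k" "k < l" "l \<le> r" "p \<longrightarrow> h"
  shows "valid (yang_baxter_RR_rule p i j k l)"
  by (rule valid_by[where ps = "[
    (0, 2, bar_idem_rule p i j), (0, 0, triv (Lam p k l)), (1, 1, bar_lamR_rule p i j l),
    (0, 4, triv (Eta p i)), (1, 3, triv (Lam p i j)), (2, 2, triv (Mu p i)), (3, 0, yang_baxter p i k l),
    (5, 1, yang_baxter p j k l), (0, 1, flip (bar_lamR_rule p i j k)), (5, 0, flip (bar_lamR_rule p i j l))]"])
    (use assms in \<open>simp add: yang_baxter_RR_rule_def bar_idem_rule_def bar_lamR_rule_def derivation_simps\<close>,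
     use assms in \<open>simp add: base_valid valid_bar_idem valid_bar_lamR\<close>)

lemma valid_yang_baxter_lawR:
  assumes "i < j" "j < k" "k < l" "l \<le> r" "p \<longrightarrow> h"
  shows "valid (yang_baxter_lawR_rule p i j k l)"
  by (rule valid_by[where ps = "[
    (0, 0, bar_lamR_rule p j k l), (0, 0, bar_lamR_rule p j k l), (4, 1, yang_baxter p i k l),
    (3, 2, triv (Lam p i k)), (4, 0, yang_baxter p i j l), (0, 1, flip (bar_lamL_rule p i j k)),
    (0, 1, flip (bar_lamL_rule p i j k))]"])
    (use assms in \<open>simp add: yang_baxter_lawR_rule_def bar_lamL_rule_def bar_lamR_rule_def derivation_simps\<close>,
     use assms in \<open>simp add: base_valid valid_bar_lamL valid_bar_lamR\<close>)

lemma valid_yang_baxter_lawL: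
  assumes "i < j" "j < k" "k < l" "l \<le> r" "p \<longrightarrow> h"
  shows "valid (yang_baxter_lawL_rule p i j k l)"
  by (rule valid_by[where ps = "[
    (5, 1, bar_lamL_rule p i k l), (0, 0, bar_lamL_rule p j k l), (4, 2, triv (Lam p i l)),
    (5, 0, yang_baxter p i j k), (2, 2, yang_baxter p i j l), (0, 2, triv (Lam p i j)),
    (1, 0, flip (bar_lamL_rule p i k l)), (0, 0, flip (bar_idem_rule p k l))]"])
    (use assms in \<open>simp add: yang_baxter_lawL_rule_def bar_idem_rule_def bar_lamL_rule_def derivation_simps\<close>,
     use assms in \<open>simp add: base_valid valid_bar_idem valid_bar_lamL\<close>)

text \<open>Both sides move \<open>s\<^sub>l\<close> across three monads after an idempotent on the
  triple. The idempotents of the inner pairs are absorbed there, and \<open>barR\<close> and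
  \<open>barL\<close> agree.\<close>

lemma valid_triple_law:
  assumes "i < j" "j < k" "k < l" "l \<le> r" "p \<longrightarrow> h"
  shows "valid (triple_law_rule p i j k l)"
  by (rule valid_by[where ps = "[
    (17, 0, bar_lamR_rule p i j l), (0, 1, bar_barR_rule p i j k), (0, 1, barR_barL_rule p i j k),
    (0, 1, flip (bar_barL_rule p i j k)), (0, 1, flip (bar_barL_rule p i j k))]"])
    (use assms in \<open>simp add: triple_law_rule_def bar_lamR_rule_def bar_barR_rule_def bar_barL_rule_def
        barR_barL_rule_def derivation_simps\<close>,
     use assms in \<open>simp add: base_valid valid_bar_lamR valid_bar_barR valid_bar_barL valid_barR_barL\<close>)

text \<open>Apart from idempotents both sides consist of the same four crossings; the crossings of
  \<open>s\<^sub>k\<close> with \<open>s\<^sub>i\<close> and of \<open>s\<^sub>l\<close> with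
  \<open>s\<^sub>j\<close> occur in different order, but side by side.\<close>

lemma valid_disjoint_law:
  assumes "i < j" "j < k" "k < l" "l \<le> r" "p \<longrightarrow> h"
  shows "valid (disjoint_law_rule p i j k l)"
  by (rule valid_by[where ps = "[
    (6, 0, bar_lamL_rule p i k l), (0, 0, bar_idem_rule p k l), (0, 2, flip (bar_idem_rule p i j)),
    (3, 2, triv (Eta p k)), (4, 1, triv (Lam p k l)), (5, 2, flip (bar_lamR_rule p i j l))]"])
    (use assms in \<open>simp add: disjoint_law_rule_def bar_idem_rule_def bar_lamL_rule_def bar_lamR_rule_def
        derivation_simps\<close>,
     use assms in \<open>simp add: base_valid valid_bar_idem valid_bar_lamL valid_bar_lamR\<close>)

section \<open>1-cells and merged monads\<close>

lemma valid_xiw_cod: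
  assumes "i < j" "j \<le> r" "h"
  shows "valid (xiw_cod_rule i j)"
  by (rule valid_by[where ps = "[
    (2, 1, bar_idem_rule False i j)]"])
    (use assms in \<open>simp add: xiw_cod_rule_def bar_idem_rule_def derivation_simps\<close>,
     use assms in \<open>simp add: base_valid valid_bar_idem\<close>)

text \<open>The conditions on a 1-cell turn the idempotent of the target law into that of the source
  law, and \<open>xiw\<close> already carries the latter.\<close>

lemma valid_xiw_dom:
  assumes "i < j" "j \<le> r" "h"
  shows "valid (xiw_dom_rule i j)"
  by (rule valid_by[where ps = "[
    (2, 2, triv (Xi j)), (3, 0, xi_mult i), (5, 1, bar_left_rule False i j), (1, 1, flip (xi_lam i j)),
    (0, 2, xi_unit i)]"])
    (use assms in \<open>simp add: xiw_dom_rule_def bar_left_rule_def derivation_simps\<close>,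
     use assms in \<open>simp add: base_valid valid_bar_left\<close>)

lemma valid_xiw_mult:
  assumes "i < j" "j \<le> r" "h"
  shows "valid (xiw_mult_rule i j)"
  by (rule valid_by[where ps = "[
    (2, 2, triv (Xi j)), (3, 0, xi_mult i), (1, 2, xi_mult j), (6, 1, bar_left_rule False i j),
    (3, 1, triv (Xi i)), (4, 2, bar_right_rule False i j), (0, 3, triv (Xi j)), (1, 1, flip (xi_lam i j)),
    (3, 0, triv (Xi i)), (4, 1, flip (wmult_bar_left_rule False i j)),
    (7, 1, flip (wmult_bar_right_rule False i j)), (0, 2, flip (xiw_cod_rule i j)),
    (2, 0, flip (xiw_dom_rule i j))]"])
    (use assms in \<open>simp add: xiw_mult_rule_def bar_left_rule_def bar_right_rule_def wmult_bar_left_rule_def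
        wmult_bar_right_rule_def xiw_cod_rule_def xiw_dom_rule_def derivation_simps\<close>,
     use assms in \<open>simp add: base_valid valid_bar_left valid_bar_right valid_wmult_bar_left
         valid_wmult_bar_right valid_xiw_cod valid_xiw_dom\<close>)

lemma valid_xiw_unit:
  assumes "i < j" "j \<le> r" "h"
  shows "valid (xiw_unit_rule i j)"
  by (rule valid_by[where ps = "[
    (2, 0, flip (xi_lam i j)), (0, 0, xi_unit i), (0, 0, xi_unit j)]"])
    (use assms in \<open>simp add: xiw_unit_rule_def derivation_simps\<close>,
     use assms in \<open>simp add: base_valid\<close>)

text \<open>Moving the components past the two crossings creates \<open>bar False i k\<close> and
  \<open>bar False j k\<close>. The former disappears by \<open>barR_lam_rule\<close>; for the
  latter \<open>barR\<close> is exchanged for \<open>barL\<close>, which starts with that very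
  idempotent.\<close>

lemma valid_xi_lamR:
  assumes "i < j" "j < k" "k \<le> r" "h"
  shows "valid (xi_lamR_rule i j k)"
  by (rule valid_by[where ps = "[
    (0, 1, xiw_cod_rule i j), (0, 1, flip (xiw_dom_rule i j)), (3, 1, xiw_cod_rule i j),
    (5, 0, triv (Xi k)), (6, 1, flip (barR_rawR_rule False i j k)), (4, 0, xi_lam i k),
    (7, 1, barR_lam_rule False i j k), (8, 1, barR_barL_rule False i j k), (3, 0, triv (Lam True i k)),
    (4, 1, xi_lam j k), (5, 1, xiw_cod_rule j k), (7, 0, triv (Xi i)),
    (8, 1, flip (barR_barL_rule False i j k)), (6, 0, flip (xiw_cod_rule i j)), (6, 0, flip (xiw_dom_rule i j))]"])
    (use assms in \<open>simp add: xi_lamR_rule_def barR_lam_rule_def barR_rawR_rule_def barR_barL_rule_def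
        xiw_cod_rule_def xiw_dom_rule_def derivation_simps\<close>,
     use assms in \<open>simp add: base_valid valid_barR_lam valid_barR_rawR valid_barR_barL valid_xiw_cod
         valid_xiw_dom\<close>)

text \<open>Dual to \<open>valid_xi_lamR\<close>: \<open>bar False i k\<close> disappears by
  \<open>barL_lam_rule\<close>, and \<open>bar False i j\<close> because \<open>barR\<close>, equal
  to \<open>barL\<close>, starts with it.\<close>

lemma valid_xi_lamL:
  assumes "i < j" "j < k" "k \<le> r" "h"
  shows "valid (xi_lamL_rule i j k)"
  by (rule valid_by[where ps = "[
    (4, 0, xiw_cod_rule j k), (6, 1, flip (barL_rawL_rule False i j k)), (0, 2, triv (Eta True j)),
    (1, 1, triv (Lam True j k)), (2, 2, xi_lam i k), (5, 0, triv (Mu True j)), (6, 0, triv (Xi j)),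
    (7, 1, barL_lam_rule False i j k), (8, 1, flip (barR_barL_rule False i j k)), (4, 0, triv (Mu True j)),
    (5, 0, xi_lam i j), (6, 0, xiw_cod_rule i j), (8, 1, barR_barL_rule False i j k),
    (7, 2, flip (bar_idem_rule False j k)), (7, 2, flip (bar_idem_rule False j k))]"])
    (use assms in \<open>simp add: xi_lamL_rule_def bar_idem_rule_def barR_barL_rule_def barL_lam_rule_def
        barL_rawL_rule_def xiw_cod_rule_def derivation_simps\<close>,
     use assms in \<open>simp add: base_valid valid_bar_idem valid_barR_barL valid_barL_lam valid_barL_rawL
         valid_xiw_cod\<close>)

text \<open>Each idempotent on the triple absorbs the idempotent of its own merged pair, so both
  sides are the three components followed by the common idempotent.\<close>

lemma valid_xi_triple:
  assumes "i < j" "j < k" "k \<le> r" "h"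
  shows "valid (xi_triple_rule i j k)"
  by (rule valid_by[where ps = "[
    (1, 0, xiw_dom_rule i j), (1, 0, xiw_cod_rule i j), (3, 1, barR_barL_rule False i j k),
    (0, 1, flip (xiw_cod_rule j k)), (0, 1, flip (xiw_cod_rule j k))]"])
    (use assms in \<open>simp add: xi_triple_rule_def barR_barL_rule_def xiw_cod_rule_def xiw_dom_rule_def
        derivation_simps\<close>,
     use assms in \<open>simp add: base_valid valid_barR_barL valid_xiw_cod valid_xiw_dom\<close>)

end

section \<open>Merging two monads of a system\<close>

lemma retype_simps [simp]: "fst (retype x a b) = fst x" "snd (retype x a b) = (a, b)"
  by (simp_all add: retype_def)

lemma lic_cell_eqI:
  "fst x = fst y \<Longrightarrow> fst (snd x) = fst (snd y) \<Longrightarrow> snd (snd x) = snd (snd y)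
      \<Longrightarrow> x = y"
  by (simp add: prod_eq_iff)

lemma retype_arr2:
  assumes "x \<in> tc_arr2 (lic K)" "a \<in> tc_arr1 (lic K)" "b \<in> tc_arr1 (lic K)"
    "fst a = fst (fst (snd x))" "fst b = fst (snd (snd x))"
    "tc_vcomp K (snd b) (fst x) = fst x" "tc_vcomp K (fst x) (snd a) = fst x"
  shows "retype x a b \<in> tc_arr2 (lic K)"
  using assms by (simp add: lic_arr2)

locale lic_system = K: two_category K + weak_system "lic K" r h A mon lam v xi
  for K :: "('o, 'a, 'c) tcat" and r h and A :: "bool \<Rightarrow> 'o" and mon lam v xi
begin

abbreviation "L \<equiv> lic K"
abbreviation sc where "sc p i \<equiv> fst (mon p i)"

text \<open>A merged 1-cell has the idempotent \<open>bar\<close> as its identity 2-cell, so that 2-cells between merged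
  1-cells have the same first component as a 2-cell between the unmerged ones.\<close>

definition wcell :: "bool \<Rightarrow> nat \<Rightarrow> nat \<Rightarrow> 'a \<times> 'c" where
  "wcell p i j = (tc_comp1 K (fst (sc p i)) (fst (sc p j)), fst (ev (bar p i j)))"

definition wmonad :: "bool \<Rightarrow> nat \<Rightarrow> nat \<Rightarrow> ('a, 'c) lmon" where
  "wmonad p i j = (wcell p i j, retype (ev (wmult p i j)) (tc_comp1 L (wcell p i j) (wcell p i j)) (wcell p i j),
     retype (ev (wunit p i j)) (tc_id1 L (A p)) (wcell p i j))"

definition lawR where
  "lawR p i j k = retype (ev (lamR p i j k)) (tc_comp1 L (sc p k) (wcell p i j)) (tc_comp1 L (wcell p i j) (sc p k))"

definition lawL where
  "lawL p i j k = retype (ev (lamL p i j k)) (tc_comp1 L (wcell p j k) (sc p i)) (tc_comp1 L (sc p i) (wcell p j k))"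

definition xiM where
  "xiM i j = retype (ev (xiw i j)) (tc_comp1 L (wcell True i j) v) (tc_comp1 L v (wcell False i j))"

lemma split_simps:
  "fst (wmonad p i j) = wcell p i j"
  "fst (lawR p i j k) = fst (ev (lamR p i j k))"
  "snd (lawR p i j k) = (tc_comp1 L (sc p k) (wcell p i j), tc_comp1 L (wcell p i j) (sc p k))"
  "fst (lawL p i j k) = fst (ev (lamL p i j k))"
  "snd (lawL p i j k) = (tc_comp1 L (wcell p j k) (sc p i), tc_comp1 L (sc p i) (wcell p j k))"
  "fst (xiM i j) = fst (ev (xiw i j))"
  "snd (xiM i j) = (tc_comp1 L (wcell True i j) v, tc_comp1 L v (wcell False i j))"
  by (simp_all add: wmonad_def lawR_def lawL_def xiM_def)

lemma wmonad_wreath: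
  assumes "i < j" "j \<le> r" "p \<longrightarrow> h"
  shows "wreath K (A p) (mon p j) (mon p i) (lam p i j) = wmonad p i j"
  using ev_bar[OF assms]
  by (simp add: wreath_def wmonad_def wcell_def wmult_def wunit_def wl_def wr_def Let_def case_prod_unfold)

lemma sc_typed:
  assumes "i \<le> r" "p \<longrightarrow> h"
  shows "sc p i \<in> tc_arr1 L" "tc_src K (fst (sc p i)) = A p" "tc_trg K (fst (sc p i)) = A p"
    "fst (sc p i) \<in> tc_arr1 K"
  using lt_typed[of "S p i"] assms by (auto simp: lic_arr1)

lemma mon_typed:
  assumes "i \<le> r" "p \<longrightarrow> h"
  shows "fst (snd (mon p i)) \<in> tc_arr2 L" "snd (fst (snd (mon p i))) = (tc_comp1 L (sc p i) (sc p i), sc p i)"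
    "snd (snd (mon p i)) \<in> tc_arr2 L" "snd (snd (snd (mon p i))) = (tc_id1 L (A p), sc p i)"
  using mon[OF assms] by (auto simp: is_monad_def case_prod_unfold prod_eq_iff)

lemma lam_typed:
  assumes "i < j" "j \<le> r" "p \<longrightarrow> h"
  shows "lam p i j \<in> tc_arr2 L" "snd (lam p i j) = (tc_comp1 L (sc p j) (sc p i), tc_comp1 L (sc p i) (sc p j))"
  using wdl[OF assms] by (auto simp: is_wdl_def case_prod_unfold prod_eq_iff)

lemma A_ob' [simp]: "A p \<in> tc_ob K" using A_ob[of p] by simp

lemma ev_typed: "tmok (r, h) t \<Longrightarrow> cell (ttrg t) (tsrc t) (tdom t) (tcod t) (ev t)"
  using slices_sound cell_sem by metis

text \<open>Cells between merged 1-cells are retyped and have ends other than those in the rules, so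
  rules are transferred through their first components.\<close>

lemma valid_fst: "valid q \<Longrightarrow> fst (ev (fst q)) = fst (ev (snd q))"
  by (auto simp: valid_def)

lemmas ev_cell = ev_typed[unfolded cell_def, THEN conjunct2, THEN conjunct2]

context
  fixes p i j assumes ij: "i < j" "j \<le> r" "p \<longrightarrow> h"
begin

lemma sc_pair: "i \<le> r"
  using ij by simp

lemmas sc_ij = sc_typed[OF sc_pair ij(3)] sc_typed[OF ij(2,3)]

lemma ev_pair:
  "ev (bar p i j) \<in> tc_arr2 L"
  "snd (ev (bar p i j)) = (tc_comp1 L (sc p i) (sc p j), tc_comp1 L (sc p i) (sc p j))"
  "ev (wmult p i j) \<in> tc_arr2 L"
  "snd (ev (wmult p i j)) = (tc_comp1 L (sc p i) (tc_comp1 L (sc p j) (tc_comp1 L (sc p i) (sc p j))),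
     tc_comp1 L (sc p i) (sc p j))"
  "ev (wunit p i j) \<in> tc_arr2 L"
  "snd (ev (wunit p i j)) = (tc_id1 L (A p), tc_comp1 L (sc p i) (sc p j))"
  using ev_cell[of "bar p i j"] ev_cell[of "wmult p i j"] ev_cell[of "wunit p i j"] ij sc_ij
  by (auto simp: bar_def wmult_def wunit_def prod_eq_iff)

lemma wcell_typed: "wcell p i j \<in> tc_arr1 L" "tc_src K (fst (wcell p i j)) = A p" "tc_trg K (fst (wcell p i j)) = A p"
    "fst (wcell p i j) \<in> tc_arr1 K" "fst (wcell p i j) = tc_comp1 K (fst (sc p i)) (fst (sc p j))"
    "snd (wcell p i j) = fst (ev (bar p i j))"
proof -
  have "tc_vcomp K (fst (ev (bar p i j))) (fst (ev (bar p i j))) = fst (ev (bar p i j))"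
    using valid_bar_idem[OF ij, THEN valid_fst] by (simp add: bar_idem_rule_def)
  then show "wcell p i j \<in> tc_arr1 L" "tc_src K (fst (wcell p i j)) = A p" "tc_trg K (fst (wcell p i j)) = A p"
    "fst (wcell p i j) \<in> tc_arr1 K" "fst (wcell p i j) = tc_comp1 K (fst (sc p i)) (fst (sc p j))"
    "snd (wcell p i j) = fst (ev (bar p i j))"
    using ev_pair sc_ij by (auto simp: lic_arr2 lic_arr1 wcell_def)
qed

lemma wmonad_monad: "is_monad L (A p) (wmonad p i j)"
proof -
  note R = valid_wmult_bar[OF ij, THEN valid_fst] valid_wmult_bar_both[OF ij, THEN valid_fst]
    valid_wunit_bar[OF ij, THEN valid_fst]
    valid_wreath_assoc[OF ij, THEN valid_fst] valid_wreath_unit_right[OF ij, THEN valid_fst]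
    valid_wreath_unit_left[OF ij, THEN valid_fst]
  note R = R[unfolded wmult_bar_rule_def wmult_bar_both_rule_def wunit_bar_rule_def wreath_assoc_rule_def
    wreath_unit_right_rule_def wreath_unit_left_rule_def, simplified]
  note T = wcell_typed(1-4)
  have c: "tc_comp1 L (wcell p i j) (wcell p i j) \<in> tc_arr1 L"
    using T by simp
  have mu: "retype (ev (wmult p i j)) (tc_comp1 L (wcell p i j) (wcell p i j)) (wcell p i j) \<in> tc_arr2 L"
    using c R T sc_ij by (intro retype_arr2 ev_pair) (simp_all add: ev_pair wcell_typed(5,6) K.comp1_assoc)
  have et: "retype (ev (wunit p i j)) (tc_id1 L (A p)) (wcell p i j) \<in> tc_arr2 L"
    using R T ev_pair(5,6) by (intro retype_arr2 ev_pair) (simp_all add: ev_pair wcell_typed(5,6) lic_arr2)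
  show ?thesis
    unfolding is_monad_def wmonad_def case_prod_conv
    using T c mu et R
    by (auto intro!: lic_cell_eqI simp: wl_def wr_def wcell_typed(6) comp1_assoc)
qed

end

context
  fixes p i j k assumes ijk: "i < j" "j < k" "k \<le> r" "p \<longrightarrow> h"
begin

lemma triple_le: "i \<le> r" "j \<le> r" "i < k"
  using ijk by simp_all

lemmas wcell_ij = wcell_typed[OF ijk(1) triple_le(2) ijk(4)] and wcell_jk = wcell_typed[OF ijk(2,3,4)]
lemmas sc_ijk = sc_typed[OF triple_le(1) ijk(4)] sc_typed[OF triple_le(2) ijk(4)] sc_typed[OF ijk(3,4)]
lemmas mon_ijk = mon_typed[OF triple_le(1) ijk(4)] mon_typed[OF triple_le(2) ijk(4)] mon_typed[OF ijk(3,4)]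

lemma ev_triple:
  "ev (lamR p i j k) \<in> tc_arr2 L"
  "snd (ev (lamR p i j k)) = (tc_comp1 L (sc p k) (tc_comp1 L (sc p i) (sc p j)),
     tc_comp1 L (sc p i) (tc_comp1 L (sc p j) (sc p k)))"
  "ev (lamL p i j k) \<in> tc_arr2 L"
  "snd (ev (lamL p i j k)) = (tc_comp1 L (sc p j) (tc_comp1 L (sc p k) (sc p i)),
     tc_comp1 L (sc p i) (tc_comp1 L (sc p j) (sc p k)))"
  using ev_cell[of "lamR p i j k"] ev_cell[of "lamL p i j k"] ijk sc_ijk
  by (auto simp: bar_def lamR_def lamL_def prod_eq_iff)

lemma lawR_arr: "lawR p i j k \<in> tc_arr2 L" "snd (lawR p i j k) = (tc_comp1 L (sc p k) (wcell p i j), tc_comp1 L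
    (wcell p i j) (sc p k))"
proof -
  note R = valid_lamR_bar[OF ijk, THEN valid_fst, unfolded lamR_bar_rule_def, simplified]
    valid_bar_lamR[OF ijk, THEN valid_fst, unfolded bar_lamR_rule_def, simplified]
  show "lawR p i j k \<in> tc_arr2 L"
    unfolding lawR_def using R wcell_ij sc_ijk
    by (intro retype_arr2 ev_triple) (simp_all add: ev_triple K.comp1_assoc)
qed (simp add: lawR_def)

lemma lawL_arr: "lawL p i j k \<in> tc_arr2 L" "snd (lawL p i j k) = (tc_comp1 L (wcell p j k) (sc p i), tc_comp1 L
    (sc p i) (wcell p j k))"
proof -
  note R = valid_lamL_bar[OF ijk, THEN valid_fst, unfolded lamL_bar_rule_def, simplified]
    valid_bar_lamL[OF ijk, THEN valid_fst, unfolded bar_lamL_rule_def, simplified]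
  show "lawL p i j k \<in> tc_arr2 L"
    unfolding lawL_def using R wcell_jk sc_ijk
    by (intro retype_arr2 ev_triple) (simp_all add: ev_triple K.comp1_assoc)
qed (simp add: lawL_def)

lemma lawR_wdl: "is_wdl L (A p) (mon p k) (wmonad p i j) (lawR p i j k)"
proof -
  note R = valid_lamR_mult_left[OF ijk, THEN valid_fst, unfolded lamR_mult_left_rule_def, simplified]
    valid_lamR_mult_right[OF ijk, THEN valid_fst, unfolded lamR_mult_right_rule_def, simplified]
    valid_lamR_unit_left[OF ijk, THEN valid_fst, unfolded lamR_unit_left_rule_def, simplified]
    valid_lamR_unit_right[OF ijk, THEN valid_fst, unfolded lamR_unit_right_rule_def, simplified]
  have "is_monad L (A p) (wmonad p i j)" "is_monad L (A p) (mon p k)"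
    using wmonad_monad ijk mon by auto
  then show ?thesis
    unfolding is_wdl_def case_prod_unfold
    using R wcell_ij(1-4) lawR_arr sc_ijk mon_ijk
    by (auto intro!: lic_cell_eqI simp: wmonad_def lawR_def[of p i j k] wl_def wr_def wcell_ij(6) comp1_assoc)
qed

lemma lawL_wdl: "is_wdl L (A p) (wmonad p j k) (mon p i) (lawL p i j k)"
proof -
  note R = valid_lamL_mult_left[OF ijk, THEN valid_fst, unfolded lamL_mult_left_rule_def, simplified]
    valid_lamL_mult_right[OF ijk, THEN valid_fst, unfolded lamL_mult_right_rule_def, simplified]
    valid_lamL_unit_left[OF ijk, THEN valid_fst, unfolded lamL_unit_left_rule_def, simplified]
    valid_lamL_unit_right[OF ijk, THEN valid_fst, unfolded lamL_unit_right_rule_def, simplified]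
  have "is_monad L (A p) (wmonad p j k)" "is_monad L (A p) (mon p i)"
    using wmonad_monad ijk mon by auto
  then show ?thesis
    unfolding is_wdl_def case_prod_unfold
    using R wcell_jk(1-4) lawL_arr sc_ijk mon_ijk
    by (auto intro!: lic_cell_eqI simp: wmonad_def lawL_def[of p i j k] wl_def wr_def wcell_jk(6) comp1_assoc)
qed

text \<open>The origin of \<open>barR\<close>: the formula for the idempotent of a law, evaluated
  for a merged monad, with \<open>bar\<close> wherever the identity 2-cell of that monad
  stands.\<close>

lemma lambar_lawR: "fst (lambar L (mon p k) (wmonad p i j) (lawR p i j k)) = fst (ev (barR p i j k))"
  by (simp add: lambar_def case_prod_unfold wmonad_def wl_def wr_def lawR_def barR_def wcell_ij(6))

lemma lambar_lawL: "fst (lambar L (wmonad p j k) (mon p i) (lawL p i j k)) = fst (ev (barL p i j k))"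
  by (simp add: lambar_def case_prod_unfold wmonad_def wl_def wr_def lawL_def barL_def wcell_jk(6))

lemma barR_barL: "fst (ev (barR p i j k)) = fst (ev (barL p i j k))"
  using valid_barR_barL[OF ijk, THEN valid_fst] by (simp add: barR_barL_rule_def)

text \<open>Equality of the idempotents makes the two merged 1-cells equal. The ends of the
  structure 2-cells then coincide, and only first components remain to be compared.\<close>

lemma wreath_assoc:
  "wreath K (A p) (mon p k) (wmonad p i j) (lawR p i j k) = wreath K (A p) (wmonad p j k) (mon p i) (lawL p i j k)"
proof -
  note R = valid_triple_mult[OF ijk, THEN valid_fst, unfolded triple_mult_rule_def, simplified]
    valid_triple_unit[OF ijk, THEN valid_fst, unfolded triple_unit_rule_def, simplified]
  have u: "tc_comp1 K (fst (wcell p i j)) (fst (sc p k)) = tc_comp1 K (fst (sc p i)) (fst (wcell p j k))"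
    using sc_ijk by (simp add: wcell_ij(5) wcell_jk(5) K.comp1_assoc)
  show ?thesis
    using R lambar_lawR lambar_lawL barR_barL u
    by (simp add: wreath_def case_prod_unfold Let_def retype_def wmonad_def lawR_def lawL_def wl_def wr_def
        wcell_ij(6) wcell_jk(6))
qed

end

context
  fixes p i j k l assumes ijkl: "i < j" "j < k" "k < l" "l \<le> r" "p \<longrightarrow> h"
begin

lemma quadruple_le: "i \<le> r" "j \<le> r" "k \<le> r" "i < k" "j < l" "i < l"
  using ijkl by simp_all

lemmas sc_ijkl = sc_typed[OF quadruple_le(1) ijkl(5)] sc_typed[OF quadruple_le(2) ijkl(5)]
  sc_typed[OF quadruple_le(3) ijkl(5)] sc_typed[OF ijkl(4,5)]
lemmas wcell_quad_snd = wcell_typed(6)[OF ijkl(1) quadruple_le(2) ijkl(5)] wcell_typed(6)[OF ijkl(2) quadruple_le(3) ijkl(5)]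
  wcell_typed(6)[OF ijkl(3,4,5)]
lemmas wcell_quad_typed = wcell_typed(1-4)[OF ijkl(1) quadruple_le(2) ijkl(5)] wcell_typed(1-4)[OF ijkl(2)
    quadruple_le(3) ijkl(5)]
  wcell_typed(1-4)[OF ijkl(3,4,5)]
lemmas lam_quad = lam_typed[OF ijkl(1) quadruple_le(2) ijkl(5)] lam_typed[OF ijkl(3,4,5)]
  lam_typed[OF quadruple_le(6) ijkl(4,5)]

lemma yang_baxter_lawR_lawR:
  "tc_vcomp L (wr L (lawR p i j k) (sc p l)) (tc_vcomp L (wl L (sc p k) (lawR p i j l)) (wr L (lam p k l) (wcell p i j))) =
   tc_vcomp L (wl L (wcell p i j) (lam p k l)) (tc_vcomp L (wr L (lawR p i j l) (sc p k)) (wl L (sc p l) (lawR p i j k)))"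
  using sc_ijkl wcell_quad_typed lam_quad valid_yang_baxter_RR[OF ijkl, THEN valid_fst, unfolded
      yang_baxter_RR_rule_def, simplified]
  by (intro lic_cell_eqI) (simp_all add: wl_def wr_def lawR_def wcell_quad_snd comp1_assoc)

lemma yang_baxter_lawL_lawR:
  "tc_vcomp L (wr L (lawL p i j k) (sc p l)) (tc_vcomp L (wl L (wcell p j k) (lam p i l)) (wr L (lawR p j k l) (sc p i))) =
   tc_vcomp L (wl L (sc p i) (lawR p j k l)) (tc_vcomp L (wr L (lam p i l) (wcell p j k)) (wl L (sc p l) (lawL p i j k)))"
  using sc_ijkl wcell_quad_typed lam_quad valid_yang_baxter_lawR[OF ijkl, THEN valid_fst, unfolded
      yang_baxter_lawR_rule_def, simplified]
  by (intro lic_cell_eqI) (simp_all add: wl_def wr_def lawR_def lawL_def wcell_quad_snd comp1_assoc)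

lemma yang_baxter_lawL_lawL:
  "tc_vcomp L (wr L (lam p i j) (wcell p k l)) (tc_vcomp L (wl L (sc p j) (lawL p i k l)) (wr L (lawL p j k l) (sc p i))) =
   tc_vcomp L (wl L (sc p i) (lawL p j k l)) (tc_vcomp L (wr L (lawL p i k l) (sc p j)) (wl L (wcell p k l) (lam p i j)))"
  using sc_ijkl wcell_quad_typed lam_quad valid_yang_baxter_lawL[OF ijkl, THEN valid_fst, unfolded
      yang_baxter_lawL_rule_def, simplified]
  by (intro lic_cell_eqI) (simp_all add: wl_def wr_def lawL_def wcell_quad_snd comp1_assoc)

text \<open>Only first components are compared, because \<open>Cobj\<close> fixes the ends of its
  laws by \<open>retype\<close>; these ends agree once the two merged monads are known to be
  equal.\<close>

lemma triple_law:
  "fst (tc_vcomp L (wl L (wcell p i j) (lam p k l)) (tc_vcomp L (wr L (lawR p i j l) (sc p k))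
      (wl L (sc p l) (lambar L (mon p k) (wmonad p i j) (lawR p i j k))))) =
   fst (tc_vcomp L (wl L (sc p i) (lawR p j k l)) (tc_vcomp L (wr L (lam p i l) (wcell p j k))
      (wl L (sc p l) (lambar L (wmonad p j k) (mon p i) (lawL p i j k)))))"
  using valid_triple_law[OF ijkl, THEN valid_fst, unfolded triple_law_rule_def, simplified]
    lambar_lawR[OF ijkl(1,2) quadruple_le(3) ijkl(5)] lambar_lawL[OF ijkl(1,2) quadruple_le(3) ijkl(5)]
  by (simp add: wl_def wr_def lawR_def wcell_quad_snd)

lemma disjoint_law:
  "fst (tc_vcomp L (wl L (sc p i) (lawL p j k l)) (tc_vcomp L (wr L (lawL p i k l) (sc p j))
      (wl L (wcell p k l) (lambar L (mon p j) (mon p i) (lam p i j))))) =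
   fst (tc_vcomp L (wr L (lawR p i j k) (sc p l)) (tc_vcomp L (wl L (sc p k) (lawR p i j l))
      (wr L (lambar L (mon p l) (mon p k) (lam p k l)) (wcell p i j))))"
  using valid_disjoint_law[OF ijkl, THEN valid_fst, unfolded disjoint_law_rule_def, simplified]
    ev_bar[OF ijkl(1) quadruple_le(2) ijkl(5)] ev_bar[OF ijkl(3,4,5)]
  by (simp add: wl_def wr_def lawR_def lawL_def wcell_quad_snd)

end

section \<open>Merged components of 1-cells\<close>

context
  assumes h
begin

lemma v_typed: "v \<in> tc_arr1 L" "tc_src K (fst v) = A False" "tc_trg K (fst v) = A True" "fst v \<in> tc_arr1 K"
  using v \<open>h\<close> by (auto simp: lic_arr1)

lemma xi_typed:
  "i \<le> r \<Longrightarrow> xi i \<in> tc_arr2 L"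
  "i \<le> r \<Longrightarrow> snd (xi i) = (tc_comp1 L (sc True i) v, tc_comp1 L v (sc False i))"
  using xi[of i] \<open>h\<close> by (auto simp: is_mnd_mor_def case_prod_unfold prod_eq_iff)

context
  fixes i j assumes ij: "i < j" "j \<le> r"
begin

lemma pair_le: "i \<le> r" "p \<longrightarrow> h"
  using ij \<open>h\<close> by simp_all

lemmas wcell_mor = wcell_typed[OF ij pair_le(2)]
lemmas sc_mor = sc_typed[OF pair_le] sc_typed[OF ij(2) pair_le(2)]

lemma ev_xiw:
  "ev (xiw i j) \<in> tc_arr2 L"
  "snd (ev (xiw i j)) = (tc_comp1 L (sc True i) (tc_comp1 L (sc True j) v), tc_comp1 L v (tc_comp1 L (sc False i) (sc
      False j)))"
  using ev_cell[of "xiw i j"] ij \<open>h\<close> v_typed sc_mor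
  by (auto simp: bar_def xiw_def prod_eq_iff)

lemma xiM_arr: "xiM i j \<in> tc_arr2 L" "snd (xiM i j) = (tc_comp1 L (wcell True i j) v, tc_comp1 L v (wcell False i j))"
proof -
  note R = valid_xiw_cod[OF ij \<open>h\<close>, THEN valid_fst, unfolded xiw_cod_rule_def, simplified]
    valid_xiw_dom[OF ij \<open>h\<close>, THEN valid_fst, unfolded xiw_dom_rule_def, simplified]
  show "xiM i j \<in> tc_arr2 L"
    unfolding xiM_def using R wcell_mor v_typed sc_mor
    by (intro retype_arr2 ev_xiw) (simp_all add: ev_xiw K.comp1_assoc)
qed (simp add: xiM_def)

lemma xiM_mnd_mor: "is_mnd_mor L (wmonad False i j) (wmonad True i j) v (xiM i j)"
  unfolding is_mnd_mor_def case_prod_unfold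
  using xiM_arr v_typed wcell_mor(1-4) valid_xiw_mult[OF ij \<open>h\<close>, THEN valid_fst, unfolded
      xiw_mult_rule_def, simplified]
    valid_xiw_unit[OF ij \<open>h\<close>, THEN valid_fst, unfolded xiw_unit_rule_def, simplified]
  by (auto intro!: lic_cell_eqI simp: wmonad_def xiM_def[of i j] wl_def wr_def wcell_mor(6) comp1_assoc)

end

context
  fixes i j k assumes ijk: "i < j" "j < k" "k \<le> r"
begin

lemma triple_mor_le: "i \<le> r" "j \<le> r" "i < k" "p \<longrightarrow> h"
  using ijk \<open>h\<close> by simp_all

lemmas wcell_tri_typed = wcell_typed(1-4)[OF ijk(1) triple_mor_le(2,4)] wcell_typed(1-4)[OF ijk(2,3) triple_mor_le(4)]
lemmas wcell_tri_snd = wcell_typed(6)[OF ijk(1) triple_mor_le(2,4)] wcell_typed(6)[OF ijk(2,3) triple_mor_le(4)]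
lemmas sc_tri = sc_typed[OF triple_mor_le(1,4)] sc_typed[OF triple_mor_le(2,4)] sc_typed[OF ijk(3) triple_mor_le(4)]
lemmas lambar_tri = lambar_lawR[OF ijk triple_mor_le(4)] lambar_lawL[OF ijk triple_mor_le(4)]

lemma lambar_tri_snd:
  "snd (lambar L (mon p k) (wmonad p i j) (lawR p i j k)) =
     (tc_comp1 L (wcell p i j) (sc p k), tc_comp1 L (wcell p i j) (sc p k))"
  "snd (lambar L (wmonad p j k) (mon p i) (lawL p i j k)) =
     (tc_comp1 L (sc p i) (wcell p j k), tc_comp1 L (sc p i) (wcell p j k))"
  using wcell_tri_typed sc_tri mon_typed[OF ijk(3) triple_mor_le(4)] mon_typed[OF triple_mor_le(1,4)]
  by (simp_all add: lambar_def case_prod_unfold wmonad_def wl_def wr_def lawR_def lawL_def comp1_assoc)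

lemma xiM_wdl_mor_lawR:
  "wdl_mor_cond L (mon False k) (wmonad False i j) (lawR False i j k) (mon True k) (wmonad True i j) (lawR True i j
      k) v (xi k) (xiM i j)"
  unfolding wdl_mor_cond_def
  using wcell_tri_typed sc_tri v_typed xi_typed[OF ijk(3)] lambar_tri lambar_tri_snd
    valid_xi_lamR[OF ijk \<open>h\<close>, THEN valid_fst, unfolded xi_lamR_rule_def, simplified]
  by (intro lic_cell_eqI) (simp_all add: wl_def wr_def split_simps wcell_tri_snd comp1_assoc)

lemma xiM_wdl_mor_lawL:
  "wdl_mor_cond L (wmonad False j k) (mon False i) (lawL False i j k) (wmonad True j k) (mon True i) (lawL True i j
      k) v (xiM j k) (xi i)"
  unfolding wdl_mor_cond_def
  using wcell_tri_typed sc_tri v_typed xi_typed[OF triple_mor_le(1)] lambar_tri lambar_tri_snd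
    valid_xi_lamL[OF ijk \<open>h\<close>, THEN valid_fst, unfolded xi_lamL_rule_def, simplified]
  by (intro lic_cell_eqI) (simp_all add: wl_def wr_def split_simps wcell_tri_snd comp1_assoc)

lemma triple_xi:
  "fst (tc_vcomp L (wl L v (lambar L (mon False k) (wmonad False i j) (lawR False i j k)))
      (tc_vcomp L (wr L (xiM i j) (sc False k)) (wl L (wcell True i j) (xi k)))) =
   fst (tc_vcomp L (wl L v (lambar L (wmonad False j k) (mon False i) (lawL False i j k)))
      (tc_vcomp L (wr L (xi i) (wcell False j k)) (wl L (sc True i) (xiM j k))))"
  using lambar_tri valid_xi_triple[OF ijk \<open>h\<close>, THEN valid_fst, unfolded xi_triple_rule_def, simplified]
  by (simp add: wl_def wr_def xiM_def wcell_tri_snd)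

end

end

end

section \<open>The 2-functors $C_k$\<close>

lemma oldidx_Suc: "oldidx (Suc q) i = (if i < q then i else Suc i)"
  by (simp add: oldidx_def)

lemma nth_merge:
  "Suc q < length xs \<Longrightarrow> i < length xs - 1 \<Longrightarrow>
    (take q xs @ [y] @ drop (Suc (Suc q)) xs) ! i = (if i = q then y else xs ! oldidx (Suc q) i)"
  by (auto simp: nth_append oldidx_Suc min_def nth_Cons' not_less)

text \<open>The number \<open>q\<close> is \<open>k - 1\<close>. Writing \<open>k\<close> as
  \<open>Suc q\<close> from here on removes the truncated subtraction of the definitions of the
  functors.\<close>

definition merged :: "('o, 'a, 'c) tcat \<Rightarrow> nat \<Rightarrow> ('o, 'a \<times> 'c, ('a, 'c) l2) wobj
    \<Rightarrow> ('a, 'c) lmon" where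
  "merged K q X = wreath K (wA X) (wmon X ! Suc q) (wmon X ! q) (wlam X q (Suc q))"

definition merged_bar :: "('o, 'a, 'c) tcat \<Rightarrow> nat \<Rightarrow> ('o, 'a \<times> 'c, ('a, 'c) l2) wobj
    \<Rightarrow> ('a, 'c) l2" where
  "merged_bar K q X = lambar (lic K) (wmon X ! Suc q) (wmon X ! q) (wlam X q (Suc q))"

lemma Cobj_wA [simp]: "wA (Cobj K k X) = wA X"
  by (simp add: Cobj_def Let_def)

lemma Cobj_wmon:
  assumes "Suc q < length (wmon X)"
  shows "length (wmon (Cobj K (Suc q) X)) = length (wmon X) - 1"
    "i < length (wmon X) - 1 \<Longrightarrow>
      wmon (Cobj K (Suc q) X) ! i = (if i = q then merged K q X else wmon X ! oldidx (Suc q) i)"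
  using assms nth_merge[OF assms, of i "merged K q X"]
  by (simp_all add: Cobj_def Let_def merged_def)

lemma Cobj_wlam:
  assumes "Suc q < length (wmon X)"
  shows "wlam (Cobj K (Suc q) X) i j =
    (if i < j \<and> j < length (wmon X) - 1 then
       if i = q then
         retype (tc_vcomp (lic K) (wl (lic K) (fst (wmon X ! q)) (wlam X (Suc q) (Suc j)))
             (tc_vcomp (lic K) (wr (lic K) (wlam X q (Suc j)) (fst (wmon X ! Suc q)))
               (wl (lic K) (fst (wmon X ! Suc j)) (merged_bar K q X))))
           (tc_comp1 (lic K) (fst (wmon X ! Suc j)) (fst (merged K q X)))
           (tc_comp1 (lic K) (fst (merged K q X)) (fst (wmon X ! Suc j)))
       else if j = q then
         retype (tc_vcomp (lic K) (wr (lic K) (wlam X i q) (fst (wmon X ! Suc q)))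
             (tc_vcomp (lic K) (wl (lic K) (fst (wmon X ! q)) (wlam X i (Suc q)))
               (wr (lic K) (merged_bar K q X) (fst (wmon X ! i)))))
           (tc_comp1 (lic K) (fst (merged K q X)) (fst (wmon X ! i)))
           (tc_comp1 (lic K) (fst (wmon X ! i)) (fst (merged K q X)))
       else wlam X (oldidx (Suc q) i) (oldidx (Suc q) j)
     else undefined)"
proof -
  have "length (take q (wmon X) @ [merged K q X] @ drop (Suc (Suc q)) (wmon X)) = length (wmon X) - 1"
    using assms by simp
  then show ?thesis
    unfolding Cobj_def Let_def diff_Suc_1 merged_def[symmetric] merged_bar_def[symmetric]
    by (simp only: wobj.simps)
qed

lemma Cmor_simps:
  "wsrc (Cmor K k f) = Cobj K k (wsrc f)" "wtrg (Cmor K k f) = Cobj K k (wtrg f)" "wv (Cmor K k f) = wv f"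
  by (simp_all add: Cmor_def Let_def)

lemma Cmor_wxi:
  assumes "Suc q < length (wxi f)"
  shows "length (wxi (Cmor K (Suc q) f)) = length (wxi f) - 1"
    "i < length (wxi f) - 1 \<Longrightarrow> wxi (Cmor K (Suc q) f) ! i =
      (if i = q then
         retype (tc_vcomp (lic K) (wl (lic K) (wv f) (merged_bar K q (wsrc f)))
             (tc_vcomp (lic K) (wr (lic K) (wxi f ! q) (fst (wmon (wsrc f) ! Suc q)))
               (wl (lic K) (fst (wmon (wtrg f) ! q)) (wxi f ! Suc q))))
           (tc_comp1 (lic K) (fst (merged K q (wtrg f))) (wv f)) (tc_comp1 (lic K) (wv f) (fst (merged K q (wsrc f))))
       else wxi f ! oldidx (Suc q) i)"
  unfolding Cmor_def Let_def using assms nth_merge[OF assms, of i]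
  by (simp_all add: merged_bar_def merged_def)

lemma wobj_eqI:
  fixes X Y :: "('o, 'a, 'c) wobj"
  assumes "wA X = wA Y" "length (wmon X) = length (wmon Y)"
    "\<And>i. i < length (wmon Y) \<Longrightarrow> wmon X ! i = wmon Y ! i" "\<And>i j. wlam X i j = wlam Y i j"
  shows "X = Y"
  using assms by (intro wobj.equality nth_equalityI ext) auto

context lic_system
begin

text \<open>A record is tied to side \<open>p\<close> of the ambient system, so that the results on
  \<open>mon\<close> and \<open>lam\<close> apply to either end of a 1-cell.\<close>

definition represents :: "bool \<Rightarrow> ('o, 'a \<times> 'c, ('a, 'c) l2) wobj \<Rightarrow> bool" where
  "represents p X \<longleftrightarrow> (p \<longrightarrow> h) \<and> wA X = A p \<and> length (wmon X) = Suc r \<and>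
     (\<forall>i\<le>r. wmon X ! i = mon p i) \<and> wlam X = lam p"

context
  fixes p X q
  assumes X: "represents p X" and q: "q < r"
begin

lemma ph: "p \<longrightarrow> h"
  using X by (simp add: represents_def)

lemma X_simps: "wA X = A p" "length (wmon X) = Suc r" "i \<le> r \<Longrightarrow> wmon X ! i = mon p i" "wlam X = lam p"
  using X by (auto simp: represents_def)

lemma merged_wmonad: "merged K q X = wmonad p q (Suc q)"
  using wmonad_wreath[of q "Suc q" p] ph q by (simp add: merged_def X_simps)

lemma merged_bar_bar: "merged_bar K q X = ev (bar p q (Suc q))"
  using ev_bar[of q "Suc q" p] ph q by (simp add: merged_bar_def X_simps)

lemma lawR_eq:
  "Suc q < k \<Longrightarrow> lawR p q (Suc q) k =
    retype (tc_vcomp L (wl L (sc p q) (lam p (Suc q) k)) (tc_vcomp L (wr L (lam p q k) (sc p (Suc q)))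
      (wl L (sc p k) (merged_bar K q X)))) (tc_comp1 L (sc p k) (wcell p q (Suc q))) (tc_comp1 L (wcell p q (Suc q))
          (sc p k))"
  by (simp add: lawR_def lamR_def merged_bar_bar wl_def wr_def)

lemma lawL_eq:
  "i < q \<Longrightarrow> lawL p i q (Suc q) =
    retype (tc_vcomp L (wr L (lam p i q) (sc p (Suc q))) (tc_vcomp L (wl L (sc p q) (lam p i (Suc q)))
      (wr L (merged_bar K q X) (sc p i)))) (tc_comp1 L (wcell p q (Suc q)) (sc p i)) (tc_comp1 L (sc p i) (wcell p q
          (Suc q)))"
  by (simp add: lawL_def lamL_def merged_bar_bar wl_def wr_def)

lemma Cobj_fields:
  "length (wmon (Cobj K (Suc q) X)) = r"
  "i < r \<Longrightarrow> wmon (Cobj K (Suc q) X) ! i = (if i = q then wmonad p q (Suc q) else mon p (oldidx (Suc q) i))"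
  "wlam (Cobj K (Suc q) X) i j =
    (if i < j \<and> j < r then
       if i = q then lawR p q (Suc q) (Suc j) else if j = q then lawL p i q (Suc q)
       else lam p (oldidx (Suc q) i) (oldidx (Suc q) j)
     else undefined)"
  using q Cobj_wmon[where q = q and X = X and K = K] Cobj_wlam[where q = q and X = X and K = K and i = i and j = j]
      lawR_eq[of "Suc j"] lawL_eq[of i]
  by (auto simp: X_simps merged_wmonad wmonad_def oldidx_Suc)

lemma Cobj_wobj: "is_wobj L (r - 1) (Cobj K (Suc q) X)"
proof -
  let ?Y = "Cobj K (Suc q) X" and ?o = "oldidx (Suc q)"
  have o: "i < r \<Longrightarrow> ?o i \<le> r" "i < j \<Longrightarrow> ?o i < ?o j" for i j
    by (auto simp: oldidx_Suc)
  have lt: "i \<le> r - 1 \<longleftrightarrow> i < r" for i using q by auto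
  have 1: "is_monad L (wA ?Y) (wmon ?Y ! i)" if "i < r" for i
    using that Cobj_fields(2)[OF that] wmonad_monad[of q "Suc q" p] mon[of "?o i" p] ph o[of i] q by (simp add: X_simps)
  have 2: "is_wdl L (wA ?Y) (wmon ?Y ! j) (wmon ?Y ! i) (wlam ?Y i j)" if "i < j" "j < r" for i j
  proof -
    consider "i = q" | "j = q" | "i \<noteq> q" "j \<noteq> q" by auto
    then show ?thesis
    proof cases
      case 1
      then show ?thesis using that lawR_wdl[of q "Suc q" "Suc j" p] ph q
        by (simp add: Cobj_fields X_simps oldidx_Suc)
    next
      case 2
      then show ?thesis using that lawL_wdl[of i q "Suc q" p] ph q
        by (simp add: Cobj_fields X_simps oldidx_Suc)
    next
      case 3
      then show ?thesis using that wdl[of "?o i" "?o j" p] ph o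
        by (simp add: Cobj_fields X_simps)
    qed
  qed
  have 3: "tc_vcomp L (wr L (wlam ?Y i j) (fst (wmon ?Y ! k)))
        (tc_vcomp L (wl L (fst (wmon ?Y ! j)) (wlam ?Y i k)) (wr L (wlam ?Y j k) (fst (wmon ?Y ! i)))) =
      tc_vcomp L (wl L (fst (wmon ?Y ! i)) (wlam ?Y j k))
        (tc_vcomp L (wr L (wlam ?Y i k) (fst (wmon ?Y ! j))) (wl L (fst (wmon ?Y ! k)) (wlam ?Y i j)))"
    if "i < j" "j < k" "k < r" for i j k
  proof -
    \<comment> \<open>The indices increase strictly, so at most one of them is the merged position.
      It meets monads of higher index through \<open>lawR\<close> and those of lower index through
      \<open>lawL\<close>.\<close>
    consider "i = q" | "j = q" | "k = q" | "i \<noteq> q" "j \<noteq> q" "k \<noteq> q" by auto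
    then show ?thesis
    proof cases
      case 1
      then show ?thesis using that yang_baxter_lawR_lawR[of q "Suc q" "Suc j" "Suc k" p] ph q
        by (simp add: Cobj_fields split_simps(1) oldidx_Suc)
    next
      case 2
      then show ?thesis using that yang_baxter_lawL_lawR[of i q "Suc q" "Suc k" p] ph q
        by (simp add: Cobj_fields split_simps(1) oldidx_Suc)
    next
      case 3
      then show ?thesis using that yang_baxter_lawL_lawL[of i j q "Suc q" p] ph q
        by (simp add: Cobj_fields split_simps(1) oldidx_Suc)
    next
      case 4
      then show ?thesis using that yb[of "?o i" "?o j" "?o k" p] ph o
        by (simp add: Cobj_fields)
    qed
  qed
  show ?thesis
    unfolding is_wobj_def Let_def using 1 2 3 q Cobj_fields(1) by (auto simp: lt)
qed

end

section \<open>Commuting merges on 0-cells\<close>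

lemma merged_assoc:
  assumes X: "represents p X" and r: "Suc 0 < r"
  shows "merged K 0 (Cobj K (Suc (Suc 0)) X) = merged K 0 (Cobj K (Suc 0) X)"
proof -
  have 0: "0 < r" using r by simp
  have tri: "0 < Suc 0" "Suc 0 < Suc (Suc 0)" "Suc (Suc 0) \<le> r" using r by auto
  show ?thesis
    using wreath_assoc[OF tri ph[OF X r]] tri
    by (simp add: merged_def Cobj_fields[OF X r] Cobj_fields[OF X 0] X_simps[OF X r] oldidx_Suc)
qed

lemma merge_disjoint:
  assumes X: "represents p X" and q: "Suc q < r" "0 < q"
  shows "merged K 0 (Cobj K (Suc (Suc q)) X) = wmonad p 0 (Suc 0)"
    "merged K q (Cobj K (Suc 0) X) = wmonad p (Suc q) (Suc (Suc q))"
    "merged_bar K 0 (Cobj K (Suc (Suc q)) X) = lambar L (mon p (Suc 0)) (mon p 0) (lam p 0 (Suc 0))"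
    "merged_bar K q (Cobj K (Suc 0) X) = lambar L (mon p (Suc (Suc q))) (mon p (Suc q)) (lam p (Suc q) (Suc (Suc q)))"
    "merged_bar K 0 X = lambar L (mon p (Suc 0)) (mon p 0) (lam p 0 (Suc 0))"
    "merged_bar K (Suc q) X = lambar L (mon p (Suc (Suc q))) (mon p (Suc q)) (lam p (Suc q) (Suc (Suc q)))"
proof -
  have 0: "0 < r" using q by simp
  note N = Cobj_fields[OF X q(1)] and M = Cobj_fields[OF X 0]
  note XS = X_simps[OF X q(1)] and ph = ph[OF X q(1)]
  show "merged K 0 (Cobj K (Suc (Suc q)) X) = wmonad p 0 (Suc 0)"
    "merged K q (Cobj K (Suc 0) X) = wmonad p (Suc q) (Suc (Suc q))"
    using wmonad_wreath[of 0 "Suc 0" p] wmonad_wreath[of "Suc q" "Suc (Suc q)" p] ph q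
    by (simp_all add: merged_def N M XS oldidx_Suc)
  show "merged_bar K 0 (Cobj K (Suc (Suc q)) X) = lambar L (mon p (Suc 0)) (mon p 0) (lam p 0 (Suc 0))"
    "merged_bar K q (Cobj K (Suc 0) X) = lambar L (mon p (Suc (Suc q))) (mon p (Suc q)) (lam p (Suc q) (Suc (Suc q)))"
    "merged_bar K 0 X = lambar L (mon p (Suc 0)) (mon p 0) (lam p 0 (Suc 0))"
    "merged_bar K (Suc q) X = lambar L (mon p (Suc (Suc q))) (mon p (Suc q)) (lam p (Suc q) (Suc (Suc q)))"
    using q by (simp_all add: merged_bar_def N M XS oldidx_Suc)
qed

text \<open>Both composites gather three monads at position \<open>0\<close>. Laws between the
  remaining monads are copied, so only the laws out of position \<open>0\<close> have
  content.\<close>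

lemma Cobj_comm_0:
  assumes X: "represents p X" and r: "Suc 0 < r"
  shows "Cobj K (Suc 0) (Cobj K (Suc (Suc 0)) X) = Cobj K (Suc 0) (Cobj K (Suc 0) X)" (is "?P = ?Q")
proof -
  let ?N = "Cobj K (Suc (Suc 0)) X" and ?M = "Cobj K (Suc 0) X"
  have 0: "0 < r" using r by simp
  note N = Cobj_fields[OF X r] and M = Cobj_fields[OF X 0]
  note XS = X_simps[OF X r] and ph = ph[OF X r]
  have lN: "Suc 0 < length (wmon ?N)" and lM: "Suc 0 < length (wmon ?M)"
    using r by (simp_all add: N M)
  note P = Cobj_wmon[OF lN] Cobj_wlam[OF lN] and Q = Cobj_wmon[OF lM] Cobj_wlam[OF lM]
  have tri: "0 < Suc 0" "Suc 0 < Suc (Suc 0)" "Suc (Suc 0) \<le> r" using r by auto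
  note w = merged_assoc[OF X r]
  show ?thesis
  proof (rule wobj_eqI)
    fix i j
    have "wlam ?P 0 j = wlam ?Q 0 j" if "0 < j" "j < r - 1"
    proof -
      have j: "Suc (Suc 0) < Suc (Suc j)" "Suc (Suc j) \<le> r" "Suc j < r" using that by auto
      from triple_law[OF tri(1,2) j(1,2) ph] show ?thesis
        using that r j by (simp add: P Q N M w merged_bar_def retype_def oldidx_Suc split_simps(1))
    qed
    then show "wlam ?P i j = wlam ?Q i j"
      by (cases "i = 0") (auto simp: P Q N M oldidx_Suc)
  next
    show "length (wmon ?P) = length (wmon ?Q)"
      by (simp add: P(1) Q(1) N(1) M(1))
    show "wmon ?P ! i = wmon ?Q ! i" if "i < length (wmon ?Q)" for i
      using that by (auto simp: P(1,2) Q(1,2) N(1,2) M(1,2) w oldidx_Suc)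
  qed simp
qed

text \<open>The pairs \<open>0, 1\<close> and \<open>q + 1, q + 2\<close> are disjoint here. A law
  involving at most one of the merged monads is given by the same formula on both sides.\<close>

lemma Cobj_comm_Suc:
  assumes X: "represents p X" and q: "Suc q < r" and q0: "0 < q"
  shows "Cobj K (Suc 0) (Cobj K (Suc (Suc q)) X) = Cobj K (Suc q) (Cobj K (Suc 0) X)" (is "?P = ?Q")
proof -
  let ?N = "Cobj K (Suc (Suc q)) X" and ?M = "Cobj K (Suc 0) X"
  have 0: "0 < r" using q by simp
  note N = Cobj_fields[OF X q] and M = Cobj_fields[OF X 0]
  note XS = X_simps[OF X q] and ph = ph[OF X q]
  have lN: "Suc 0 < length (wmon ?N)" and lM: "Suc q < length (wmon ?M)"
    using q by (simp_all add: N M)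
  note P = Cobj_wmon[OF lN] Cobj_wlam[OF lN] and Q = Cobj_wmon[OF lM] Cobj_wlam[OF lM]
  note w1 = merge_disjoint(1,2)[OF X q q0] and w2 = merge_disjoint(3-6)[OF X q q0]
  note LR0 = lawR_eq[OF X 0, unfolded w2] and LRq = lawR_eq[OF X q, unfolded w2]
    and LLq = lawL_eq[OF X q, unfolded w2]
  show ?thesis
  proof (rule wobj_eqI)
    fix i j
    show "wlam ?P i j = wlam ?Q i j"
    proof (cases "i < j \<and> j < r - 1")
      case True
      consider "i = 0" "j = q" | "i = 0" "j \<noteq> q" | "0 < i" "i = q" | "0 < i" "j = q" | "0 < i" "i \<noteq> q"
          "j \<noteq> q" by auto
      then show ?thesis
      proof cases
        case 1
        \<comment> \<open>The law between the two merged monads: after both merges they sit at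
          positions \<open>0\<close> and \<open>q\<close>, as merging \<open>0, 1\<close> lowers the
          position of the other pair by one.\<close>
        have "0 < Suc 0" "Suc 0 < Suc q" "Suc q < Suc (Suc q)" "Suc (Suc q) \<le> r"
          using q q0 by auto
        from disjoint_law[OF this ph] 1 True q q0 show ?thesis
          by (simp add: P Q N M w1 w2 retype_def oldidx_Suc split_simps(1))
      next
        case 2
        then show ?thesis using True q q0 LR0
          by (auto simp: P Q N M w1 w2 oldidx_Suc split_simps(1))
      next
        case 3
        then show ?thesis using True q q0 LRq[of "Suc (Suc j)"]
          by (auto simp: P Q N M w1 w2 oldidx_Suc split_simps(1))
      next
        case 4
        then show ?thesis using True q q0 LLq[of "Suc i"]
          by (auto simp: P Q N M w1 w2 oldidx_Suc split_simps(1))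
      next
        case 5
        then show ?thesis using True q q0
          by (auto simp: P Q N M w1 w2 oldidx_Suc split_simps(1))
      qed
    next
      \<comment> \<open>Outside the range both sides take the default value
        \<open>undefined\<close>, so the records are equal as a whole.\<close>
      case False
      then show ?thesis by (auto simp: P(3) Q(3) N(1) M(1))
    qed
  next
    show "length (wmon ?P) = length (wmon ?Q)"
      by (simp add: P(1) Q(1) N(1) M(1))
    show "wmon ?P ! i = wmon ?Q ! i" if "i < length (wmon ?Q)" for i
      using that q q0 by (auto simp: P(1,2) Q(1,2) N(1,2) M(1,2) w1 oldidx_Suc)
  qed simp
qed

lemma Cobj_comm:
  "represents p X \<Longrightarrow> Suc q < r \<Longrightarrow>
    Cobj K (Suc 0) (Cobj K (Suc (Suc q)) X) = Cobj K (Suc q) (Cobj K (Suc 0) X)"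
  using Cobj_comm_0 Cobj_comm_Suc by (cases q) auto

section \<open>Merging and commutation on 1-cells\<close>

definition represents_mor :: "('o, 'a \<times> 'c, ('a, 'c) l2) wmor \<Rightarrow> bool" where
  "represents_mor f \<longleftrightarrow> represents False (wsrc f) \<and> represents True (wtrg f) \<and> wv f = v \<and>
     length (wxi f) = Suc r \<and> (\<forall>i\<le>r. wxi f ! i = xi i)"

context
  fixes f q
  assumes f: "represents_mor f" and q: "q < r"
begin

lemma f_simps: "represents False (wsrc f)" "represents True (wtrg f)" "wv f = v" "length (wxi f) = Suc r"
  "i \<le> r \<Longrightarrow> wxi f ! i = xi i" h
  using f by (auto simp: represents_mor_def) (auto simp: represents_def)

lemma xiM_eq:
  "xiM q (Suc q) = retype (tc_vcomp L (wl L v (merged_bar K q (wsrc f))) (tc_vcomp L (wr L (xi q) (sc False (Suc q)))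
      (wl L (sc True q) (xi (Suc q))))) (tc_comp1 L (wcell True q (Suc q)) v) (tc_comp1 L v (wcell False q (Suc q)))"
  by (simp add: xiM_def xiw_def merged_bar_bar[OF f_simps(1) q] wl_def wr_def)

lemma Cmor_fields:
  "length (wxi (Cmor K (Suc q) f)) = r"
  "i < r \<Longrightarrow> wxi (Cmor K (Suc q) f) ! i = (if i = q then xiM q (Suc q) else xi (oldidx (Suc q) i))"
  using q Cmor_wxi(1)[where q = q and f = f and K = K] Cmor_wxi(2)[where q = q and f = f and K = K and i = i] xiM_eq
  by (auto simp: f_simps X_simps[OF f_simps(1) q] X_simps[OF f_simps(2) q] merged_wmonad[OF f_simps(1) q]
      merged_wmonad[OF f_simps(2) q] wmonad_def oldidx_Suc)

lemma Cmor_wmor: "is_wmor L (r - 1) (Cmor K (Suc q) f)"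
proof -
  let ?g = "Cmor K (Suc q) f" and ?o = "oldidx (Suc q)"
  note F = Cobj_fields[OF f_simps(1) q] Cobj_fields[OF f_simps(2) q]
  have o: "i < r \<Longrightarrow> ?o i \<le> r" "i < j \<Longrightarrow> ?o i < ?o j" for i j
    by (auto simp: oldidx_Suc)
  have lt: "i \<le> r - 1 \<longleftrightarrow> i < r" for i using q by auto
  have 1: "is_mnd_mor L (wmon (wsrc ?g) ! i) (wmon (wtrg ?g) ! i) (wv ?g) (wxi ?g ! i)" if "i < r" for i
    using that xiM_mnd_mor[of q "Suc q"] xi[of "?o i"] f_simps(6) q o(1)[OF that]
    by (simp add: Cmor_simps F Cmor_fields f_simps(3))
  have 2: "wdl_mor_cond L (wmon (wsrc ?g) ! j) (wmon (wsrc ?g) ! i) (wlam (wsrc ?g) i j)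
      (wmon (wtrg ?g) ! j) (wmon (wtrg ?g) ! i) (wlam (wtrg ?g) i j) (wv ?g) (wxi ?g ! j) (wxi ?g ! i)"
    if "i < j" "j < r" for i j
  proof -
    consider "i = q" | "j = q" | "i \<noteq> q" "j \<noteq> q" by auto
    then show ?thesis
    proof cases
      case 1
      then show ?thesis using that xiM_wdl_mor_lawR[of q "Suc q" "Suc j"] f_simps(6) q
        by (simp add: Cmor_simps F Cmor_fields f_simps(3) oldidx_Suc)
    next
      case 2
      then show ?thesis using that xiM_wdl_mor_lawL[of i q "Suc q"] f_simps(6) q
        by (simp add: Cmor_simps F Cmor_fields f_simps(3) oldidx_Suc)
    next
      case 3
      then show ?thesis using that xi_wdl[of "?o i" "?o j"] f_simps(6) o
        by (simp add: Cmor_simps F Cmor_fields f_simps(3))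
    qed
  qed
  show ?thesis
    unfolding is_wmor_def
    using 1 2 q Cmor_fields(1) Cobj_wobj[OF f_simps(1) q] Cobj_wobj[OF f_simps(2) q] v f_simps(6)
    by (auto simp: lt Cmor_simps f_simps(3) X_simps[OF f_simps(1) q] X_simps[OF f_simps(2) q])
qed

end

text \<open>For overlapping merges the component of the triple is formed in two ways, compared by
  \<open>triple_xi\<close>; for disjoint merges every component is given by the same formula on both
  sides.\<close>

lemma Cmor_comm:
  assumes f: "represents_mor f" and q: "Suc q < r"
  shows "Cmor K (Suc 0) (Cmor K (Suc (Suc q)) f) = Cmor K (Suc q) (Cmor K (Suc 0) f)" (is "?P = ?Q")
proof -
  let ?N = "Cmor K (Suc (Suc q)) f" and ?M = "Cmor K (Suc 0) f"
  have 0: "0 < r" using q by simp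
  note fs = f_simps[OF f q]
  note N = Cmor_fields[OF f q] and M = Cmor_fields[OF f 0]
  note NO = Cobj_fields[OF fs(1) q] Cobj_fields[OF fs(2) q] and MO = Cobj_fields[OF fs(1) 0] Cobj_fields[OF fs(2) 0]
  have lN: "Suc 0 < length (wxi ?N)" and lM: "Suc q < length (wxi ?M)"
    using q by (simp_all add: N M)
  note P = Cmor_wxi[OF lN] and Q = Cmor_wxi[OF lM]
  have "wxi ?P = wxi ?Q"
  proof (rule nth_equalityI)
    fix i assume "i < length (wxi ?P)"
    then have i: "i < r - 1" "i < r" "Suc i < r" using lN N by (auto simp: P)
    show "wxi ?P ! i = wxi ?Q ! i"
    proof (cases "q = 0")
      case True
      have tri: "0 < Suc 0" "Suc 0 < Suc (Suc 0)" "Suc (Suc 0) \<le> r" using q by auto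
      note w = merged_assoc[OF fs(1) q[unfolded True]] merged_assoc[OF fs(2) q[unfolded True]]
      show ?thesis
        using i q w triple_xi[OF fs(6) tri]
        by (auto simp: P[unfolded True] Q[unfolded True] N[unfolded True] M NO[unfolded True] MO True Cmor_simps fs
            merged_bar_def retype_def oldidx_Suc split_simps(1))
    next
      case False
      then have q0: "0 < q" by simp
      note w = merge_disjoint[OF fs(1) q q0] merge_disjoint[OF fs(2) q q0]
      note X = xiM_eq[OF f q, unfolded w] xiM_eq[OF f 0, unfolded w]
      show ?thesis
        using i q q0 X
        by (auto simp: P Q N M NO MO Cmor_simps fs w oldidx_Suc split_simps(1))
    qed
  next
    show "length (wxi ?P) = length (wxi ?Q)"
      by (simp add: P(1) Q(1) N(1) M(1))
  qed
  then show ?thesis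
    using Cobj_comm[OF fs(1) q] Cobj_comm[OF fs(2) q]
    by (intro wmor.equality) (simp_all add: Cmor_simps)
qed

end

text \<open>There is no 1-cell, so \<open>h\<close> is false and \<open>v\<close> and
  \<open>xi\<close> may be \<open>undefined\<close>. The data of \<open>X\<close> are put at both
  booleans because \<open>A_ob\<close> is assumed for each of them.\<close>

lemma wobj_system:
  assumes K: "twocat K" and X: "is_wobj (lic K) m X"
  shows "lic_system K m False (\<lambda>_. wA X) (\<lambda>_ i. wmon X ! i) (\<lambda>_. wlam X) undefined undefined"
    and "lic_system.represents m False (\<lambda>_. wA X) (\<lambda>_ i. wmon X ! i) (\<lambda>_. wlam X) False X"
proof -
  have "wA X \<in> tc_ob K"
    using X by (auto simp: is_wobj_def is_monad_def case_prod_unfold)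
  then show s: "lic_system K m False (\<lambda>_. wA X) (\<lambda>_ i. wmon X ! i) (\<lambda>_. wlam X) undefined undefined"
    by unfold_locales (use K twocat_lic[OF K] X in \<open>auto simp: is_wobj_def Let_def\<close>)
  show "lic_system.represents m False (\<lambda>_. wA X) (\<lambda>_ i. wmon X ! i) (\<lambda>_. wlam X) False X"
    using X by (simp add: lic_system.represents_def[OF s] is_wobj_def)
qed

text \<open>The function \<open>Z\<close> places the two ends of \<open>f\<close> at the booleans
  used in the diagrams; together with the components of \<open>f\<close> they satisfy the
  assumptions of the system with \<open>h\<close> true.\<close>

lemma wmor_system:
  fixes K f
  defines "Z \<equiv> \<lambda>p. if p then wtrg f else wsrc f"
  assumes K: "twocat K" and f: "is_wmor (lic K) m f"
  shows "lic_system K m True (\<lambda>p. wA (Z p)) (\<lambda>p i. wmon (Z p) ! i) (\<lambda>p. wlam (Z p)) (wv f)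
      (\<lambda>i. wxi f ! i)"
    and "lic_system.represents_mor m True (\<lambda>p. wA (Z p)) (\<lambda>p i. wmon (Z p) ! i) (\<lambda>p. wlam (Z
        p)) (wv f) (\<lambda>i. wxi f ! i) f"
proof -
  have Z: "is_wobj (lic K) m (Z p)" for p
    using f by (simp add: Z_def is_wmor_def)
  then have "is_monad (lic K) (wA (Z p)) (wmon (Z p) ! 0)" for p
    by (simp add: is_wobj_def)
  then have A: "wA (Z p) \<in> tc_ob K" for p
    by (simp add: is_monad_def case_prod_unfold)
  show s: "lic_system K m True (\<lambda>p. wA (Z p)) (\<lambda>p i. wmon (Z p) ! i) (\<lambda>p. wlam (Z p)) (wv f)
      (\<lambda>i. wxi f ! i)"
    by unfold_locales (use K twocat_lic[OF K] Z A f in \<open>auto simp: is_wobj_def is_wmor_def Let_def\<close>,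
        auto simp: Z_def)
  show "lic_system.represents_mor m True (\<lambda>p. wA (Z p)) (\<lambda>p i. wmon (Z p) ! i) (\<lambda>p. wlam (Z
      p)) (wv f) (\<lambda>i. wxi f ! i) f"
    using f Z[of True] Z[of False]
    by (simp add: lic_system.represents_def[OF s] lic_system.represents_mor_def[OF s] is_wmor_def is_wobj_def) (simp
        add: Z_def)
qed

section \<open>Independence of the indices\<close>

lemma composites_agree:
  fixes C :: "nat \<Rightarrow> 'x \<Rightarrow> 'x" and P :: "nat \<Rightarrow> 'x \<Rightarrow> bool"
  assumes pres: "\<And>m q x. P (Suc m) x \<Longrightarrow> q \<le> m \<Longrightarrow> P m (C (Suc q) x)"
    and comm: "\<And>m q x. P (Suc m) x \<Longrightarrow> q < m \<Longrightarrow> C (Suc 0) (C (Suc (Suc q)) x) = C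
        (Suc q) (C (Suc 0) x)"
  shows "admissible n ks \<Longrightarrow> admissible n ks' \<Longrightarrow> P n x \<Longrightarrow> foldr C ks x =
      foldr C ks' x"
proof -
  have adm: "\<exists>js q. ks = js @ [Suc q] \<and> q \<le> m \<and> admissible m js" if "admissible (Suc m) ks" for m ks
  proof -
    have l: "length ks = Suc m" and b: "\<forall>i<Suc m. 1 \<le> ks ! i \<and> ks ! i \<le> Suc i"
      using that by (auto simp: admissible_def)
    define js where "js = butlast ks"
    have k: "ks = js @ [last ks]" using l unfolding js_def by (metis append_butlast_last_id list.size(3) nat.simps(3))
    have lj: "length js = m" using l by (simp add: js_def)
    have "ks ! m = last ks" using k lj by (metis nth_append_length)
    then obtain q where q: "last ks = Suc q" "q \<le> m" using b by (metis lessI Suc_le_D Suc_le_mono One_nat_def)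
    have "\<forall>i<m. 1 \<le> js ! i \<and> js ! i \<le> Suc i"
      using b k lj by (metis less_SucI nth_append)
    then show ?thesis using k q lj by (auto simp: admissible_def)
  qed
  have adm_rep: "admissible m (replicate m (Suc 0))" for m
    by (simp add: admissible_def)
  have admI: "admissible (Suc m) (js @ [Suc q])" if "admissible m js" "q \<le> m" for m js q
    using that by (auto simp: admissible_def nth_append less_Suc_eq)
  have main: "admissible n ks \<Longrightarrow> P n x \<Longrightarrow> foldr C ks x = foldr C (replicate n (Suc 0))
      x" for ks
  proof (induction n arbitrary: ks x)
    case 0
    then show ?case by (simp add: admissible_def)
  next
    case (Suc n)
    obtain js q where ks: "ks = js @ [Suc q]" and q: "q \<le> n" and js: "admissible n js"
      using adm[OF Suc.prems(1)] by blast
    have p: "P n (C (Suc q) x)" "P n (C (Suc 0) x)" using pres Suc.prems(2) q by auto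
    have rep: "replicate (Suc k) (Suc 0) = replicate k (Suc 0) @ [Suc 0]" for k
      by (simp add: replicate_append_same)
    have e: "foldr C ks x = foldr C (replicate n (Suc 0)) (C (Suc q) x)"
      using Suc.IH[OF js p(1)] by (simp add: ks)
    show ?case
    proof (cases q)
      case 0
      then show ?thesis using e by (simp only: rep) simp
    next
      case (Suc s)
      then obtain m where m: "n = Suc m" and s: "s \<le> m" using q by (cases n) auto
      \<comment> \<open>The outer factors are already all \<open>C (Suc 0)\<close>. Exchanging the
        last of them with \<open>C (Suc (Suc s))\<close> puts \<open>C (Suc 0)\<close> innermost;
        the induction hypothesis then applies again, at \<open>C (Suc 0) x\<close>, to an admissible
        list ending in \<open>Suc s\<close>.\<close>
      have "foldr C (replicate n (Suc 0)) (C (Suc q) x) = foldr C (replicate m (Suc 0)) (C (Suc 0) (C (Suc (Suc s)) x))"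
        unfolding m rep Suc by simp
      also have "\<dots> = foldr C (replicate m (Suc 0) @ [Suc s]) (C (Suc 0) x)"
        using comm[OF Suc.prems(2), of s] s m by simp
      also have "\<dots> = foldr C (replicate n (Suc 0)) (C (Suc 0) x)"
        using Suc.IH[OF _ p(2), of "replicate m (Suc 0) @ [Suc s]"] admI[OF adm_rep s] m by simp
      also have "\<dots> = foldr C (replicate (Suc n) (Suc 0)) x"
        unfolding rep by simp
      finally show ?thesis using e by simp
    qed
  qed
  show "admissible n ks \<Longrightarrow> admissible n ks' \<Longrightarrow> P n x \<Longrightarrow> foldr C ks x =
      foldr C ks' x"
    using main[of ks] main[of ks'] by simp
qed

text \<open>The underlying 2-cell never changes, so agreement on 2-cells follows from agreement on
  the 1-cells that bound them.\<close>

lemma foldr_C2cell: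
  "foldr (C2cell K) ks \<alpha> =
     \<lparr>w2s = foldr (Cmor K) ks (w2s \<alpha>), w2c = w2c \<alpha>, w2t = foldr (Cmor K) ks (w2t \<alpha>)\<rparr>"
  by (induction ks) (simp_all add: C2cell_def)

theorem theorem2p10:
  fixes K :: "('o, 'a, 'c) tcat" and n :: nat and ks ks' :: "nat list"
  assumes "twocat K" and "0 < n"
    and "admissible n ks" and "admissible n ks'"
  shows "(\<forall>X. is_wobj (lic K) n X \<longrightarrow> foldr (Cobj K) ks X = foldr (Cobj K) ks' X) \<and>
         (\<forall>f. is_wmor (lic K) n f \<longrightarrow> foldr (Cmor K) ks f = foldr (Cmor K) ks' f) \<and>
         (\<forall>\<alpha>. is_w2cell (lic K) n \<alpha> \<longrightarrow> foldr (C2cell K) ks \<alpha> = foldr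
             (C2cell K) ks' \<alpha>)"
proof -
  have obj: "foldr (Cobj K) ks X = foldr (Cobj K) ks' X" if "is_wobj (lic K) n X" for X
  proof (rule composites_agree[where P = "is_wobj (lic K)", OF _ _ assms(3,4) that])
    fix m q X assume X: "is_wobj (lic K) (Suc m) X"
    note sys = wobj_system[OF assms(1) X]
    show "q \<le> m \<Longrightarrow> is_wobj (lic K) m (Cobj K (Suc q) X)"
      using lic_system.Cobj_wobj[OF sys, of q] by simp
    show "q < m \<Longrightarrow> Cobj K (Suc 0) (Cobj K (Suc (Suc q)) X) = Cobj K (Suc q) (Cobj K (Suc 0) X)"
      using lic_system.Cobj_comm[OF sys, of q] by simp
  qed
  have mor: "foldr (Cmor K) ks f = foldr (Cmor K) ks' f" if "is_wmor (lic K) n f" for f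
  proof (rule composites_agree[where P = "is_wmor (lic K)", OF _ _ assms(3,4) that])
    fix m q f assume f: "is_wmor (lic K) (Suc m) f"
    note sys = wmor_system[OF assms(1) f]
    show "q \<le> m \<Longrightarrow> is_wmor (lic K) m (Cmor K (Suc q) f)"
      using lic_system.Cmor_wmor[OF sys, of q] by simp
    show "q < m \<Longrightarrow> Cmor K (Suc 0) (Cmor K (Suc (Suc q)) f) = Cmor K (Suc q) (Cmor K (Suc 0) f)"
      using lic_system.Cmor_comm[OF sys, of q] by simp
  qed
  show ?thesis
    using obj mor by (auto simp: foldr_C2cell is_w2cell_def)
qed

end
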